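(* Let $\mathcal C$ be a braided pivotal category, $\mathcal M$ a pivotal category, $\Phi^{\mathcal Z}:\mathcal C\to\mathcal Z(\mathcal M)$ a braided pivotal functor, $\Phi=F\circ\Phi^{\mathcal Z}:\mathcal C\to\mathcal M$ with $F:\mathcal Z(\mathcal M)\to\mathcal M$ the forgetful functor, and let $\mathrm{Tr}_{\mathcal C}:\mathcal M\to\mathcal C$ be the right adjoint of $\Phi$. Then for all $x,y\in\mathcal M$, $$\tau_{x,y}\circ\mu_{x,y}=\mu_{y,x}\circ\beta_{\mathrm{Tr}_{\mathcal C}(x),\mathrm{Tr}_{\mathcal C}(y)}\circ(\mathrm{id}_{\mathrm{Tr}_{\mathcal C}(x)}\otimes\theta_{\mathrm{Tr}_{\mathcal C}(y)}),$$ and similarly $$\tau^-_{x,y}\circ\mu_{x,y}=\mu_{y,x}\circ\beta^-_{\mathrm{Tr}_{\mathcal C}(x),\mathrm{Tr}_{\mathcal C}(y)}\circ(\theta^{-1}_{\mathrm{Tr}_{\mathcal C}(x)}\otimes\mathrm{id}_{\mathrm{Tr}_{\mathcal C}(y)}).$$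
   Context: Tensor functors are strong monoidal; associators, unitors and the isomorphisms $\Phi(c)\otimes\Phi(d)\cong\Phi(c\otimes d)$, $1\cong\Phi(1)$ are suppressed. Duals: $\mathrm{ev}_a:a^*\otimes a\to1$, $\mathrm{coev}_a:1\to a\otimes a^*$ satisfying the zig-zag equations. Pivotal: rigid with a monoidal natural isomorphism $\varphi_a:a\to a^{**}$. A tensor functor $G$ between pivotal categories has canonical isomorphisms $\delta_x:G(x^* )\to G(x)^*$; it is pivotal if $G(\varphi_x)=\delta_{x^*}^{-1}\circ\delta_x^*\circ\varphi_{G(x)}$. In a braided category with braiding $\beta_{a,b}:a\otimes b\to b\otimes a$ write $\beta^-_{a,b}=\beta_{b,a}^{-1}$. A braided pivotal category carries the twist $$\theta_a=(\mathrm{id}_a\otimes\mathrm{ev}_{a^*})\circ(\beta_{a^{**},a}\otimes\mathrm{id}_{a^*})\circ(\mathrm{id}_{a^{**}}\otimes\mathrm{coev}_a)\circ\varphi_a:a\to a.$$ The Drinfel'd center $\mathcal Z(\mathcal M)$ has as objects pairs $(a,e_a)$ with $e_{a,b}:a\otimes b\to b\otimes a$ isomorphisms natural in $b$ satisfying $e_{a,b\otimes c}=(\mathrm{id}_b\otimes e_{a,c})\circ(e_{a,b}\otimes\mathrm{id}_c)$; morphisms are morphisms of $\mathcal M$ commuting with the half-braidings; $e_{a\otimes b,c}=(e_{a,c}\otimes\mathrm{id}_b)\circ(\mathrm{id}_a\otimes e_{b,c})$; the braiding is $\beta_{(a,e_a),(b,e_b)}=e_{a,b}$; it is pivotal with the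 same $\varphi_a$. For $c\in\mathcal C$, $y\in\mathcal M$ one has $e_{\Phi(c),y}:\Phi(c)\otimes y\to y\otimes\Phi(c)$. Let $\varepsilon_x:\Phi(\mathrm{Tr}_{\mathcal C}(x))\to x$ be the counit of $\Phi\dashv\mathrm{Tr}_{\mathcal C}$. The mate of $g:c\to\mathrm{Tr}_{\mathcal C}(x)$ is $\varepsilon_x\circ\Phi(g):\Phi(c)\to x$. The multiplication map $\mu_{x,y}:\mathrm{Tr}_{\mathcal C}(x)\otimes\mathrm{Tr}_{\mathcal C}(y)\to\mathrm{Tr}_{\mathcal C}(x\otimes y)$ is the morphism whose mate is $\varepsilon_x\otimes\varepsilon_y$. Let $\widetilde{\mathrm{ev}}_y=\mathrm{ev}_{y^*}\circ(\varphi_y\otimes\mathrm{id}_{y^*}):y\otimes y^*\to1$. The traciator $\tau_{x,y}:\mathrm{Tr}_{\mathcal C}(x\otimes y)\to\mathrm{Tr}_{\mathcal C}(y\otimes x)$ is the morphism whose mate is, with $c=\mathrm{Tr}_{\mathcal C}(x\otimes y)$, $$(\mathrm{id}_{y\otimes x}\otimes\widetilde{\mathrm{ev}}_y)\circ(\mathrm{id}_y\otimes\varepsilon_{x\otimes y}\otimes\mathrm{id}_{y^*})\circ(e_{\Phi(c),y}\otimes\mathrm{id}_{y^*})\circ(\mathrm{id}_{\Phi(c)}\otimes\mathrm{coev}_y).$$ It is invertible; put $\tau^-_{x,y}=\tau_{y,x}^{-1}$. *)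

theory Defs
  imports Main "HOL-Library.FuncSet"
begin

section \<open>Categories and functors\<close>

text \<open>Operations are only meaningful on objects in \<open>Obj\<close> and on composable arrows in \<open>Arr\<close>;
  their values elsewhere are unconstrained.  Composition is written in applicative order.\<close>

record ('o, 'm) cat =
  Obj :: "'o set"
  Arr :: "'m set"
  Src :: "'m \<Rightarrow> 'o"
  Tgt :: "'m \<Rightarrow> 'o"
  Ide :: "'o \<Rightarrow> 'm"  (\<open>ide\<index>\<close>)
  Comp :: "'m \<Rightarrow> 'm \<Rightarrow> 'm"  (infixr \<open>\<cdot>\<index>\<close> 55)

definition Hom :: "('o, 'm, 'z) cat_scheme \<Rightarrow> 'o \<Rightarrow> 'o \<Rightarrow> 'm set" where
  "Hom C a b = {f \<in> Arr C. Src C f = a \<and> Tgt C f = b}"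

locale category =
  fixes C :: "('o, 'm, 'z) cat_scheme" (structure)
  assumes src_obj: "f \<in> Arr C \<Longrightarrow> Src C f \<in> Obj C"
    and tgt_obj: "f \<in> Arr C \<Longrightarrow> Tgt C f \<in> Obj C"
    and ide_hom: "a \<in> Obj C \<Longrightarrow> ide a \<in> Hom C a a"
    and comp_hom: "\<lbrakk>f \<in> Hom C a b; g \<in> Hom C b c\<rbrakk> \<Longrightarrow> g \<cdot> f \<in> Hom C a c"
    and comp_ide_right: "f \<in> Hom C a b \<Longrightarrow> f \<cdot> ide a = f"
    and comp_ide_left: "f \<in> Hom C a b \<Longrightarrow> ide b \<cdot> f = f"
    and comp_assoc: "\<lbrakk>f \<in> Hom C a b; g \<in> Hom C b c; h \<in> Hom C c d\<rbrakk>
                      \<Longrightarrow> (h \<cdot> g) \<cdot> f = h \<cdot> (g \<cdot> f)"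

context
  fixes C :: "('o, 'm, 'z) cat_scheme" (structure)
begin

definition inverse_arrows :: "'m \<Rightarrow> 'm \<Rightarrow> bool" where
  "inverse_arrows f g \<longleftrightarrow> f \<in> Arr C \<and> g \<in> Hom C (Tgt C f) (Src C f)
     \<and> g \<cdot> f = ide (Src C f) \<and> f \<cdot> g = ide (Tgt C f)"

definition is_iso :: "'m \<Rightarrow> bool" where
  "is_iso f \<longleftrightarrow> (\<exists>g. inverse_arrows f g)"

definition inv_arrow :: "'m \<Rightarrow> 'm" where
  "inv_arrow f = (THE g. inverse_arrows f g)"

end

notation inv_arrow (\<open>(_\<^sup>\<inverse>\<index>)\<close> [1000] 999)

record ('o, 'm, 'p, 'n) cfun =
  OMap :: "'o \<Rightarrow> 'p"
  AMap :: "'m \<Rightarrow> 'n"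

locale cat_functor =
  fixes C :: "('o, 'm, 'y) cat_scheme" and D :: "('p, 'n, 'z) cat_scheme"
    and F :: "('o, 'm, 'p, 'n, 'w) cfun_scheme"
  assumes omap: "a \<in> Obj C \<Longrightarrow> OMap F a \<in> Obj D"
    and amap: "f \<in> Hom C a b \<Longrightarrow> AMap F f \<in> Hom D (OMap F a) (OMap F b)"
    and map_ide: "a \<in> Obj C \<Longrightarrow> AMap F (ide\<^bsub>C\<^esub> a) = ide\<^bsub>D\<^esub> (OMap F a)"
    and map_comp: "\<lbrakk>f \<in> Hom C a b; g \<in> Hom C b c\<rbrakk>
                    \<Longrightarrow> AMap F (g \<cdot>\<^bsub>C\<^esub> f) = AMap F g \<cdot>\<^bsub>D\<^esub> AMap F f"

text \<open>\<open>T\<close> is right adjoint to \<open>F\<close>, with unit \<open>\<eta>\<close> and counit \<open>\<epsilon>\<close>.\<close>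

locale adjunction =
  F: cat_functor C D F + T: cat_functor D C T
  for C :: "('o, 'm, 'y) cat_scheme" and D :: "('p, 'n, 'z) cat_scheme"
    and F :: "('o, 'm, 'p, 'n, 'v) cfun_scheme" and T :: "('p, 'n, 'o, 'm, 'w) cfun_scheme"
    and \<eta> :: "'o \<Rightarrow> 'm" and \<epsilon> :: "'p \<Rightarrow> 'n" +
  assumes unit_hom: "c \<in> Obj C \<Longrightarrow> \<eta> c \<in> Hom C c (OMap T (OMap F c))"
    and unit_natural: "f \<in> Hom C c d \<Longrightarrow> \<eta> d \<cdot>\<^bsub>C\<^esub> f = AMap T (AMap F f) \<cdot>\<^bsub>C\<^esub> \<eta> c"
    and counit_hom: "x \<in> Obj D \<Longrightarrow> \<epsilon> x \<in> Hom D (OMap F (OMap T x)) x"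
    and counit_natural: "g \<in> Hom D x y \<Longrightarrow> \<epsilon> y \<cdot>\<^bsub>D\<^esub> AMap F (AMap T g) = g \<cdot>\<^bsub>D\<^esub> \<epsilon> x"
    and triangle_left: "c \<in> Obj C \<Longrightarrow> \<epsilon> (OMap F c) \<cdot>\<^bsub>D\<^esub> AMap F (\<eta> c) = ide\<^bsub>D\<^esub> (OMap F c)"
    and triangle_right: "x \<in> Obj D \<Longrightarrow> AMap T (\<epsilon> x) \<cdot>\<^bsub>C\<^esub> \<eta> (OMap T x) = ide\<^bsub>C\<^esub> (OMap T x)"


section \<open>Monoidal categories and tensor functors\<close>

text \<open>No strictness is assumed.  The arrows \<open>\<a> a b c : (a \<otimes> b) \<otimes> c \<rightarrow> a \<otimes> (b \<otimes> c)\<close>,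
  \<open>\<l> a : 1 \<otimes> a \<rightarrow> a\<close> and \<open>\<r> a : a \<otimes> 1 \<rightarrow> a\<close> are the associators and unitors;
  \<open>f \<odot> g\<close> is the tensor product of arrows.\<close>

record ('o, 'm) moncat = "('o, 'm) cat" +
  TensO :: "'o \<Rightarrow> 'o \<Rightarrow> 'o"  (infixr \<open>\<otimes>\<index>\<close> 70)
  TensA :: "'m \<Rightarrow> 'm \<Rightarrow> 'm"  (infixr \<open>\<odot>\<index>\<close> 70)
  Unit :: 'o  (\<open>\<one>\<index>\<close>)
  Assoc :: "'o \<Rightarrow> 'o \<Rightarrow> 'o \<Rightarrow> 'm"  (\<open>\<a>\<index>\<close>)
  Lunit :: "'o \<Rightarrow> 'm"  (\<open>\<l>\<index>\<close>)
  Runit :: "'o \<Rightarrow> 'm"  (\<open>\<r>\<index>\<close>)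

locale monoidal_category = category C
  for C :: "('o, 'm, 'z) moncat_scheme" (structure) +
  assumes tensor_obj: "\<lbrakk>a \<in> Obj C; b \<in> Obj C\<rbrakk> \<Longrightarrow> a \<otimes> b \<in> Obj C"
    and tensor_hom: "\<lbrakk>f \<in> Hom C a b; g \<in> Hom C c d\<rbrakk> \<Longrightarrow> f \<odot> g \<in> Hom C (a \<otimes> c) (b \<otimes> d)"
    and tensor_ide: "\<lbrakk>a \<in> Obj C; b \<in> Obj C\<rbrakk> \<Longrightarrow> ide a \<odot> ide b = ide (a \<otimes> b)"
    and tensor_comp: "\<lbrakk>f \<in> Hom C a b; g \<in> Hom C b c; f' \<in> Hom C a' b'; g' \<in> Hom C b' c'\<rbrakk>
           \<Longrightarrow> (g \<cdot> f) \<odot> (g' \<cdot> f') = (g \<odot> g') \<cdot> (f \<odot> f')"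
    and unit_obj: "\<one> \<in> Obj C"
    and assoc_hom: "\<lbrakk>a \<in> Obj C; b \<in> Obj C; c \<in> Obj C\<rbrakk>
           \<Longrightarrow> \<a> a b c \<in> Hom C ((a \<otimes> b) \<otimes> c) (a \<otimes> (b \<otimes> c))"
    and assoc_iso: "\<lbrakk>a \<in> Obj C; b \<in> Obj C; c \<in> Obj C\<rbrakk> \<Longrightarrow> is_iso C (\<a> a b c)"
    and assoc_natural: "\<lbrakk>f \<in> Hom C a a'; g \<in> Hom C b b'; h \<in> Hom C c c'\<rbrakk>
           \<Longrightarrow> \<a> a' b' c' \<cdot> ((f \<odot> g) \<odot> h) = (f \<odot> (g \<odot> h)) \<cdot> \<a> a b c"
    and lunit_hom: "a \<in> Obj C \<Longrightarrow> \<l> a \<in> Hom C (\<one> \<otimes> a) a"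
    and lunit_iso: "a \<in> Obj C \<Longrightarrow> is_iso C (\<l> a)"
    and lunit_natural: "f \<in> Hom C a b \<Longrightarrow> \<l> b \<cdot> (ide \<one> \<odot> f) = f \<cdot> \<l> a"
    and runit_hom: "a \<in> Obj C \<Longrightarrow> \<r> a \<in> Hom C (a \<otimes> \<one>) a"
    and runit_iso: "a \<in> Obj C \<Longrightarrow> is_iso C (\<r> a)"
    and runit_natural: "f \<in> Hom C a b \<Longrightarrow> \<r> b \<cdot> (f \<odot> ide \<one>) = f \<cdot> \<r> a"
    and pentagon: "\<lbrakk>a \<in> Obj C; b \<in> Obj C; c \<in> Obj C; d \<in> Obj C\<rbrakk>
           \<Longrightarrow> \<a> a b (c \<otimes> d) \<cdot> \<a> (a \<otimes> b) c d
             = (ide a \<odot> \<a> b c d) \<cdot> \<a> a (b \<otimes> c) d \<cdot> (\<a> a b c \<odot> ide d)"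
    and triangle: "\<lbrakk>a \<in> Obj C; b \<in> Obj C\<rbrakk>
           \<Longrightarrow> (ide a \<odot> \<l> b) \<cdot> \<a> a \<one> b = \<r> a \<odot> ide b"

text \<open>\<open>Ten F a b : F a \<otimes> F b \<rightarrow> F (a \<otimes> b)\<close> and \<open>Uni F : 1 \<rightarrow> F 1\<close> are the structure isomorphisms
  of a strong monoidal functor.\<close>

record ('o, 'm, 'p, 'n) tfun = "('o, 'm, 'p, 'n) cfun" +
  Ten :: "'o \<Rightarrow> 'o \<Rightarrow> 'n"
  Uni :: 'n

locale tensor_functor = cat_functor C D F
  for C :: "('o, 'm, 'y) moncat_scheme" and D :: "('p, 'n, 'z) moncat_scheme"
    and F :: "('o, 'm, 'p, 'n, 'w) tfun_scheme" +
  assumes ten_hom: "\<lbrakk>a \<in> Obj C; b \<in> Obj C\<rbrakk>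
           \<Longrightarrow> Ten F a b \<in> Hom D (OMap F a \<otimes>\<^bsub>D\<^esub> OMap F b) (OMap F (a \<otimes>\<^bsub>C\<^esub> b))"
    and ten_iso: "\<lbrakk>a \<in> Obj C; b \<in> Obj C\<rbrakk> \<Longrightarrow> is_iso D (Ten F a b)"
    and ten_natural: "\<lbrakk>f \<in> Hom C a a'; g \<in> Hom C b b'\<rbrakk>
           \<Longrightarrow> Ten F a' b' \<cdot>\<^bsub>D\<^esub> (AMap F f \<odot>\<^bsub>D\<^esub> AMap F g) = AMap F (f \<odot>\<^bsub>C\<^esub> g) \<cdot>\<^bsub>D\<^esub> Ten F a b"
    and uni_hom: "Uni F \<in> Hom D \<one>\<^bsub>D\<^esub> (OMap F \<one>\<^bsub>C\<^esub>)"
    and uni_iso: "is_iso D (Uni F)"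
    and ten_assoc: "\<lbrakk>a \<in> Obj C; b \<in> Obj C; c \<in> Obj C\<rbrakk>
           \<Longrightarrow> AMap F (\<a>\<^bsub>C\<^esub> a b c) \<cdot>\<^bsub>D\<^esub> Ten F (a \<otimes>\<^bsub>C\<^esub> b) c \<cdot>\<^bsub>D\<^esub> (Ten F a b \<odot>\<^bsub>D\<^esub> ide\<^bsub>D\<^esub> (OMap F c))
             = Ten F a (b \<otimes>\<^bsub>C\<^esub> c) \<cdot>\<^bsub>D\<^esub> (ide\<^bsub>D\<^esub> (OMap F a) \<odot>\<^bsub>D\<^esub> Ten F b c)
                 \<cdot>\<^bsub>D\<^esub> \<a>\<^bsub>D\<^esub> (OMap F a) (OMap F b) (OMap F c)"
    and ten_lunit: "a \<in> Obj C
           \<Longrightarrow> AMap F (\<l>\<^bsub>C\<^esub> a) \<cdot>\<^bsub>D\<^esub> Ten F \<one>\<^bsub>C\<^esub> a \<cdot>\<^bsub>D\<^esub> (Uni F \<odot>\<^bsub>D\<^esub> ide\<^bsub>D\<^esub> (OMap F a)) = \<l>\<^bsub>D\<^esub> (OMap F a)"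
    and ten_runit: "a \<in> Obj C
           \<Longrightarrow> AMap F (\<r>\<^bsub>C\<^esub> a) \<cdot>\<^bsub>D\<^esub> Ten F a \<one>\<^bsub>C\<^esub> \<cdot>\<^bsub>D\<^esub> (ide\<^bsub>D\<^esub> (OMap F a) \<odot>\<^bsub>D\<^esub> Uni F) = \<r>\<^bsub>D\<^esub> (OMap F a)"

definition id_tfun :: "('o, 'm, 'z) moncat_scheme \<Rightarrow> ('o, 'm, 'o, 'm) tfun" where
  "id_tfun C = \<lparr>OMap = \<lambda>a. a, AMap = \<lambda>f. f, Ten = \<lambda>a b. ide\<^bsub>C\<^esub> (a \<otimes>\<^bsub>C\<^esub> b), Uni = ide\<^bsub>C\<^esub> \<one>\<^bsub>C\<^esub>\<rparr>"

text \<open>The composite \<open>G \<circ> F\<close>; \<open>E\<close> is the target category of \<open>G\<close>.\<close>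

definition comp_tfun :: "('q, 'k, 'z) moncat_scheme \<Rightarrow> ('p, 'n, 'q, 'k) tfun
    \<Rightarrow> ('o, 'm, 'p, 'n) tfun \<Rightarrow> ('o, 'm, 'q, 'k) tfun" where
  "comp_tfun E G F =
    \<lparr>OMap = \<lambda>a. OMap G (OMap F a),
     AMap = \<lambda>f. AMap G (AMap F f),
     Ten = \<lambda>a b. AMap G (Ten F a b) \<cdot>\<^bsub>E\<^esub> Ten G (OMap F a) (OMap F b),
     Uni = AMap G (Uni F) \<cdot>\<^bsub>E\<^esub> Uni G\<rparr>"

locale monoidal_natural_iso =
  fixes C :: "('o, 'm, 'y) moncat_scheme" and D :: "('p, 'n, 'z) moncat_scheme"
    and F :: "('o, 'm, 'p, 'n, 'v) tfun_scheme" and G :: "('o, 'm, 'p, 'n, 'w) tfun_scheme"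
    and \<phi> :: "'o \<Rightarrow> 'n"
  assumes component_hom: "a \<in> Obj C \<Longrightarrow> \<phi> a \<in> Hom D (OMap F a) (OMap G a)"
    and component_iso: "a \<in> Obj C \<Longrightarrow> is_iso D (\<phi> a)"
    and natural: "f \<in> Hom C a b \<Longrightarrow> \<phi> b \<cdot>\<^bsub>D\<^esub> AMap F f = AMap G f \<cdot>\<^bsub>D\<^esub> \<phi> a"
    and monoidal: "\<lbrakk>a \<in> Obj C; b \<in> Obj C\<rbrakk>
           \<Longrightarrow> \<phi> (a \<otimes>\<^bsub>C\<^esub> b) \<cdot>\<^bsub>D\<^esub> Ten F a b = Ten G a b \<cdot>\<^bsub>D\<^esub> (\<phi> a \<odot>\<^bsub>D\<^esub> \<phi> b)"
    and monoidal_unit: "\<phi> \<one>\<^bsub>C\<^esub> \<cdot>\<^bsub>D\<^esub> Uni F = Uni G"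


section \<open>Duals and pivotal structures\<close>

record ('o, 'm) pivcat = "('o, 'm) moncat" +
  Dual :: "'o \<Rightarrow> 'o"
  Ev :: "'o \<Rightarrow> 'm"
  Coev :: "'o \<Rightarrow> 'm"
  Piv :: "'o \<Rightarrow> 'm"

locale rigid_category = monoidal_category C
  for C :: "('o, 'm, 'z) pivcat_scheme" (structure) +
  assumes dual_obj: "a \<in> Obj C \<Longrightarrow> Dual C a \<in> Obj C"
    and ev_hom: "a \<in> Obj C \<Longrightarrow> Ev C a \<in> Hom C (Dual C a \<otimes> a) \<one>"
    and coev_hom: "a \<in> Obj C \<Longrightarrow> Coev C a \<in> Hom C \<one> (a \<otimes> Dual C a)"
    and zigzag_obj: "a \<in> Obj C \<Longrightarrow>
           \<r> a \<cdot> (ide a \<odot> Ev C a) \<cdot> \<a> a (Dual C a) a \<cdot> (Coev C a \<odot> ide a) \<cdot> (\<l> a)\<^sup>\<inverse> = ide a"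
    and zigzag_dual: "a \<in> Obj C \<Longrightarrow>
           \<l> (Dual C a) \<cdot> (Ev C a \<odot> ide (Dual C a)) \<cdot> (\<a> (Dual C a) a (Dual C a))\<^sup>\<inverse>
             \<cdot> (ide (Dual C a) \<odot> Coev C a) \<cdot> (\<r> (Dual C a))\<^sup>\<inverse> = ide (Dual C a)"

context
  fixes C :: "('o, 'm, 'z) pivcat_scheme" (structure)
begin

text \<open>The arrow \<open>u \<rightarrow> v\<^sup>*\<close> corresponding to a pairing \<open>p : u \<otimes> v \<rightarrow> 1\<close>, i.e. the unique \<open>h\<close> with
  \<open>ev\<^sub>v \<circ> (h \<otimes> id) = p\<close>.\<close>

definition curry_pairing :: "'o \<Rightarrow> 'o \<Rightarrow> 'm \<Rightarrow> 'm" where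
  "curry_pairing u v p =
     \<l> (Dual C v) \<cdot> (p \<odot> ide (Dual C v)) \<cdot> (\<a> u v (Dual C v))\<^sup>\<inverse> \<cdot> (ide u \<odot> Coev C v) \<cdot> (\<r> u)\<^sup>\<inverse>"

definition dual_arrow :: "'m \<Rightarrow> 'm" where
  "dual_arrow f = curry_pairing (Dual C (Tgt C f)) (Src C f)
                    (Ev C (Tgt C f) \<cdot> (ide (Dual C (Tgt C f)) \<odot> f))"

text \<open>The canonical isomorphisms \<open>b\<^sup>* \<otimes> a\<^sup>* \<rightarrow> (a \<otimes> b)\<^sup>*\<close> and \<open>1 \<rightarrow> 1\<^sup>*\<close>.\<close>

definition dual_ten :: "'o \<Rightarrow> 'o \<Rightarrow> 'm" where
  "dual_ten a b = curry_pairing (Dual C b \<otimes> Dual C a) (a \<otimes> b)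
     (Ev C b \<cdot> (ide (Dual C b) \<odot> (\<l> b \<cdot> (Ev C a \<odot> ide b) \<cdot> (\<a> (Dual C a) a b)\<^sup>\<inverse>))
       \<cdot> \<a> (Dual C b) (Dual C a) (a \<otimes> b))"

definition dual_uni :: 'm where
  "dual_uni = curry_pairing \<one> \<one> (\<l> \<one>)"

definition double_dual :: "('o, 'm, 'o, 'm) tfun" where
  "double_dual =
    \<lparr>OMap = \<lambda>a. Dual C (Dual C a),
     AMap = \<lambda>f. dual_arrow (dual_arrow f),
     Ten = \<lambda>a b. dual_arrow ((dual_ten a b)\<^sup>\<inverse>) \<cdot> dual_ten (Dual C b) (Dual C a),
     Uni = dual_arrow (dual_uni\<^sup>\<inverse>) \<cdot> dual_uni\<rparr>"

definition ev_tilde :: "'o \<Rightarrow> 'm" where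
  "ev_tilde y = Ev C (Dual C y) \<cdot> (Piv C y \<odot> ide (Dual C y))"

end

text \<open>Only left duals are part of the structure; the pivotal structure makes \<open>a\<^sup>*\<close> a right dual
  of \<open>a\<close> as well.\<close>

locale pivotal_category = rigid_category C
  for C :: "('o, 'm, 'z) pivcat_scheme" (structure) +
  assumes pivotal: "monoidal_natural_iso C C (id_tfun C) (double_dual C) (Piv C)"

text \<open>The canonical isomorphism \<open>\<delta>\<^sub>x : G (x\<^sup>*) \<rightarrow> G (x)\<^sup>*\<close>.\<close>

definition dual_comparison :: "('o, 'm, 'y) pivcat_scheme \<Rightarrow> ('p, 'n, 'z) pivcat_scheme
    \<Rightarrow> ('o, 'm, 'p, 'n, 'w) tfun_scheme \<Rightarrow> 'o \<Rightarrow> 'n" where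
  "dual_comparison C D G x = curry_pairing D (OMap G (Dual C x)) (OMap G x)
     ((Uni G)\<^sup>\<inverse>\<^bsub>D\<^esub> \<cdot>\<^bsub>D\<^esub> AMap G (Ev C x) \<cdot>\<^bsub>D\<^esub> Ten G (Dual C x) x)"

locale pivotal_functor = tensor_functor C D G
  for C :: "('o, 'm, 'y) pivcat_scheme" and D :: "('p, 'n, 'z) pivcat_scheme"
    and G :: "('o, 'm, 'p, 'n, 'w) tfun_scheme" +
  assumes map_piv: "x \<in> Obj C \<Longrightarrow>
     AMap G (Piv C x) = (dual_comparison C D G (Dual C x))\<^sup>\<inverse>\<^bsub>D\<^esub>
       \<cdot>\<^bsub>D\<^esub> dual_arrow D (dual_comparison C D G x) \<cdot>\<^bsub>D\<^esub> Piv D (OMap G x)"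


section \<open>Braidings and the twist\<close>

record ('o, 'm) bpivcat = "('o, 'm) pivcat" +
  Braid :: "'o \<Rightarrow> 'o \<Rightarrow> 'm"  (\<open>\<beta>\<index>\<close>)

locale braided_pivotal_category = pivotal_category C
  for C :: "('o, 'm, 'z) bpivcat_scheme" (structure) +
  assumes braid_hom: "\<lbrakk>a \<in> Obj C; b \<in> Obj C\<rbrakk> \<Longrightarrow> \<beta> a b \<in> Hom C (a \<otimes> b) (b \<otimes> a)"
    and braid_iso: "\<lbrakk>a \<in> Obj C; b \<in> Obj C\<rbrakk> \<Longrightarrow> is_iso C (\<beta> a b)"
    and braid_natural: "\<lbrakk>f \<in> Hom C a a'; g \<in> Hom C b b'\<rbrakk>
           \<Longrightarrow> \<beta> a' b' \<cdot> (f \<odot> g) = (g \<odot> f) \<cdot> \<beta> a b"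
    and hexagon_right: "\<lbrakk>a \<in> Obj C; b \<in> Obj C; c \<in> Obj C\<rbrakk>
           \<Longrightarrow> \<a> b c a \<cdot> \<beta> a (b \<otimes> c) \<cdot> \<a> a b c
             = (ide b \<odot> \<beta> a c) \<cdot> \<a> b a c \<cdot> (\<beta> a b \<odot> ide c)"
    and hexagon_left: "\<lbrakk>a \<in> Obj C; b \<in> Obj C; c \<in> Obj C\<rbrakk>
           \<Longrightarrow> (\<a> c a b)\<^sup>\<inverse> \<cdot> \<beta> (a \<otimes> b) c \<cdot> (\<a> a b c)\<^sup>\<inverse>
             = (\<beta> a c \<odot> ide b) \<cdot> (\<a> a c b)\<^sup>\<inverse> \<cdot> (ide a \<odot> \<beta> b c)"

locale braided_pivotal_functor = pivotal_functor C D G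
  for C :: "('o, 'm, 'y) bpivcat_scheme" and D :: "('p, 'n, 'z) bpivcat_scheme"
    and G :: "('o, 'm, 'p, 'n, 'w) tfun_scheme" +
  assumes map_braid: "\<lbrakk>a \<in> Obj C; b \<in> Obj C\<rbrakk>
     \<Longrightarrow> AMap G (\<beta>\<^bsub>C\<^esub> a b) \<cdot>\<^bsub>D\<^esub> Ten G a b = Ten G b a \<cdot>\<^bsub>D\<^esub> \<beta>\<^bsub>D\<^esub> (OMap G a) (OMap G b)"

context
  fixes C :: "('o, 'm, 'z) bpivcat_scheme" (structure)
begin

definition braid_minus :: "'o \<Rightarrow> 'o \<Rightarrow> 'm" where
  "braid_minus a b = (\<beta> b a)\<^sup>\<inverse>"

definition twist :: "'o \<Rightarrow> 'm" where
  "twist a = (let a' = Dual C a; a'' = Dual C a' in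
     \<r> a \<cdot> (ide a \<odot> Ev C a') \<cdot> \<a> a a'' a' \<cdot> (\<beta> a'' a \<odot> ide a')
       \<cdot> (\<a> a'' a a')\<^sup>\<inverse> \<cdot> (ide a'' \<odot> Coev C a) \<cdot> (\<r> a'')\<^sup>\<inverse> \<cdot> Piv C a)"

end

notation braid_minus (\<open>\<beta>\<^sup>-\<index>\<close>)
notation twist (\<open>\<theta>\<index>\<close>)


section \<open>The Drinfeld center\<close>

text \<open>Half-braidings are required to be \<open>extensional\<close> so that an object of the center is determined
  by the values \<open>e b\<close> for \<open>b \<in> Obj M\<close>.\<close>

context
  fixes M :: "('p, 'n, 'z) moncat_scheme" (structure)
begin

definition half_braiding :: "'p \<Rightarrow> ('p \<Rightarrow> 'n) \<Rightarrow> bool" where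
  "half_braiding a e \<longleftrightarrow> e \<in> extensional (Obj M)
     \<and> (\<forall>b\<in>Obj M. e b \<in> Hom M (a \<otimes> b) (b \<otimes> a) \<and> is_iso M (e b))
     \<and> (\<forall>b\<in>Obj M. \<forall>c\<in>Obj M. \<forall>f\<in>Hom M b c. e c \<cdot> (ide a \<odot> f) = (f \<odot> ide a) \<cdot> e b)
     \<and> (\<forall>b\<in>Obj M. \<forall>c\<in>Obj M.
          \<a> b c a \<cdot> e (b \<otimes> c) \<cdot> \<a> a b c = (ide b \<odot> e c) \<cdot> \<a> b a c \<cdot> (e b \<odot> ide c))"

definition center_obj :: "('p \<times> ('p \<Rightarrow> 'n)) set" where
  "center_obj = {(a, e). a \<in> Obj M \<and> half_braiding a e}"

text \<open>Arrows of the center are arrows of \<open>M\<close> tagged with their source and target.\<close>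

definition center_arr ::
    "(('p \<times> ('p \<Rightarrow> 'n)) \<times> 'n \<times> ('p \<times> ('p \<Rightarrow> 'n))) set" where
  "center_arr = {((a, e), f, (a', e')).
     (a, e) \<in> center_obj \<and> (a', e') \<in> center_obj \<and> f \<in> Hom M a a'
     \<and> (\<forall>b\<in>Obj M. e' b \<cdot> (f \<odot> ide b) = (ide b \<odot> f) \<cdot> e b)}"

definition center_tensor ::
    "'p \<times> ('p \<Rightarrow> 'n) \<Rightarrow> 'p \<times> ('p \<Rightarrow> 'n) \<Rightarrow> 'p \<times> ('p \<Rightarrow> 'n)" where
  "center_tensor X Y = (case (X, Y) of ((a, e), (b, e')) \<Rightarrow>
     (a \<otimes> b, \<lambda>c\<in>Obj M. \<a> c a b \<cdot> (e c \<odot> ide b) \<cdot> (\<a> a c b)\<^sup>\<inverse> \<cdot> (ide a \<odot> e' c) \<cdot> \<a> a b c))"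

definition center_unit :: "'p \<times> ('p \<Rightarrow> 'n)" where
  "center_unit = (\<one>, \<lambda>b\<in>Obj M. (\<r> b)\<^sup>\<inverse> \<cdot> \<l> b)"

end

context
  fixes M :: "('p, 'n, 'z) pivcat_scheme" (structure)
begin

text \<open>The half-braiding on the dual \<open>a\<^sup>*\<close> is
  \<open>(ev\<^sub>a \<otimes> id) \<circ> (id \<otimes> e\<^sub>b\<^sup>-\<^sup>1 \<otimes> id) \<circ> (id \<otimes> coev\<^sub>a) : a\<^sup>* \<otimes> b \<rightarrow> b \<otimes> a\<^sup>*\<close>, the only one for which
  \<open>ev\<^sub>a\<close> and \<open>coev\<^sub>a\<close> are arrows of the center.\<close>

definition center_dual :: "'p \<times> ('p \<Rightarrow> 'n) \<Rightarrow> 'p \<times> ('p \<Rightarrow> 'n)" where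
  "center_dual X = (case X of (a, e) \<Rightarrow> let a' = Dual M a in
     (a', \<lambda>b\<in>Obj M. (\<l> b \<odot> ide a') \<cdot> ((Ev M a \<odot> ide b) \<odot> ide a')
        \<cdot> ((\<a> a' a b)\<^sup>\<inverse> \<odot> ide a') \<cdot> ((ide a' \<odot> (e b)\<^sup>\<inverse>) \<odot> ide a')
        \<cdot> (\<a> a' b a \<odot> ide a') \<cdot> (\<a> (a' \<otimes> b) a a')\<^sup>\<inverse> \<cdot> (ide (a' \<otimes> b) \<odot> Coev M a)
        \<cdot> (\<r> (a' \<otimes> b))\<^sup>\<inverse>))"

definition center ::
    "('p \<times> ('p \<Rightarrow> 'n), ('p \<times> ('p \<Rightarrow> 'n)) \<times> 'n \<times> ('p \<times> ('p \<Rightarrow> 'n))) bpivcat" where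
  "center =
    \<lparr>Obj = center_obj M,
     Arr = center_arr M,
     Src = \<lambda>(X, f, Y). X,
     Tgt = \<lambda>(X, f, Y). Y,
     Ide = \<lambda>X. (X, ide (fst X), X),
     Comp = \<lambda>(Y, g, Z) (X, f, Y'). (X, g \<cdot> f, Z),
     TensO = center_tensor M,
     TensA = \<lambda>(X, f, Y) (X', f', Y'). (center_tensor M X X', f \<odot> f', center_tensor M Y Y'),
     Unit = center_unit M,
     Assoc = \<lambda>X Y Z. (center_tensor M (center_tensor M X Y) Z, \<a> (fst X) (fst Y) (fst Z),
                      center_tensor M X (center_tensor M Y Z)),
     Lunit = \<lambda>X. (center_tensor M (center_unit M) X, \<l> (fst X), X),
     Runit = \<lambda>X. (center_tensor M X (center_unit M), \<r> (fst X), X),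
     Dual = center_dual,
     Ev = \<lambda>X. (center_tensor M (center_dual X) X, Ev M (fst X), center_unit M),
     Coev = \<lambda>X. (center_unit M, Coev M (fst X), center_tensor M X (center_dual X)),
     Piv = \<lambda>X. (X, Piv M (fst X), center_dual (center_dual X)),
     Braid = \<lambda>X Y. (center_tensor M X Y, snd X (fst Y), center_tensor M Y X)\<rparr>"

definition forgetful ::
    "('p \<times> ('p \<Rightarrow> 'n), ('p \<times> ('p \<Rightarrow> 'n)) \<times> 'n \<times> ('p \<times> ('p \<Rightarrow> 'n)), 'p, 'n) tfun" where
  "forgetful =
    \<lparr>OMap = fst, AMap = \<lambda>(X, f, Y). f,
     Ten = \<lambda>X Y. ide (fst X \<otimes> fst Y), Uni = ide \<one>\<rparr>"

end


section \<open>The multiplication maps and the traciator\<close>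

text \<open>In what follows \<open>C\<close> is the braided category, \<open>Z : C \<rightarrow> center M\<close> the central functor, \<open>\<Phi>\<close> its
  composite with the forgetful functor, and \<open>Tr\<close> the right adjoint of \<open>\<Phi>\<close> with counit \<open>\<epsilon>\<close>.\<close>

definition underlying :: "('p, 'n, 'z) pivcat_scheme
    \<Rightarrow> ('o, 'm, 'p \<times> ('p \<Rightarrow> 'n), ('p \<times> ('p \<Rightarrow> 'n)) \<times> 'n \<times> ('p \<times> ('p \<Rightarrow> 'n))) tfun
    \<Rightarrow> ('o, 'm, 'p, 'n) tfun" where
  "underlying M Z = comp_tfun M (forgetful M) Z"

definition with_mate :: "('o, 'm, 'y) cat_scheme \<Rightarrow> ('p, 'n, 'z) cat_scheme
    \<Rightarrow> ('o, 'm, 'p, 'n, 'v) cfun_scheme \<Rightarrow> ('p, 'n, 'o, 'm, 'w) cfun_scheme \<Rightarrow> ('p \<Rightarrow> 'n)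
    \<Rightarrow> 'o \<Rightarrow> 'p \<Rightarrow> 'n \<Rightarrow> 'm" where
  "with_mate C M \<Phi> Tr \<epsilon> c x f =
     (THE g. g \<in> Hom C c (OMap Tr x) \<and> \<epsilon> x \<cdot>\<^bsub>M\<^esub> AMap \<Phi> g = f)"

context
  fixes C :: "('o, 'm, 'y) bpivcat_scheme" and M :: "('p, 'n, 'z) pivcat_scheme" (structure)
    and Z :: "('o, 'm, 'p \<times> ('p \<Rightarrow> 'n), ('p \<times> ('p \<Rightarrow> 'n)) \<times> 'n \<times> ('p \<times> ('p \<Rightarrow> 'n))) tfun"
    and Tr :: "('p, 'n, 'o, 'm) cfun" and \<epsilon> :: "'p \<Rightarrow> 'n"
begin

definition mult_map :: "'p \<Rightarrow> 'p \<Rightarrow> 'm" where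
  "mult_map x y =
     with_mate C M (underlying M Z) Tr \<epsilon> (OMap Tr x \<otimes>\<^bsub>C\<^esub> OMap Tr y) (x \<otimes> y)
       ((\<epsilon> x \<odot> \<epsilon> y) \<cdot> (Ten (underlying M Z) (OMap Tr x) (OMap Tr y))\<^sup>\<inverse>)"

text \<open>Below \<open>w = \<Phi> c\<close>, and \<open>e y : w \<otimes> y \<rightarrow> y \<otimes> w\<close> is its half-braiding, carried by the object \<open>Z c\<close>
  of the center.\<close>

definition traciator :: "'p \<Rightarrow> 'p \<Rightarrow> 'm" where
  "traciator x y =
     (let c = OMap Tr (x \<otimes> y); w = OMap (underlying M Z) c; e = snd (OMap Z c); y' = Dual M y in
      with_mate C M (underlying M Z) Tr \<epsilon> c (y \<otimes> x)
       (\<r> (y \<otimes> x) \<cdot> (ide (y \<otimes> x) \<odot> ev_tilde M y) \<cdot> \<a> (y \<otimes> x) y y' \<cdot> ((\<a> y x y)\<^sup>\<inverse> \<odot> ide y')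
          \<cdot> ((ide y \<odot> \<epsilon> (x \<otimes> y)) \<odot> ide y') \<cdot> (e y \<odot> ide y')
          \<cdot> (\<a> w y y')\<^sup>\<inverse> \<cdot> (ide w \<odot> Coev M y) \<cdot> (\<r> w)\<^sup>\<inverse>))"

definition traciator_minus :: "'p \<Rightarrow> 'p \<Rightarrow> 'm" where
  "traciator_minus x y = (traciator y x)\<^sup>\<inverse>\<^bsub>C\<^esub>"

end

end

theory Submission
  imports Defs
begin

text \<open>All computations are string diagrams, so coherence is disposed of first: an arrow \<open>f\<close> of a monoidal
  category is replaced by the natural transformation \<open>f \<otimes> -\<close>, and composition of endofunctors is strict.

  Under the adjunction, the traciator is the rotation of the counit around \<open>y\<close>, which uses the half-braiding
  of \<open>\<Phi> (Tr (x \<otimes> y))\<close>.  On \<open>\<mu>\<close> this half-braiding is that of the tensor product \<open>\<Phi> (Tr x) \<otimes> \<Phi> (Tr y)\<close>, so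
  the rotation strand first crosses \<open>\<Phi> (Tr y)\<close>, closing up to a twist loop, and then \<open>\<Phi> (Tr x)\<close>, giving
  the braiding.  The loop is \<open>\<Phi> (\<theta>)\<close> because \<open>\<Phi>\<close> is pivotal.  Rotation is bijective, being the composite of
  two adjunctions between \<open>y\<close>, \<open>y\<^sup>*\<close> and the inverse half-braiding of \<open>y\<^sup>*\<close>; hence the traciator and the twist
  are invertible, and the second identity is the first one for \<open>(y, x)\<close> read backwards.\<close>

section \<open>Arrows and inverses\<close>

text \<open>The hypotheses on \<open>Z\<close> are equations in the record \<open>center M\<close>,
  whose inverse arrows are descriptions over its own arrows. The obstacle is to extract from them
  that the composite \<open>\<Phi>\<close> with the forgetful functor is pivotal: the comparison of
  \<open>Z\<close> with duals is a composite containing inverses formed in the center, and these can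
  be computed in \<open>M\<close> only between genuine objects of the center. Hence the dual and the
  double dual of \<open>Z d\<close> have to be recognised as such objects. This is done by
  comparison with the values of \<open>Z\<close> at the dual and the double dual of
  \<open>d\<close>, which are objects of the center by hypothesis. Invertibility of the twist has
  another difficulty: the twist is an arrow of \<open>C\<close>, whereas rotation is formed in a
  pivotal category around an object with a half-braiding. There \<open>C\<close> itself serves as
  the target category: its braiding is a half-braiding on each object, and the identity functor
  stands in for \<open>\<Phi>\<close>.\<close>

context category
begin

lemma HomI: "\<lbrakk>f \<in> Arr C; Src C f = a; Tgt C f = b\<rbrakk> \<Longrightarrow> f \<in> Hom C a b"
  by (auto simp: Hom_def)

lemma ide_arr [simp]: "a \<in> Obj C \<Longrightarrow> ide a \<in> Arr C" "a \<in> Obj C \<Longrightarrow> Src C (ide a) = a"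
    "a \<in> Obj C \<Longrightarrow> Tgt C (ide a) = a"
  using ide_hom by (auto simp: Hom_def)

lemma src_tgt_obj [simp]: "f \<in> Arr C \<Longrightarrow> Src C f \<in> Obj C" "f \<in> Arr C \<Longrightarrow> Tgt C f \<in> Obj C"
  by (simp_all add: src_obj tgt_obj)

lemma comp_arr [simp]:
  assumes "f \<in> Arr C" "g \<in> Arr C" "Src C g = Tgt C f"
  shows "g \<cdot> f \<in> Arr C" "Src C (g \<cdot> f) = Src C f" "Tgt C (g \<cdot> f) = Tgt C g"
  using comp_hom[of f "Src C f" "Tgt C f" g "Tgt C g"] assms by (auto simp: Hom_def)

lemma comp_ide [simp]:
  "\<lbrakk>f \<in> Arr C; Src C f = a\<rbrakk> \<Longrightarrow> f \<cdot> ide a = f"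
  "\<lbrakk>f \<in> Arr C; Tgt C f = a\<rbrakk> \<Longrightarrow> ide a \<cdot> f = f"
  by (auto intro!: comp_ide_right comp_ide_left simp: Hom_def)

lemma comp_assoc' [simp]:
  "\<lbrakk>f \<in> Arr C; g \<in> Arr C; h \<in> Arr C; Src C g = Tgt C f; Src C h = Tgt C g\<rbrakk>
    \<Longrightarrow> (h \<cdot> g) \<cdot> f = h \<cdot> (g \<cdot> f)"
  by (rule comp_assoc) (auto simp: Hom_def)

lemma inverse_unique:
  assumes "inverse_arrows C f g" "inverse_arrows C f h"
  shows "g = h"
proof -
  have f: "f \<in> Arr C" and g: "g \<in> Arr C" "Src C g = Tgt C f" "Tgt C g = Src C f"
    and h: "h \<in> Arr C" "Src C h = Tgt C f" "Tgt C h = Src C f"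
    using assms by (auto simp: inverse_arrows_def Hom_def)
  have "g = g \<cdot> (f \<cdot> h)"
    using assms f g h by (simp add: inverse_arrows_def)
  also have "\<dots> = (g \<cdot> f) \<cdot> h"
    using f g h by simp
  also have "\<dots> = h"
    using assms f g h by (simp add: inverse_arrows_def)
  finally show ?thesis .
qed

lemma inv_arrow_eq: "inverse_arrows C f g \<Longrightarrow> f\<^sup>\<inverse> = g"
  unfolding inv_arrow_def by (rule the_equality) (auto intro: inverse_unique)

lemma inverse_inv_arrow: "is_iso C f \<Longrightarrow> inverse_arrows C f (f\<^sup>\<inverse>)"
  unfolding is_iso_def using inv_arrow_eq by auto

lemma iso_arr: "is_iso C f \<Longrightarrow> f \<in> Arr C"
  by (auto simp: is_iso_def inverse_arrows_def)

lemma inv_arr [simp]: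
  assumes "is_iso C f"
  shows "f\<^sup>\<inverse> \<in> Arr C" "Src C (f\<^sup>\<inverse>) = Tgt C f" "Tgt C (f\<^sup>\<inverse>) = Src C f"
    "f\<^sup>\<inverse> \<cdot> f = ide (Src C f)" "f \<cdot> f\<^sup>\<inverse> = ide (Tgt C f)"
  using inverse_inv_arrow[OF assms] by (auto simp: inverse_arrows_def Hom_def)

lemma inv_hom: "\<lbrakk>is_iso C f; f \<in> Hom C a b\<rbrakk> \<Longrightarrow> f\<^sup>\<inverse> \<in> Hom C b a"
  by (auto simp: Hom_def)

lemma inv_comp_cancel [simp]:
  assumes "is_iso C f"
  shows "\<lbrakk>g \<in> Arr C; Tgt C g = Src C f\<rbrakk> \<Longrightarrow> f\<^sup>\<inverse> \<cdot> f \<cdot> g = g"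
    "\<lbrakk>g \<in> Arr C; Tgt C g = Tgt C f\<rbrakk> \<Longrightarrow> f \<cdot> f\<^sup>\<inverse> \<cdot> g = g"
proof -
  have f: "f \<in> Arr C" using assms by (rule iso_arr)
  show "f\<^sup>\<inverse> \<cdot> f \<cdot> g = g" if "g \<in> Arr C" "Tgt C g = Src C f"
    using comp_assoc'[of g f "f\<^sup>\<inverse>"] assms that f by simp
  show "f \<cdot> f\<^sup>\<inverse> \<cdot> g = g" if "g \<in> Arr C" "Tgt C g = Tgt C f"
    using comp_assoc'[of g "f\<^sup>\<inverse>" f] assms that f by simp
qed

lemma inverse_arrowsI:
  "\<lbrakk>f \<in> Hom C a b; g \<in> Hom C b a; g \<cdot> f = ide a; f \<cdot> g = ide b\<rbrakk> \<Longrightarrow> inverse_arrows C f g"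
  by (auto simp: inverse_arrows_def Hom_def)

lemma is_isoI:
  "\<lbrakk>f \<in> Hom C a b; g \<in> Hom C b a; g \<cdot> f = ide a; f \<cdot> g = ide b\<rbrakk> \<Longrightarrow> is_iso C f"
  unfolding is_iso_def using inverse_arrowsI by blast

lemma iso_comp:
  assumes "is_iso C f" "is_iso C g" "Src C g = Tgt C f"
  shows "is_iso C (g \<cdot> f)"
proof (rule is_isoI)
  have [simp]: "f \<in> Arr C" "g \<in> Arr C" using assms by (auto intro: iso_arr)
  show "g \<cdot> f \<in> Hom C (Src C f) (Tgt C g)" "f\<^sup>\<inverse> \<cdot> g\<^sup>\<inverse> \<in> Hom C (Tgt C g) (Src C f)"
    using assms by (auto intro!: HomI)
  have "f\<^sup>\<inverse> \<cdot> (g\<^sup>\<inverse> \<cdot> (g \<cdot> f)) = ide (Src C f)" "g \<cdot> (f \<cdot> (f\<^sup>\<inverse> \<cdot> g\<^sup>\<inverse>)) = ide (Tgt C g)"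
    using assms by simp_all
  then show "(f\<^sup>\<inverse> \<cdot> g\<^sup>\<inverse>) \<cdot> (g \<cdot> f) = ide (Src C f)" "(g \<cdot> f) \<cdot> (f\<^sup>\<inverse> \<cdot> g\<^sup>\<inverse>) = ide (Tgt C g)"
    using assms by simp_all
qed

lemma inv_iso: "is_iso C f \<Longrightarrow> is_iso C (f\<^sup>\<inverse>)"
  by (rule is_isoI[where g = f]) (auto intro: HomI iso_arr)

lemma ide_iso: "a \<in> Obj C \<Longrightarrow> is_iso C (ide a)"
  by (rule is_isoI[where g = "ide a"]) (auto intro: HomI)

lemma iso_cancel_right:
  assumes "is_iso C h" "f \<in> Arr C" "g \<in> Arr C" "Src C f = Tgt C h" "Src C g = Tgt C h" "f \<cdot> h = g \<cdot> h"
  shows "f = g"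
proof -
  have "h \<in> Arr C" using assms(1) by (rule iso_arr)
  then have "f = (f \<cdot> h) \<cdot> h\<^sup>\<inverse>" "g = (g \<cdot> h) \<cdot> h\<^sup>\<inverse>" using assms(1-5) by simp_all
  then show ?thesis using assms(6) by simp
qed

end

section \<open>String diagrams in a monoidal category\<close>

text \<open>A diagram from the word \<open>xs\<close> to the word \<open>ys\<close> is a natural transformation between the
  endofunctors \<open>xs\<^sub>1 \<otimes> (xs\<^sub>2 \<otimes> (\<dots> \<otimes> -))\<close> and \<open>ys\<^sub>1 \<otimes> (ys\<^sub>2 \<otimes> (\<dots> \<otimes> -))\<close>.  Composition of endofunctors
  being strict, associators and unitors disappear.  The value \<open>Null\<close> of ill-typed expressions makes
  most laws of the calculus unconditional.\<close>

datatype ('o, 'm) diagram = Null | Diagram (dsrc: "'o list") (dmap: "'o \<Rightarrow> 'm") (dtgt: "'o list")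

context
  fixes C :: "('o, 'm, 'z) moncat_scheme" (structure)
begin

definition act :: "'o list \<Rightarrow> 'o \<Rightarrow> 'o" where
  "act xs z = foldr (\<otimes>) xs z"

definition act_arr :: "'o list \<Rightarrow> 'm \<Rightarrow> 'm" where
  "act_arr xs h = foldr (\<lambda>x k. ide x \<odot> k) xs h"

text \<open>Components are kept extensional, so that two diagrams are equal as soon as their words
  and their components at objects agree. Naturality is required along all arrows, because
  \<open>interchange\<close> applies it to components of other diagrams.\<close>

definition diag :: "('o, 'm) diagram \<Rightarrow> bool" where
  "diag f \<longleftrightarrow> f \<noteq> Null \<and> set (dsrc f) \<subseteq> Obj C \<and> set (dtgt f) \<subseteq> Obj C \<and> dmap f \<in> extensional (Obj C)
     \<and> (\<forall>z\<in>Obj C. dmap f z \<in> Hom C (act (dsrc f) z) (act (dtgt f) z))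
     \<and> (\<forall>h\<in>Arr C. dmap f (Tgt C h) \<cdot> act_arr (dsrc f) h = act_arr (dtgt f) h \<cdot> dmap f (Src C h))"

definition dcomp :: "('o, 'm) diagram \<Rightarrow> ('o, 'm) diagram \<Rightarrow> ('o, 'm) diagram" where
  "dcomp g f = (if diag g \<and> diag f \<and> dsrc g = dtgt f
     then Diagram (dsrc f) (\<lambda>z\<in>Obj C. dmap g z \<cdot> dmap f z) (dtgt g) else Null)"

text \<open>Horizontal composition with identities of endofunctors: strands on the left act as a
  functor on the components, strands on the right only change the object at which a component is
  taken.\<close>

definition whisker :: "'o list \<Rightarrow> ('o, 'm) diagram \<Rightarrow> 'o list \<Rightarrow> ('o, 'm) diagram" where
  "whisker xs f ys = (if set xs \<subseteq> Obj C \<and> diag f \<and> set ys \<subseteq> Obj C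
     then Diagram (xs @ dsrc f @ ys) (\<lambda>z\<in>Obj C. act_arr xs (dmap f (act ys z))) (xs @ dtgt f @ ys) else Null)"

definition did :: "'o list \<Rightarrow> ('o, 'm) diagram" where
  "did xs = Diagram xs (\<lambda>z\<in>Obj C. ide (act xs z)) xs"

definition emb :: "'m \<Rightarrow> ('o, 'm) diagram" where
  "emb f = Diagram [Src C f] (\<lambda>z\<in>Obj C. f \<odot> ide z) [Tgt C f]"

text \<open>The inverse associator, read as natural in its last argument. Together with
  \<open>split\<close> and the left unitors \<open>create\<close> and \<open>erase\<close> it is the
  only coherence that remains visible; the right unitor is expressed through these.\<close>

definition merge :: "'o \<Rightarrow> 'o \<Rightarrow> ('o, 'm) diagram" where
  "merge a b = Diagram [a, b] (\<lambda>z\<in>Obj C. (\<a> a b z)\<^sup>\<inverse>) [a \<otimes> b]"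

definition split :: "'o \<Rightarrow> 'o \<Rightarrow> ('o, 'm) diagram" where
  "split a b = Diagram [a \<otimes> b] (\<lambda>z\<in>Obj C. \<a> a b z) [a, b]"

definition create :: "('o, 'm) diagram" where
  "create = Diagram [] (\<lambda>z\<in>Obj C. (\<l> z)\<^sup>\<inverse>) [\<one>]"

definition erase :: "('o, 'm) diagram" where
  "erase = Diagram [\<one>] (\<lambda>z\<in>Obj C. \<l> z) []"

end

notation dcomp (infixr \<open>\<bullet>\<index>\<close> 55)
notation whisker (\<open>(_ \<lhd> _ \<rhd>\<index> _)\<close> [61, 61, 61] 60)

section \<open>Calculus of diagrams: composition, whiskering, interchange\<close>

context monoidal_category
begin

lemma tensor_obj' [simp]: "\<lbrakk>a \<in> Obj C; b \<in> Obj C\<rbrakk> \<Longrightarrow> a \<otimes> b \<in> Obj C"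
  by (rule tensor_obj)

lemma unit_obj' [simp]: "\<one> \<in> Obj C"
  by (rule unit_obj)

lemma tensor_arr [simp]:
  assumes "f \<in> Arr C" "g \<in> Arr C"
  shows "f \<odot> g \<in> Arr C" "Src C (f \<odot> g) = Src C f \<otimes> Src C g" "Tgt C (f \<odot> g) = Tgt C f \<otimes> Tgt C g"
  using tensor_hom[of f "Src C f" "Tgt C f" g "Src C g" "Tgt C g"] assms by (auto simp: Hom_def)

lemma tensor_ide' [simp]: "\<lbrakk>a \<in> Obj C; b \<in> Obj C\<rbrakk> \<Longrightarrow> ide a \<odot> ide b = ide (a \<otimes> b)"
  by (rule tensor_ide)

lemma tensor_comp':
  "\<lbrakk>f \<in> Arr C; g \<in> Arr C; f' \<in> Arr C; g' \<in> Arr C; Src C g = Tgt C f; Src C g' = Tgt C f'\<rbrakk>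
    \<Longrightarrow> (g \<odot> g') \<cdot> (f \<odot> f') = (g \<cdot> f) \<odot> (g' \<cdot> f')"
  by (rule tensor_comp[symmetric]) (auto simp: Hom_def)

lemma coherence_arr [simp]:
  "\<lbrakk>a \<in> Obj C; b \<in> Obj C; c \<in> Obj C\<rbrakk> \<Longrightarrow> is_iso C (\<a> a b c)"
  "\<lbrakk>a \<in> Obj C; b \<in> Obj C; c \<in> Obj C\<rbrakk> \<Longrightarrow> \<a> a b c \<in> Arr C"
  "\<lbrakk>a \<in> Obj C; b \<in> Obj C; c \<in> Obj C\<rbrakk> \<Longrightarrow> Src C (\<a> a b c) = (a \<otimes> b) \<otimes> c"
  "\<lbrakk>a \<in> Obj C; b \<in> Obj C; c \<in> Obj C\<rbrakk> \<Longrightarrow> Tgt C (\<a> a b c) = a \<otimes> (b \<otimes> c)"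
  "a \<in> Obj C \<Longrightarrow> is_iso C (\<l> a)" "a \<in> Obj C \<Longrightarrow> \<l> a \<in> Arr C"
  "a \<in> Obj C \<Longrightarrow> Src C (\<l> a) = \<one> \<otimes> a" "a \<in> Obj C \<Longrightarrow> Tgt C (\<l> a) = a"
  "a \<in> Obj C \<Longrightarrow> is_iso C (\<r> a)" "a \<in> Obj C \<Longrightarrow> \<r> a \<in> Arr C"
  "a \<in> Obj C \<Longrightarrow> Src C (\<r> a) = a \<otimes> \<one>" "a \<in> Obj C \<Longrightarrow> Tgt C (\<r> a) = a"
  using assoc_hom assoc_iso lunit_hom lunit_iso runit_hom runit_iso by (auto simp: Hom_def)

lemma act_simps [simp]: "act C [] z = z" "act C (x # xs) z = x \<otimes> act C xs z"
    "act C (xs @ ys) z = act C xs (act C ys z)"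
    "act_arr C [] h = h" "act_arr C (x # xs) h = ide x \<odot> act_arr C xs h"
    "act_arr C (xs @ ys) h = act_arr C xs (act_arr C ys h)"
  by (simp_all add: act_def act_arr_def)

lemma act_obj [simp]: "\<lbrakk>set xs \<subseteq> Obj C; z \<in> Obj C\<rbrakk> \<Longrightarrow> act C xs z \<in> Obj C"
  by (induction xs) auto

lemma act_arr_arr [simp]:
  assumes "h \<in> Arr C" "set xs \<subseteq> Obj C"
  shows "act_arr C xs h \<in> Arr C" "Src C (act_arr C xs h) = act C xs (Src C h)"
    "Tgt C (act_arr C xs h) = act C xs (Tgt C h)"
  using assms by (induction xs) auto

lemma act_arr_ide [simp]: "\<lbrakk>set xs \<subseteq> Obj C; z \<in> Obj C\<rbrakk> \<Longrightarrow> act_arr C xs (ide z) = ide (act C xs z)"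
  by (induction xs) auto

lemma act_arr_comp:
  assumes "h \<in> Arr C" "k \<in> Arr C" "Src C k = Tgt C h" "set xs \<subseteq> Obj C"
  shows "act_arr C xs (k \<cdot> h) = act_arr C xs k \<cdot> act_arr C xs h"
  using assms by (induction xs) (auto simp: tensor_comp')

lemma diagD:
  assumes "diag C f"
  shows "set (dsrc f) \<subseteq> Obj C" "set (dtgt f) \<subseteq> Obj C"
    "z \<in> Obj C \<Longrightarrow> dmap f z \<in> Arr C" "z \<in> Obj C \<Longrightarrow> Src C (dmap f z) = act C (dsrc f) z"
    "z \<in> Obj C \<Longrightarrow> Tgt C (dmap f z) = act C (dtgt f) z"
    "h \<in> Arr C \<Longrightarrow> dmap f (Tgt C h) \<cdot> act_arr C (dsrc f) h = act_arr C (dtgt f) h \<cdot> dmap f (Src C h)"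
  using assms by (auto simp: diag_def Hom_def)

lemma diag_Null [simp]: "\<not> diag C Null"
  by (simp add: diag_def)

lemma diag_eqI:
  assumes "diag C f" "diag C g" "dsrc f = dsrc g" "dtgt f = dtgt g" "\<And>z. z \<in> Obj C \<Longrightarrow> dmap f z = dmap g z"
  shows "f = g"
proof -
  have "dmap f = dmap g"
    using assms by (intro extensionalityI[of _ "Obj C"]) (auto simp: diag_def)
  then show ?thesis
    using assms(1-4) by (cases f; cases g) auto
qed

lemma diag_dcomp_I:
  assumes "diag C f" "diag C g" "dsrc g = dtgt f"
  shows "diag C (g \<bullet> f)"
proof -
  note [simp] = diagD(1-5)[OF assms(1)] diagD(1-5)[OF assms(2)] assms(3)
  have "(dmap g (Tgt C h) \<cdot> dmap f (Tgt C h)) \<cdot> act_arr C (dsrc f) h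
      = act_arr C (dtgt g) h \<cdot> dmap g (Src C h) \<cdot> dmap f (Src C h)" if [simp]: "h \<in> Arr C" for h
  proof -
    have "(dmap g (Tgt C h) \<cdot> dmap f (Tgt C h)) \<cdot> act_arr C (dsrc f) h
       = dmap g (Tgt C h) \<cdot> dmap f (Tgt C h) \<cdot> act_arr C (dsrc f) h"
      by simp
    also have "\<dots> = (dmap g (Tgt C h) \<cdot> act_arr C (dsrc g) h) \<cdot> dmap f (Src C h)"
      by (simp add: diagD(6)[OF assms(1)])
    also have "\<dots> = act_arr C (dtgt g) h \<cdot> dmap g (Src C h) \<cdot> dmap f (Src C h)"
      unfolding diagD(6)[OF assms(2) that] by simp
    finally show ?thesis .
  qed
  then show ?thesis
    using assms by (auto simp: dcomp_def diag_def[of _ "Diagram _ _ _"] intro!: HomI)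
qed

lemma diag_dcomp [simp]: "diag C (g \<bullet> f) \<longleftrightarrow> diag C g \<and> diag C f \<and> dsrc g = dtgt f"
  using diag_dcomp_I[of f g] by (auto simp: dcomp_def)

lemma dcomp_simps [simp]:
  assumes "diag C g" "diag C f" "dsrc g = dtgt f"
  shows "dsrc (g \<bullet> f) = dsrc f" "dtgt (g \<bullet> f) = dtgt g"
  using assms by (auto simp: dcomp_def)

lemma dmap_dcomp:
  assumes "diag C g" "diag C f" "dsrc g = dtgt f" "z \<in> Obj C"
  shows "dmap (g \<bullet> f) z = dmap g z \<cdot> dmap f z"
  using assms by (auto simp: dcomp_def)

lemma not_diag_dcomp: "\<not> (diag C g \<and> diag C f \<and> dsrc g = dtgt f) \<Longrightarrow> g \<bullet> f = Null"
  by (auto simp: dcomp_def)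

lemma dcomp_assoc [simp]: "(h \<bullet> g) \<bullet> f = h \<bullet> (g \<bullet> f)"
proof (cases "diag C h \<and> diag C g \<and> diag C f \<and> dsrc h = dtgt g \<and> dsrc g = dtgt f")
  case True
  then show ?thesis
    by (intro diag_eqI) (auto simp: dmap_dcomp diagD)
next
  case False
  have "(h \<bullet> g) \<bullet> f = Null"
    by (rule not_diag_dcomp) (use False in \<open>auto\<close>)
  moreover have "h \<bullet> (g \<bullet> f) = Null"
    by (rule not_diag_dcomp) (use False in \<open>auto\<close>)
  ultimately show ?thesis by simp
qed

lemma diag_whisker_I:
  assumes "set xs \<subseteq> Obj C" "diag C f" "set ys \<subseteq> Obj C"
  shows "diag C (xs \<lhd> f \<rhd> ys)"
proof -
  note [simp] = diagD[OF assms(2)] assms(1,3)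
  have "act_arr C xs (dmap f (act C ys (Tgt C h))) \<cdot> act_arr C xs (act_arr C (dsrc f) (act_arr C ys h))
      = act_arr C xs (act_arr C (dtgt f) (act_arr C ys h)) \<cdot> act_arr C xs (dmap f (act C ys (Src C h)))"
    if [simp]: "h \<in> Arr C" for h
    using diagD(6)[OF assms(2), of "act_arr C ys h"] by (simp add: act_arr_comp[symmetric])
  then show ?thesis
    using assms by (auto simp: whisker_def diag_def[of _ "Diagram _ _ _"] intro!: HomI)
qed

lemma diag_whisker [simp]: "diag C (xs \<lhd> f \<rhd> ys) \<longleftrightarrow> set xs \<subseteq> Obj C \<and> diag C f \<and> set ys \<subseteq> Obj C"
  using diag_whisker_I[of xs f ys] by (auto simp: whisker_def)

lemma whisker_simps [simp]:
  assumes "set xs \<subseteq> Obj C" "diag C f" "set ys \<subseteq> Obj C"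
  shows "dsrc (xs \<lhd> f \<rhd> ys) = xs @ dsrc f @ ys" "dtgt (xs \<lhd> f \<rhd> ys) = xs @ dtgt f @ ys"
  using assms by (auto simp: whisker_def)

lemma dmap_whisker:
  assumes "set xs \<subseteq> Obj C" "diag C f" "set ys \<subseteq> Obj C" "z \<in> Obj C"
  shows "dmap (xs \<lhd> f \<rhd> ys) z = act_arr C xs (dmap f (act C ys z))"
  using assms by (auto simp: whisker_def)

lemma whisker_Null: "\<not> (set xs \<subseteq> Obj C \<and> diag C f \<and> set ys \<subseteq> Obj C) \<Longrightarrow> xs \<lhd> f \<rhd> ys = Null"
  by (auto simp: whisker_def)

lemma whisker_whisker [simp]: "xs \<lhd> (xs' \<lhd> f \<rhd> ys') \<rhd> ys = (xs @ xs') \<lhd> f \<rhd> (ys' @ ys)"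
proof (cases "set xs \<subseteq> Obj C \<and> set xs' \<subseteq> Obj C \<and> diag C f \<and> set ys \<subseteq> Obj C \<and> set ys' \<subseteq> Obj C")
  case True
  then show ?thesis by (intro diag_eqI) (auto simp: dmap_whisker)
next
  case False
  have "xs \<lhd> (xs' \<lhd> f \<rhd> ys') \<rhd> ys = Null"
    by (rule whisker_Null, use False in auto)
  moreover have "(xs @ xs') \<lhd> f \<rhd> (ys' @ ys) = Null"
    by (rule whisker_Null, use False in auto)
  ultimately show ?thesis by simp
qed

lemma whisker_nil [simp]: "diag C f \<Longrightarrow> [] \<lhd> f \<rhd> [] = f"
  by (intro diag_eqI) (auto simp: dmap_whisker)

lemma whisker_comp [simp]: "xs \<lhd> (g \<bullet> f) \<rhd> ys = (xs \<lhd> g \<rhd> ys) \<bullet> (xs \<lhd> f \<rhd> ys)"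
proof (cases "set xs \<subseteq> Obj C \<and> diag C g \<and> diag C f \<and> dsrc g = dtgt f \<and> set ys \<subseteq> Obj C")
  case True
  then show ?thesis by (intro diag_eqI) (auto simp: dmap_whisker dmap_dcomp diagD act_arr_comp)
next
  case False
  have "xs \<lhd> (g \<bullet> f) \<rhd> ys = Null"
    by (rule whisker_Null, use False in auto)
  moreover have "(xs \<lhd> g \<rhd> ys) \<bullet> (xs \<lhd> f \<rhd> ys) = Null"
    by (rule not_diag_dcomp, use False in auto)
  ultimately show ?thesis by simp
qed

text \<open>Boxes on disjoint strands slide past each other because \<open>f\<close> is natural
  along the component of \<open>g\<close>, whiskered by the strands \<open>ys\<close> between
  them.\<close>

lemma interchange:
  "xs \<lhd> f \<rhd> (ys @ dtgt g @ zs) \<bullet> (xs @ dsrc f @ ys) \<lhd> g \<rhd> zs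
    = (xs @ dtgt f @ ys) \<lhd> g \<rhd> zs \<bullet> xs \<lhd> f \<rhd> (ys @ dsrc g @ zs)" (is "?l = ?r")
proof (cases "set xs \<subseteq> Obj C \<and> diag C g \<and> diag C f \<and> set ys \<subseteq> Obj C \<and> set zs \<subseteq> Obj C")
  case True
  note [simp] = diagD[of f] diagD[of g]
  show ?thesis
  proof (rule diag_eqI)
    fix z assume z: "z \<in> Obj C"
    show "dmap ?l z = dmap ?r z"
      using diagD(6)[of f "act_arr C ys (dmap g (act C zs z))"] True z
      by (simp add: dmap_whisker dmap_dcomp act_arr_comp[symmetric])
  qed (use True in auto)
next
  case False
  have "?l = Null" by (rule not_diag_dcomp, use False in auto)
  moreover have "?r = Null" by (rule not_diag_dcomp, use False in auto)
  ultimately show ?thesis by simp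
qed

lemma did_simps [simp]: "dsrc (did C xs) = xs" "dtgt (did C xs) = xs"
    "set xs \<subseteq> Obj C \<Longrightarrow> diag C (did C xs)"
  by (auto simp: did_def diag_def intro!: HomI)

lemma dcomp_did [simp]:
  "\<lbrakk>diag C f; dsrc f = xs\<rbrakk> \<Longrightarrow> f \<bullet> did C xs = f"
  "\<lbrakk>diag C f; dtgt f = xs\<rbrakk> \<Longrightarrow> did C xs \<bullet> f = f"
  by (auto intro!: diag_eqI simp: diagD dmap_dcomp) (auto simp: did_def diagD)

lemma whisker_did [simp]:
  "\<lbrakk>set xs \<subseteq> Obj C; set ys \<subseteq> Obj C; set zs \<subseteq> Obj C\<rbrakk> \<Longrightarrow> xs \<lhd> did C ys \<rhd> zs = did C (xs @ ys @ zs)"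
  by (intro diag_eqI) (auto simp: dmap_whisker, auto simp: did_def)

text \<open>Kelly's argument that this unit law follows from pentagon and triangle: it is proved
  after tensoring with \<open>\<one>\<close> on the left, and \<open>ide \<one> \<odot> -\<close> is
  faithful since the left unitor is a natural isomorphism.\<close>

lemma lunit_tensor:
  assumes [simp]: "a \<in> Obj C" "b \<in> Obj C"
  shows "\<l> (a \<otimes> b) \<cdot> \<a> \<one> a b = \<l> a \<odot> ide b"
proof -
  let ?k = "\<a> \<one> (\<one> \<otimes> a) b \<cdot> (\<a> \<one> \<one> a \<odot> ide b)"
  have tri: "(ide \<one> \<odot> \<l> c) \<cdot> \<a> \<one> \<one> c = \<r> \<one> \<odot> ide c" if "c \<in> Obj C" for c
    using triangle[of \<one> c] that by simp
  have iso: "is_iso C ?k"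
  proof (intro iso_comp)
    show "is_iso C (\<a> \<one> \<one> a \<odot> ide b)"
      by (rule is_isoI[where g = "(\<a> \<one> \<one> a)\<^sup>\<inverse> \<odot> ide b"]) (auto intro!: HomI simp: tensor_comp')
  qed auto
  \<comment> \<open>Composition with the isomorphism \<open>?k\<close> brings in the pentagon for
    \<open>\<one>\<close>, \<open>\<one>\<close>, \<open>a\<close>, \<open>b\<close>; the triangle
    is then used once at \<open>a \<otimes> b\<close> and once at \<open>a\<close>.\<close>
  have "(ide \<one> \<odot> (\<l> (a \<otimes> b) \<cdot> \<a> \<one> a b)) \<cdot> ?k
      = (ide \<one> \<odot> \<l> (a \<otimes> b)) \<cdot> ((ide \<one> \<odot> \<a> \<one> a b) \<cdot> ?k)"
    using tensor_comp'[of "ide \<one>" "ide \<one>" "\<a> \<one> a b" "\<l> (a \<otimes> b)", symmetric] by simp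
  also have "\<dots> = ((ide \<one> \<odot> \<l> (a \<otimes> b)) \<cdot> \<a> \<one> \<one> (a \<otimes> b)) \<cdot> \<a> (\<one> \<otimes> \<one>) a b"
    using pentagon[of \<one> \<one> a b] by simp
  also have "\<dots> = (\<r> \<one> \<odot> ide (a \<otimes> b)) \<cdot> \<a> (\<one> \<otimes> \<one>) a b"
    by (simp only: tri tensor_obj assms)
  also have "\<dots> = \<a> \<one> a b \<cdot> ((\<r> \<one> \<odot> ide a) \<odot> ide b)"
    using assoc_natural[of "\<r> \<one>" "\<one> \<otimes> \<one>" \<one> "ide a" a a "ide b" b b] by (simp add: HomI)
  also have "\<dots> = \<a> \<one> a b \<cdot> (((ide \<one> \<odot> \<l> a) \<cdot> \<a> \<one> \<one> a) \<odot> (ide b \<cdot> ide b))"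
    by (simp add: tri)
  also have "\<dots> = \<a> \<one> a b \<cdot> (((ide \<one> \<odot> \<l> a) \<odot> ide b) \<cdot> (\<a> \<one> \<one> a \<odot> ide b))"
    by (subst tensor_comp') auto
  also have "\<dots> = (\<a> \<one> a b \<cdot> ((ide \<one> \<odot> \<l> a) \<odot> ide b)) \<cdot> (\<a> \<one> \<one> a \<odot> ide b)"
    by simp
  also have "\<dots> = ((ide \<one> \<odot> (\<l> a \<odot> ide b)) \<cdot> \<a> \<one> (\<one> \<otimes> a) b) \<cdot> (\<a> \<one> \<one> a \<odot> ide b)"
    using assoc_natural[of "ide \<one>" \<one> \<one> "\<l> a" "\<one> \<otimes> a" a "ide b" b b] by (simp add: HomI)
  also have "\<dots> = (ide \<one> \<odot> (\<l> a \<odot> ide b)) \<cdot> ?k"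
    by simp
  finally have *: "ide \<one> \<odot> (\<l> (a \<otimes> b) \<cdot> \<a> \<one> a b) = ide \<one> \<odot> (\<l> a \<odot> ide b)"
    using iso by (rule iso_cancel_right[rotated -1]) auto
  have "(\<l> (a \<otimes> b) \<cdot> \<a> \<one> a b) \<cdot> \<l> ((\<one> \<otimes> a) \<otimes> b) = (\<l> a \<odot> ide b) \<cdot> \<l> ((\<one> \<otimes> a) \<otimes> b)"
    using lunit_natural[of "\<l> (a \<otimes> b) \<cdot> \<a> \<one> a b" "(\<one> \<otimes> a) \<otimes> b" "a \<otimes> b"]
      lunit_natural[of "\<l> a \<odot> ide b" "(\<one> \<otimes> a) \<otimes> b" "a \<otimes> b"] * by (simp add: HomI)
  then show ?thesis
    by (rule iso_cancel_right[rotated -1]) auto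
qed

section \<open>The diagram of an arrow and the elimination of coherence\<close>

lemma emb_arr [simp]:
  "f \<in> Arr C \<Longrightarrow> diag C (emb C f)" "dsrc (emb C f) = [Src C f]" "dtgt (emb C f) = [Tgt C f]"
  by (auto simp: emb_def diag_def tensor_comp' intro!: HomI)

lemma merge_simps [simp]:
  "dsrc (merge C a b) = [a, b]" "dtgt (merge C a b) = [a \<otimes> b]"
  "dsrc (split C a b) = [a \<otimes> b]" "dtgt (split C a b) = [a, b]"
  "dsrc (create C) = []" "dtgt (create C) = [\<one>]"
  "dsrc (erase C) = [\<one>]" "dtgt (erase C) = []"
  by (simp_all add: merge_def split_def create_def erase_def)

lemma split_diag [simp]:
  assumes [simp]: "a \<in> Obj C" "b \<in> Obj C"
  shows "diag C (split C a b)"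
proof -
  have "\<a> a b (Tgt C h) \<cdot> (ide (a \<otimes> b) \<odot> h) = (ide a \<odot> (ide b \<odot> h)) \<cdot> \<a> a b (Src C h)"
    if "h \<in> Arr C" for h
    using assoc_natural[of "ide a" a a "ide b" b b h "Src C h" "Tgt C h"] that by (simp add: HomI)
  then show ?thesis by (auto simp: split_def diag_def intro!: HomI)
qed

lemma erase_diag [simp]: "diag C (erase C)"
  using lunit_natural by (auto simp: erase_def diag_def Hom_def)

lemma inv_natural:
  assumes "is_iso C f" "is_iso C g" "h \<in> Arr C" "k \<in> Arr C" "Src C h = Src C f" "Tgt C h = Src C g"
     "Src C k = Tgt C f" "Tgt C k = Tgt C g" "g \<cdot> h = k \<cdot> f"
  shows "g\<^sup>\<inverse> \<cdot> k = h \<cdot> f\<^sup>\<inverse>"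
proof -
  have [simp]: "f \<in> Arr C" "g \<in> Arr C" using assms by (auto intro: iso_arr)
  have "g\<^sup>\<inverse> \<cdot> k = g\<^sup>\<inverse> \<cdot> (k \<cdot> f) \<cdot> f\<^sup>\<inverse>" using assms(1-8) by simp
  also have "\<dots> = g\<^sup>\<inverse> \<cdot> (g \<cdot> h) \<cdot> f\<^sup>\<inverse>" using assms(9) by simp
  also have "\<dots> = h \<cdot> f\<^sup>\<inverse>" using assms(1-8) by simp
  finally show ?thesis .
qed

lemma merge_diag [simp]:
  assumes [simp]: "a \<in> Obj C" "b \<in> Obj C"
  shows "diag C (merge C a b)"
proof -
  have "(\<a> a b (Tgt C h))\<^sup>\<inverse> \<cdot> (ide a \<odot> (ide b \<odot> h)) = (ide (a \<otimes> b) \<odot> h) \<cdot> (\<a> a b (Src C h))\<^sup>\<inverse>"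
    if "h \<in> Arr C" for h
    using assoc_natural[of "ide a" a a "ide b" b b h "Src C h" "Tgt C h"] that
    by (intro inv_natural) (simp_all add: HomI)
  then show ?thesis by (auto simp: merge_def diag_def intro!: HomI)
qed

lemma create_diag [simp]: "diag C (create C)"
proof -
  have "(\<l> (Tgt C h))\<^sup>\<inverse> \<cdot> h = (ide \<one> \<odot> h) \<cdot> (\<l> (Src C h))\<^sup>\<inverse>" if "h \<in> Arr C" for h
    using lunit_natural[of h "Src C h" "Tgt C h"] that by (intro inv_natural) (simp_all add: HomI)
  then show ?thesis by (auto simp: create_def diag_def intro!: HomI)
qed

lemma split_merge:
  assumes [simp]: "a \<in> Obj C" "b \<in> Obj C"
  shows "split C a b \<bullet> merge C a b = did C [a, b]" "merge C a b \<bullet> split C a b = did C [a \<otimes> b]"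
  by (intro diag_eqI; auto simp: dmap_dcomp; auto simp: did_def merge_def split_def)+

lemma erase_create: "erase C \<bullet> create C = did C []" "create C \<bullet> erase C = did C [\<one>]"
  by (intro diag_eqI; auto simp: dmap_dcomp; auto simp: did_def erase_def create_def)+

lemma coherence_cancel [simp]:
  assumes [simp]: "set xs \<subseteq> Obj C" "set ys \<subseteq> Obj C"
  shows "\<lbrakk>a \<in> Obj C; b \<in> Obj C\<rbrakk>
      \<Longrightarrow> xs \<lhd> split C a b \<rhd> ys \<bullet> xs \<lhd> merge C a b \<rhd> ys = did C (xs @ [a, b] @ ys)"
    "\<lbrakk>a \<in> Obj C; b \<in> Obj C\<rbrakk>
      \<Longrightarrow> xs \<lhd> merge C a b \<rhd> ys \<bullet> xs \<lhd> split C a b \<rhd> ys = did C (xs @ [a \<otimes> b] @ ys)"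
    "xs \<lhd> erase C \<rhd> ys \<bullet> xs \<lhd> create C \<rhd> ys = did C (xs @ ys)"
    "xs \<lhd> create C \<rhd> ys \<bullet> xs \<lhd> erase C \<rhd> ys = did C (xs @ [\<one>] @ ys)"
  by (simp_all add: split_merge erase_create flip: whisker_comp)

declare split_merge [simp] erase_create [simp]

lemma dcomp_cancel:
  assumes "g \<bullet> f = did C xs" "diag C t" "dtgt t = xs"
  shows "g \<bullet> f \<bullet> t = t"
  using assms by (simp flip: dcomp_assoc)

lemma coherence_cancel_comp [simp]:
  assumes [simp]: "set xs \<subseteq> Obj C" "set ys \<subseteq> Obj C" and t: "diag C t"
  shows "\<lbrakk>a \<in> Obj C; b \<in> Obj C; dtgt t = xs @ [a, b] @ ys\<rbrakk>
      \<Longrightarrow> xs \<lhd> split C a b \<rhd> ys \<bullet> xs \<lhd> merge C a b \<rhd> ys \<bullet> t = t"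
    "\<lbrakk>a \<in> Obj C; b \<in> Obj C; dtgt t = xs @ [a \<otimes> b] @ ys\<rbrakk>
      \<Longrightarrow> xs \<lhd> merge C a b \<rhd> ys \<bullet> xs \<lhd> split C a b \<rhd> ys \<bullet> t = t"
    "dtgt t = xs @ ys \<Longrightarrow> xs \<lhd> erase C \<rhd> ys \<bullet> xs \<lhd> create C \<rhd> ys \<bullet> t = t"
    "dtgt t = xs @ [\<one>] @ ys \<Longrightarrow> xs \<lhd> create C \<rhd> ys \<bullet> xs \<lhd> erase C \<rhd> ys \<bullet> t = t"
  by (rule dcomp_cancel[OF _ t]; simp)+

lemma split_merge_comp [simp]:
  assumes [simp]: "a \<in> Obj C" "b \<in> Obj C" and t: "diag C t"
  shows "dtgt t = [a, b] \<Longrightarrow> split C a b \<bullet> merge C a b \<bullet> t = t"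
    "dtgt t = [a \<otimes> b] \<Longrightarrow> merge C a b \<bullet> split C a b \<bullet> t = t"
  by (rule dcomp_cancel[OF _ t]; simp)+

lemma erase_create_comp [simp]:
  assumes t: "diag C t"
  shows "dtgt t = [] \<Longrightarrow> erase C \<bullet> create C \<bullet> t = t"
    "dtgt t = [\<one>] \<Longrightarrow> create C \<bullet> erase C \<bullet> t = t"
  by (rule dcomp_cancel[OF _ t]; simp)+

text \<open>The component at \<open>\<one>\<close> recovers \<open>f\<close> up to the right unitor,
  so every equation of arrows may be proved between diagrams.\<close>

lemma emb_faithful:
  assumes "emb C f = emb C g" and [simp]: "f \<in> Arr C" "g \<in> Arr C"
  shows "f = g"
proof -
  have st: "Src C f = Src C g" "Tgt C f = Tgt C g"
    using arg_cong[OF assms(1), of dsrc] arg_cong[OF assms(1), of dtgt] by simp_all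
  have "f \<odot> ide \<one> = g \<odot> ide \<one>"
    using fun_cong[OF arg_cong[OF assms(1), of dmap], of \<one>] by (simp add: emb_def)
  then have "f \<cdot> \<r> (Src C f) = g \<cdot> \<r> (Src C f)"
    using runit_natural[of f "Src C f" "Tgt C f"] runit_natural[of g "Src C g" "Tgt C g"] st
    by (simp add: HomI)
  then show ?thesis
    by (rule iso_cancel_right[rotated -1]) (auto simp: st)
qed

lemma emb_ide: "a \<in> Obj C \<Longrightarrow> emb C (ide a) = did C [a]"
  by (intro diag_eqI) (simp_all, simp add: emb_def did_def)

lemma emb_comp: "\<lbrakk>f \<in> Arr C; g \<in> Arr C; Src C g = Tgt C f\<rbrakk> \<Longrightarrow> emb C (g \<cdot> f) = emb C g \<bullet> emb C f"
  by (intro diag_eqI) (auto simp: dmap_dcomp, auto simp: emb_def tensor_comp')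

text \<open>Naturality of the associator in its first two arguments. The boxes are drawn at
  different heights, the right one applied first; \<open>interchange\<close> gives the other
  order.\<close>

lemma emb_tensor:
  assumes [simp]: "f \<in> Arr C" "g \<in> Arr C"
  shows "emb C (f \<odot> g) = merge C (Tgt C f) (Tgt C g) \<bullet> [] \<lhd> emb C f \<rhd> [Tgt C g] \<bullet> [Src C f] \<lhd> emb C g \<rhd> []
    \<bullet> split C (Src C f) (Src C g)"
proof (rule diag_eqI; auto simp: dmap_dcomp dmap_whisker)
  fix z assume [simp]: "z \<in> Obj C"
  have "\<a> (Tgt C f) (Tgt C g) z \<cdot> ((f \<odot> g) \<odot> ide z) = (f \<odot> (g \<odot> ide z)) \<cdot> \<a> (Src C f) (Src C g) z"
    using assoc_natural[of f "Src C f" "Tgt C f" g "Src C g" "Tgt C g" "ide z" z z] by (simp add: HomI)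
  then have "(\<a> (Tgt C f) (Tgt C g) z)\<^sup>\<inverse> \<cdot> (f \<odot> (g \<odot> ide z)) = ((f \<odot> g) \<odot> ide z) \<cdot> (\<a> (Src C f) (Src C g) z)\<^sup>\<inverse>"
    by (intro inv_natural) auto
  then have "((\<a> (Tgt C f) (Tgt C g) z)\<^sup>\<inverse> \<cdot> (f \<odot> (g \<odot> ide z))) \<cdot> \<a> (Src C f) (Src C g) z = (f \<odot> g) \<odot> ide z"
    by simp
  moreover have "f \<odot> (g \<odot> ide z) = (f \<odot> ide (Tgt C g \<otimes> z)) \<cdot> (ide (Src C f) \<odot> (g \<odot> ide z))"
    by (simp add: tensor_comp')
  ultimately show "dmap (emb C (f \<odot> g)) z = dmap (merge C (Tgt C f) (Tgt C g)) z \<cdot>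
         dmap (emb C f) (Tgt C g \<otimes> z) \<cdot> (ide (Src C f) \<odot> dmap (emb C g) z) \<cdot> dmap (split C (Src C f) (Src C g)) z"
    by (simp add: emb_def merge_def split_def)
qed

text \<open>This is the pentagon with \<open>z\<close> as the fourth object. From here on
  rebracketing is a formal product of \<open>merge\<close> and \<open>split\<close>, which cancels
  by rewriting.\<close>

lemma emb_assoc:
  assumes [simp]: "a \<in> Obj C" "b \<in> Obj C" "c \<in> Obj C"
  shows "emb C (\<a> a b c) = merge C a (b \<otimes> c) \<bullet> [a] \<lhd> merge C b c \<rhd> [] \<bullet> [] \<lhd> split C a b \<rhd> [c] \<bullet> split C (a \<otimes> b) c"
proof (rule diag_eqI; auto simp: dmap_dcomp dmap_whisker)
  fix z assume [simp]: "z \<in> Obj C"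
  have "(\<a> a (b \<otimes> c) z)\<^sup>\<inverse> \<cdot> (ide a \<odot> (\<a> b c z)\<^sup>\<inverse>) \<cdot> (\<a> a b (c \<otimes> z) \<cdot> \<a> (a \<otimes> b) c z)
      = (\<a> a (b \<otimes> c) z)\<^sup>\<inverse> \<cdot> ((ide a \<odot> (\<a> b c z)\<^sup>\<inverse>) \<cdot> (ide a \<odot> \<a> b c z))
          \<cdot> \<a> a (b \<otimes> c) z \<cdot> (\<a> a b c \<odot> ide z)"
    unfolding pentagon[OF assms \<open>z \<in> Obj C\<close>] by simp
  also have "\<dots> = \<a> a b c \<odot> ide z"
    by (subst tensor_comp') simp_all
  finally have "(\<a> a (b \<otimes> c) z)\<^sup>\<inverse> \<cdot> (ide a \<odot> (\<a> b c z)\<^sup>\<inverse>) \<cdot> (\<a> a b (c \<otimes> z) \<cdot> \<a> (a \<otimes> b) c z)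
      = \<a> a b c \<odot> ide z" .
  then show "dmap (emb C (\<a> a b c)) z = dmap (merge C a (b \<otimes> c)) z \<cdot>
         (ide a \<odot> dmap (merge C b c) z) \<cdot> dmap (split C a b) (c \<otimes> z) \<cdot> dmap (split C (a \<otimes> b) c) z"
    by (simp add: emb_def merge_def split_def)
qed

text \<open>The component at \<open>z\<close> is \<open>lunit_tensor\<close>, just as for the right
  unitor below it is the triangle axiom.\<close>

lemma emb_lunit: "a \<in> Obj C \<Longrightarrow> emb C (\<l> a) = [] \<lhd> erase C \<rhd> [a] \<bullet> split C \<one> a"
  by (rule diag_eqI; auto simp: dmap_dcomp dmap_whisker)
     (auto simp: emb_def erase_def split_def lunit_tensor)

lemma emb_runit: "a \<in> Obj C \<Longrightarrow> emb C (\<r> a) = [a] \<lhd> erase C \<rhd> [] \<bullet> split C a \<one>"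
  by (rule diag_eqI; auto simp: dmap_dcomp dmap_whisker)
     (auto simp: emb_def erase_def split_def triangle)

lemma emb_inv_cancel:
  assumes "is_iso C f"
  shows "emb C (f\<^sup>\<inverse>) \<bullet> emb C f = did C [Src C f]" "emb C f \<bullet> emb C (f\<^sup>\<inverse>) = did C [Tgt C f]"
  using assms iso_arr[OF assms] by (simp_all add: emb_ide flip: emb_comp)

lemma inverse_diagram_unique:
  assumes "g \<bullet> f = did C xs" "f \<bullet> h = did C ys" "diag C g" "diag C h" "dsrc g = ys" "dtgt h = xs"
  shows "g = h"
proof -
  have "g = g \<bullet> (f \<bullet> h)" using assms by simp
  also have "\<dots> = (g \<bullet> f) \<bullet> h" by simp
  also have "\<dots> = h" using assms by simp
  finally show ?thesis .
qed

text \<open>Since \<open>f\<close> is already known to be invertible, a one-sided inverse diagram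
  determines the diagram of its inverse.\<close>

lemma emb_inv_eq:
  assumes "is_iso C f" "emb C f \<bullet> h = did C [Tgt C f]" "diag C h" "dtgt h = [Src C f]"
  shows "emb C (f\<^sup>\<inverse>) = h"
  using assms emb_inv_cancel[OF assms(1)] iso_arr[OF assms(1)]
  by - (rule inverse_diagram_unique[of _ "emb C f" "[Src C f]" _ "[Tgt C f]"], auto)

lemma emb_inv_assoc:
  assumes [simp]: "a \<in> Obj C" "b \<in> Obj C" "c \<in> Obj C"
  shows "emb C ((\<a> a b c)\<^sup>\<inverse>) = merge C (a \<otimes> b) c \<bullet> [] \<lhd> merge C a b \<rhd> [c] \<bullet> [a] \<lhd> split C b c \<rhd> [] \<bullet> split C a (b \<otimes> c)"
  by (rule emb_inv_eq) (simp_all add: emb_assoc)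

lemma emb_inv_lunit: "a \<in> Obj C \<Longrightarrow> emb C ((\<l> a)\<^sup>\<inverse>) = merge C \<one> a \<bullet> [] \<lhd> create C \<rhd> [a]"
  by (rule emb_inv_eq) (simp_all add: emb_lunit)

lemma emb_inv_runit: "a \<in> Obj C \<Longrightarrow> emb C ((\<r> a)\<^sup>\<inverse>) = merge C a \<one> \<bullet> [a] \<lhd> create C \<rhd> []"
  by (rule emb_inv_eq) (simp_all add: emb_runit)

lemmas emb_simps = emb_ide emb_comp emb_tensor emb_assoc emb_lunit emb_runit
  emb_inv_assoc emb_inv_lunit emb_inv_runit

end

section \<open>Duals\<close>

context
  fixes C :: "('o, 'm, 'z) moncat_scheme" (structure)
begin

definition cap :: "'o \<Rightarrow> 'o \<Rightarrow> 'm \<Rightarrow> ('o, 'm) diagram" where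
  "cap u v p = erase C \<bullet> emb C p \<bullet> merge C u v"

definition cup :: "'o \<Rightarrow> 'o \<Rightarrow> 'm \<Rightarrow> ('o, 'm) diagram" where
  "cup u v q = split C u v \<bullet> emb C q \<bullet> create C"

end

context monoidal_category
begin

lemma comp_extend: "g \<bullet> f = h \<Longrightarrow> g \<bullet> f \<bullet> t = h \<bullet> t"
  by (simp flip: dcomp_assoc)

lemma comp_extend3: "k \<bullet> g \<bullet> f = h \<Longrightarrow> k \<bullet> g \<bullet> f \<bullet> t = h \<bullet> t"
  by (simp flip: dcomp_assoc)

lemma whisker_eq: "l = r \<Longrightarrow> xs \<lhd> l \<rhd> ys = xs \<lhd> r \<rhd> ys"
  by simp

lemma HomD: "f \<in> Hom C a b \<Longrightarrow> f \<in> Arr C \<and> Src C f = a \<and> Tgt C f = b"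
  by (simp add: Hom_def)

lemma Hom_obj: "f \<in> Hom C a b \<Longrightarrow> a \<in> Obj C" "f \<in> Hom C a b \<Longrightarrow> b \<in> Obj C"
  by (auto simp: Hom_def)

lemma cap_simps [simp]:
  assumes "p \<in> Hom C (u \<otimes> v) \<one>" "u \<in> Obj C" "v \<in> Obj C"
  shows "diag C (cap C u v p)" "dsrc (cap C u v p) = [u, v]" "dtgt (cap C u v p) = []"
  using assms HomD[OF assms(1)] by (simp_all add: cap_def)

lemma cup_simps [simp]:
  assumes "q \<in> Hom C \<one> (u \<otimes> v)" "u \<in> Obj C" "v \<in> Obj C"
  shows "diag C (cup C u v q)" "dsrc (cup C u v q) = []" "dtgt (cup C u v q) = [u, v]"
  using assms HomD[OF assms(1)] by (simp_all add: cup_def)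

lemma emb_Hom [simp]:
  assumes "f \<in> Hom C a b"
  shows "diag C (emb C f)" "dsrc (emb C f) = [a]" "dtgt (emb C f) = [b]"
  using HomD[OF assms] by auto

lemma emb_faithful_Hom: "\<lbrakk>f \<in> Hom C a b; g \<in> Hom C a b; emb C f = emb C g\<rbrakk> \<Longrightarrow> f = g"
  by (auto intro: emb_faithful simp: Hom_def)

lemma cap_comp_tensor:
  assumes "p \<in> Hom C (u \<otimes> v) \<one>" "f \<in> Hom C a u" "g \<in> Hom C b v"
  shows "cap C a b (p \<cdot> (f \<odot> g)) = cap C u v p \<bullet> [] \<lhd> emb C f \<rhd> [v] \<bullet> [a] \<lhd> emb C g \<rhd> []"
  using HomD[OF assms(1)] HomD[OF assms(2)] HomD[OF assms(3)]
  by (auto simp: cap_def emb_simps)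

end

context rigid_category
begin

lemma dual_obj' [simp]: "a \<in> Obj C \<Longrightarrow> Dual C a \<in> Obj C"
  by (rule dual_obj)

lemma ev_arr [simp]: "a \<in> Obj C \<Longrightarrow> Ev C a \<in> Arr C" "a \<in> Obj C \<Longrightarrow> Src C (Ev C a) = Dual C a \<otimes> a"
    "a \<in> Obj C \<Longrightarrow> Tgt C (Ev C a) = \<one>"
    "a \<in> Obj C \<Longrightarrow> Coev C a \<in> Arr C" "a \<in> Obj C \<Longrightarrow> Src C (Coev C a) = \<one>"
    "a \<in> Obj C \<Longrightarrow> Tgt C (Coev C a) = a \<otimes> Dual C a"
  using ev_hom coev_hom by (auto simp: Hom_def)

abbreviation (input) ev_cap where "ev_cap a \<equiv> cap C (Dual C a) a (Ev C a)"
abbreviation (input) coev_cup where "coev_cup a \<equiv> cup C a (Dual C a) (Coev C a)"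

lemma ev_cap_simps [simp]:
  assumes "a \<in> Obj C"
  shows "diag C (ev_cap a)" "dsrc (ev_cap a) = [Dual C a, a]" "dtgt (ev_cap a) = []"
    "diag C (coev_cup a)" "dsrc (coev_cup a) = []" "dtgt (coev_cup a) = [a, Dual C a]"
  using assms ev_hom coev_hom by simp_all

lemma zigzag_obj_diagram:
  assumes [simp]: "a \<in> Obj C"
  shows "[a] \<lhd> ev_cap a \<rhd> [] \<bullet> [] \<lhd> coev_cup a \<rhd> [a] = did C [a]"
  using arg_cong[OF zigzag_obj[OF assms], of "emb C"] by (simp add: emb_simps cap_def cup_def)

lemma zigzag_dual_diagram:
  assumes [simp]: "a \<in> Obj C"
  shows "[] \<lhd> ev_cap a \<rhd> [Dual C a] \<bullet> [Dual C a] \<lhd> coev_cup a \<rhd> [] = did C [Dual C a]"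
  using arg_cong[OF zigzag_dual[OF assms], of "emb C"] by (simp add: emb_simps cap_def cup_def)

lemma curry_hom:
  assumes [simp]: "u \<in> Obj C" "v \<in> Obj C" and p: "p \<in> Hom C (u \<otimes> v) \<one>"
  shows "curry_pairing C u v p \<in> Hom C u (Dual C v)"
  using HomD[OF p] by (auto simp: curry_pairing_def intro!: HomI)

lemma emb_curry:
  assumes [simp]: "u \<in> Obj C" "v \<in> Obj C" and p: "p \<in> Hom C (u \<otimes> v) \<one>"
  shows "emb C (curry_pairing C u v p) = [] \<lhd> cap C u v p \<rhd> [Dual C v] \<bullet> [u] \<lhd> coev_cup v \<rhd> []"
  using HomD[OF p] by (simp add: curry_pairing_def emb_simps cap_def cup_def)

text \<open>The universal property of currying: once \<open>p\<close> has slid past the evaluation,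
  the coevaluation inside the curried arrow and \<open>ev\<close> form a zig-zag on the strand
  \<open>v\<close>.\<close>

lemma ev_curry:
  assumes [simp]: "u \<in> Obj C" "v \<in> Obj C" and p [simp]: "p \<in> Hom C (u \<otimes> v) \<one>"
  shows "ev_cap v \<bullet> [] \<lhd> emb C (curry_pairing C u v p) \<rhd> [v] = cap C u v p"
proof -
  have i: "ev_cap v \<bullet> [] \<lhd> cap C u v p \<rhd> [Dual C v, v] = cap C u v p \<bullet> [u, v] \<lhd> ev_cap v \<rhd> []"
    using interchange[of "[]" "cap C u v p" "[]" "ev_cap v" "[]"] by simp
  have z: "[u, v] \<lhd> ev_cap v \<rhd> [] \<bullet> [u] \<lhd> coev_cup v \<rhd> [v] = did C [u, v]"
    using whisker_eq[OF zigzag_obj_diagram[of v], of "[u]" "[]"] by simp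
  show ?thesis by (simp add: emb_curry comp_extend[OF i] z)
qed

text \<open>Counterpart of \<open>ev_curry\<close> for the other half of a duality: a copairing that
  straightens against \<open>p\<close> on the strand \<open>v\<close> is carried to the
  coevaluation.\<close>

lemma curry_coev:
  assumes [simp]: "u \<in> Obj C" "v \<in> Obj C" and p [simp]: "p \<in> Hom C (u \<otimes> v) \<one>"
    and Q [simp]: "diag C Q" "dsrc Q = []" "dtgt Q = [v, u]"
    and z: "[v] \<lhd> cap C u v p \<rhd> [] \<bullet> [] \<lhd> Q \<rhd> [v] = did C [v]"
  shows "[v] \<lhd> emb C (curry_pairing C u v p) \<rhd> [] \<bullet> Q = coev_cup v"
proof -
  have i: "[v, u] \<lhd> coev_cup v \<rhd> [] \<bullet> Q = [] \<lhd> Q \<rhd> [v, Dual C v] \<bullet> coev_cup v"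
    using interchange[of "[]" Q "[]" "coev_cup v" "[]"] by simp
  have z: "[v] \<lhd> cap C u v p \<rhd> [Dual C v] \<bullet> [] \<lhd> Q \<rhd> [v, Dual C v] = did C [v, Dual C v]"
    using whisker_eq[OF z, of "[]" "[Dual C v]"] by simp
  show ?thesis by (simp add: emb_curry i comp_extend[OF z])
qed

text \<open>Uniqueness of duals: both zig-zags say that \<open>u\<close> is itself a dual of
  \<open>v\<close>. This is the source of all invertible comparison arrows with duals.\<close>

lemma curry_iso:
  assumes [simp]: "u \<in> Obj C" "v \<in> Obj C" and p [simp]: "p \<in> Hom C (u \<otimes> v) \<one>"
    and q: "q \<in> Hom C \<one> (v \<otimes> u)"
    and z1: "[v] \<lhd> cap C u v p \<rhd> [] \<bullet> [] \<lhd> cup C v u q \<rhd> [v] = did C [v]"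
    and z2: "[] \<lhd> cap C u v p \<rhd> [u] \<bullet> [u] \<lhd> cup C v u q \<rhd> [] = did C [u]"
  shows "is_iso C (curry_pairing C u v p)"
proof -
  let ?c = "curry_pairing C u v p" and ?Q = "cup C v u q" and ?v = "Dual C v"
  \<comment> \<open>The same currying with the two dualities exchanged: the evaluation of
    \<open>v\<close> is bent by the copairing \<open>q\<close>.\<close>
  let ?k = "\<l> u \<cdot> (Ev C v \<odot> ide u) \<cdot> (\<a> ?v v u)\<^sup>\<inverse> \<cdot> (ide ?v \<odot> q) \<cdot> (\<r> ?v)\<^sup>\<inverse>"
  note [simp] = q curry_hom
  have k: "?k \<in> Hom C ?v u"
    using HomD[OF q] by (auto intro!: HomI)
  have ek: "emb C ?k = [] \<lhd> ev_cap v \<rhd> [u] \<bullet> [?v] \<lhd> ?Q \<rhd> []"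
    using HomD[OF q] by (simp add: emb_simps cap_def cup_def)
  have i: "emb C ?c \<bullet> [] \<lhd> ev_cap v \<rhd> [u] = [] \<lhd> ev_cap v \<rhd> [?v] \<bullet> [?v, v] \<lhd> emb C ?c \<rhd> []"
    using interchange[of "[]" "ev_cap v" "[]" "emb C ?c" "[]"] emb_Hom[OF curry_hom[of u v p]] by simp
  have c: "[?v, v] \<lhd> emb C ?c \<rhd> [] \<bullet> [?v] \<lhd> ?Q \<rhd> [] = [?v] \<lhd> coev_cup v \<rhd> []"
    using whisker_eq[OF curry_coev[OF _ _ p _ _ _ z1], of "[?v]" "[]"] by simp
  have "emb C ?c \<bullet> emb C ?k = emb C (ide ?v)"
    unfolding ek comp_extend[OF i] dcomp_assoc c zigzag_dual_diagram[OF assms(2)] by (simp add: emb_ide)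
  then have 1: "?c \<cdot> ?k = ide ?v"
    using HomD[OF k] HomD[OF curry_hom[OF assms(1,2) p]]
    by (intro emb_faithful) (simp_all add: emb_comp)
  have i: "[?v] \<lhd> ?Q \<rhd> [] \<bullet> emb C ?c = [] \<lhd> emb C ?c \<rhd> [v, u] \<bullet> [u] \<lhd> ?Q \<rhd> []"
    using interchange[of "[]" "emb C ?c" "[]" ?Q "[]"] emb_Hom[OF curry_hom[of u v p]] by simp
  have c: "[] \<lhd> ev_cap v \<rhd> [u] \<bullet> [] \<lhd> emb C ?c \<rhd> [v, u] = [] \<lhd> cap C u v p \<rhd> [u]"
    using whisker_eq[OF ev_curry[OF _ _ p], of "[]" "[u]"] by simp
  have "emb C ?k \<bullet> emb C ?c = emb C (ide u)"
    unfolding ek dcomp_assoc i comp_extend[OF c] z2 by (simp add: emb_ide)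
  then have 2: "?k \<cdot> ?c = ide u"
    using HomD[OF k] HomD[OF curry_hom[OF assms(1,2) p]]
    by (intro emb_faithful) (simp_all add: emb_comp)
  show ?thesis
    by (rule is_isoI[OF curry_hom[OF assms(1-3)] k 2 1])
qed

lemma dual_arrow_hom:
  assumes "f \<in> Hom C a b"
  shows "dual_arrow C f \<in> Hom C (Dual C b) (Dual C a)"
  using HomD[OF assms] Hom_obj[OF assms] curry_hom[of "Dual C b" a "Ev C b \<cdot> (ide (Dual C b) \<odot> f)"]
  by (simp add: dual_arrow_def HomI)

text \<open>The rule by which a box passes over a cap and becomes its dual;
  \<open>dual_arrow\<close> is defined by currying the right-hand side.\<close>

lemma ev_dual_arrow:
  assumes f [simp]: "f \<in> Hom C a b"
  shows "ev_cap a \<bullet> [] \<lhd> emb C (dual_arrow C f) \<rhd> [a] = ev_cap b \<bullet> [Dual C b] \<lhd> emb C f \<rhd> []"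
proof -
  note [simp] = Hom_obj[OF f] HomD[OF f]
  have "ev_cap a \<bullet> [] \<lhd> emb C (dual_arrow C f) \<rhd> [a] = cap C (Dual C b) a (Ev C b \<cdot> (ide (Dual C b) \<odot> f))"
    unfolding dual_arrow_def using ev_curry[of "Dual C b" a] by (simp add: HomI)
  also have "\<dots> = ev_cap b \<bullet> [Dual C b] \<lhd> emb C f \<rhd> []"
    using cap_comp_tensor[of "Ev C b" "Dual C b" b "ide (Dual C b)" "Dual C b" f a]
    by (simp add: HomI emb_ide)
  finally show ?thesis .
qed

text \<open>The passage under a cup needs one more zig-zag: the cup of \<open>b\<close> straightens
  against the cap hidden in the dual arrow.\<close>

lemma coev_dual_arrow:
  assumes f [simp]: "f \<in> Hom C a b"
  shows "[b] \<lhd> emb C (dual_arrow C f) \<rhd> [] \<bullet> coev_cup b = [] \<lhd> emb C f \<rhd> [Dual C a] \<bullet> coev_cup a"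
proof -
  let ?f = "emb C f" and ?a = "Dual C a" and ?b = "Dual C b"
  note [simp] = Hom_obj[OF f] HomD[OF f]
  have e: "emb C (dual_arrow C f) = [] \<lhd> ev_cap b \<rhd> [?a] \<bullet> [?b] \<lhd> ?f \<rhd> [?a] \<bullet> [?b] \<lhd> coev_cup a \<rhd> []"
    using emb_curry[of "Dual C b" a "Ev C b \<cdot> (ide (Dual C b) \<odot> f)"]
      cap_comp_tensor[of "Ev C b" "Dual C b" b "ide (Dual C b)" "Dual C b" f a]
    by (simp add: dual_arrow_def HomI emb_ide)
  have i: "[b, ?b] \<lhd> coev_cup a \<rhd> [] \<bullet> coev_cup b = [] \<lhd> coev_cup b \<rhd> [a, ?a] \<bullet> coev_cup a"
    using interchange[of "[]" "coev_cup b" "[]" "coev_cup a" "[]"] by simp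
  have j: "[b, ?b] \<lhd> ?f \<rhd> [?a] \<bullet> [] \<lhd> coev_cup b \<rhd> [a, ?a] = [] \<lhd> coev_cup b \<rhd> [b, ?a] \<bullet> [] \<lhd> ?f \<rhd> [?a]"
    using interchange[of "[]" "coev_cup b" "[]" ?f "[?a]"] by simp
  have z: "[b] \<lhd> ev_cap b \<rhd> [?a] \<bullet> [] \<lhd> coev_cup b \<rhd> [b, ?a] = did C [b, ?a]"
    using whisker_eq[OF zigzag_obj_diagram[of b], of "[]" "[?a]"] by simp
  show ?thesis
    by (simp add: e i comp_extend[OF j] comp_extend[OF z])
qed

end

section \<open>Pivotal structures\<close>

context pivotal_category
begin

lemma piv_arr [simp]:
  "a \<in> Obj C \<Longrightarrow> Piv C a \<in> Arr C" "a \<in> Obj C \<Longrightarrow> Src C (Piv C a) = a"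
  "a \<in> Obj C \<Longrightarrow> Tgt C (Piv C a) = Dual C (Dual C a)" "a \<in> Obj C \<Longrightarrow> is_iso C (Piv C a)"
proof -
  interpret monoidal_natural_iso C C "id_tfun C" "double_dual C" "Piv C" by (rule pivotal)
  show "a \<in> Obj C \<Longrightarrow> Piv C a \<in> Arr C" "a \<in> Obj C \<Longrightarrow> Src C (Piv C a) = a"
    "a \<in> Obj C \<Longrightarrow> Tgt C (Piv C a) = Dual C (Dual C a)" "a \<in> Obj C \<Longrightarrow> is_iso C (Piv C a)"
    using component_hom[of a] component_iso[of a] by (auto simp: Hom_def id_tfun_def double_dual_def)
qed

lemma piv_natural: "f \<in> Hom C a b \<Longrightarrow> Piv C b \<cdot> f = dual_arrow C (dual_arrow C f) \<cdot> Piv C a"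
  using monoidal_natural_iso.natural[OF pivotal, of f a b] by (simp add: id_tfun_def double_dual_def)

text \<open>Partner of \<open>ev_tilde\<close>: the two straighten against each other, which makes
  the dual of \<open>y\<close> a dual on the other side as well.\<close>

definition coev_tilde :: "'o \<Rightarrow> 'm" where
  "coev_tilde y = (ide (Dual C y) \<odot> (Piv C y)\<^sup>\<inverse>) \<cdot> Coev C (Dual C y)"

abbreviation (input) evt_cap where "evt_cap y \<equiv> cap C y (Dual C y) (ev_tilde C y)"
abbreviation (input) coevt_cup where "coevt_cup y \<equiv> cup C (Dual C y) y (coev_tilde y)"

lemma tilde_hom:
  "y \<in> Obj C \<Longrightarrow> ev_tilde C y \<in> Hom C (y \<otimes> Dual C y) \<one>"
  "y \<in> Obj C \<Longrightarrow> coev_tilde y \<in> Hom C \<one> (Dual C y \<otimes> y)"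
  by (auto simp: ev_tilde_def coev_tilde_def intro!: HomI)

lemma tilde_arr [simp]:
  assumes "y \<in> Obj C"
  shows "ev_tilde C y \<in> Arr C" "Src C (ev_tilde C y) = y \<otimes> Dual C y" "Tgt C (ev_tilde C y) = \<one>"
    "coev_tilde y \<in> Arr C" "Src C (coev_tilde y) = \<one>" "Tgt C (coev_tilde y) = Dual C y \<otimes> y"
    "diag C (evt_cap y)" "dsrc (evt_cap y) = [y, Dual C y]" "dtgt (evt_cap y) = []"
    "diag C (coevt_cup y)" "dsrc (coevt_cup y) = []" "dtgt (coevt_cup y) = [Dual C y, y]"
  using assms tilde_hom[OF assms] by (auto simp: Hom_def)

lemma evt_cap_eq:
  assumes [simp]: "y \<in> Obj C"
  shows "evt_cap y = ev_cap (Dual C y) \<bullet> [] \<lhd> emb C (Piv C y) \<rhd> [Dual C y]"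
  using cap_comp_tensor[of "Ev C (Dual C y)" "Dual C (Dual C y)" "Dual C y" "Piv C y" y "ide (Dual C y)" "Dual C y"]
  by (simp add: ev_tilde_def HomI emb_ide)

lemma coevt_cup_eq:
  assumes [simp]: "y \<in> Obj C"
  shows "coevt_cup y = [Dual C y] \<lhd> emb C ((Piv C y)\<^sup>\<inverse>) \<rhd> [] \<bullet> coev_cup (Dual C y)"
  by (simp add: coev_tilde_def cup_def emb_simps)

text \<open>The zig-zag on the double dual of \<open>y\<close>, conjugated by the pivotal
  isomorphism.\<close>

lemma zigzag_tilde_obj:
  assumes [simp]: "y \<in> Obj C"
  shows "[] \<lhd> evt_cap y \<rhd> [y] \<bullet> [y] \<lhd> coevt_cup y \<rhd> [] = did C [y]"
proof -
  let ?y = "Dual C y" and ?p = "emb C (Piv C y)" and ?q = "emb C ((Piv C y)\<^sup>\<inverse>)"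
  have i1: "[] \<lhd> ?p \<rhd> [?y, y] \<bullet> [y, ?y] \<lhd> ?q \<rhd> [] = [Dual C ?y, ?y] \<lhd> ?q \<rhd> [] \<bullet> [] \<lhd> ?p \<rhd> [?y, Dual C ?y]"
    using interchange[of "[]" ?p "[?y]" ?q "[]"] by simp
  have i2: "[] \<lhd> ev_cap ?y \<rhd> [y] \<bullet> [Dual C ?y, ?y] \<lhd> ?q \<rhd> [] = ?q \<bullet> [] \<lhd> ev_cap ?y \<rhd> [Dual C ?y]"
    using interchange[of "[]" "ev_cap ?y" "[]" ?q "[]"] by simp
  have i3: "[] \<lhd> ?p \<rhd> [?y, Dual C ?y] \<bullet> [y] \<lhd> coev_cup ?y \<rhd> [] = [Dual C ?y] \<lhd> coev_cup ?y \<rhd> [] \<bullet> ?p"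
    using interchange[of "[]" ?p "[]" "coev_cup ?y" "[]"] by simp
  have z: "[] \<lhd> ev_cap ?y \<rhd> [Dual C ?y] \<bullet> [Dual C ?y] \<lhd> coev_cup ?y \<rhd> [] = did C [Dual C ?y]"
    by (rule zigzag_dual_diagram) simp
  show ?thesis
    by (simp add: evt_cap_eq coevt_cup_eq comp_extend[OF i1] comp_extend[OF i2] i3 comp_extend[OF z])
       (simp add: emb_ide flip: emb_comp)
qed

lemma zigzag_tilde_dual:
  assumes [simp]: "y \<in> Obj C"
  shows "[Dual C y] \<lhd> evt_cap y \<rhd> [] \<bullet> [] \<lhd> coevt_cup y \<rhd> [Dual C y] = did C [Dual C y]"
proof -
  let ?y = "Dual C y" and ?p = "emb C (Piv C y)" and ?q = "emb C ((Piv C y)\<^sup>\<inverse>)"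
  have pq: "?p \<bullet> ?q = did C [Dual C ?y]"
    by (simp add: emb_ide flip: emb_comp)
  have c: "[?y] \<lhd> ?p \<rhd> [?y] \<bullet> [?y] \<lhd> ?q \<rhd> [?y] = did C [?y, Dual C ?y, ?y]"
    using whisker_eq[OF pq, of "[?y]" "[?y]"] by simp
  show ?thesis
    by (simp add: evt_cap_eq coevt_cup_eq comp_extend[OF c] zigzag_obj_diagram)
qed

text \<open>The cap \<open>ev_tilde\<close> contains \<open>Piv\<close>. Naturality of
  \<open>Piv\<close> replaces \<open>f\<close> by its double dual, which then passes over the
  ordinary cap by \<open>ev_dual_arrow\<close>.\<close>

lemma evt_dual_arrow:
  assumes f [simp]: "f \<in> Hom C w y"
  shows "evt_cap y \<bullet> [] \<lhd> emb C f \<rhd> [Dual C y] = evt_cap w \<bullet> [w] \<lhd> emb C (dual_arrow C f) \<rhd> []"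
proof -
  note [simp] = Hom_obj[OF f]
  let ?f = "dual_arrow C f" and ?ff = "dual_arrow C (dual_arrow C f)"
  have df [simp]: "?f \<in> Hom C (Dual C y) (Dual C w)"
    by (rule dual_arrow_hom) simp
  have ddf [simp]: "?ff \<in> Hom C (Dual C (Dual C w)) (Dual C (Dual C y))"
    by (rule dual_arrow_hom) simp
  have n: "emb C (Piv C y) \<bullet> emb C f = emb C ?ff \<bullet> emb C (Piv C w)"
    using arg_cong[OF piv_natural[OF f], of "emb C"] HomD[OF f] HomD[OF ddf] by (simp add: emb_comp)
  have n': "[] \<lhd> emb C (Piv C y) \<rhd> [Dual C y] \<bullet> [] \<lhd> emb C f \<rhd> [Dual C y]
      = [] \<lhd> emb C ?ff \<rhd> [Dual C y] \<bullet> [] \<lhd> emb C (Piv C w) \<rhd> [Dual C y]"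
    using whisker_eq[OF n, of "[]" "[Dual C y]"] by simp
  have i: "[Dual C (Dual C w)] \<lhd> emb C ?f \<rhd> [] \<bullet> [] \<lhd> emb C (Piv C w) \<rhd> [Dual C y]
    = [] \<lhd> emb C (Piv C w) \<rhd> [Dual C w] \<bullet> [w] \<lhd> emb C ?f \<rhd> []"
    using interchange[of "[]" "emb C (Piv C w)" "[]" "emb C ?f" "[]"] emb_Hom[OF df] by simp
  show ?thesis
    by (simp add: evt_cap_eq n' comp_extend[OF ev_dual_arrow[OF df]] i)
qed

end

section \<open>Half-braidings and rotation\<close>

definition hb :: "('o, 'm, 'z) moncat_scheme \<Rightarrow> 'o \<Rightarrow> ('o \<Rightarrow> 'm) \<Rightarrow> 'o \<Rightarrow> ('o, 'm) diagram" where
  "hb C w e b = split C b w \<bullet>\<^bsub>C\<^esub> emb C (e b) \<bullet>\<^bsub>C\<^esub> merge C w b"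

definition hb_inv :: "('o, 'm, 'z) moncat_scheme \<Rightarrow> 'o \<Rightarrow> ('o \<Rightarrow> 'm) \<Rightarrow> 'o \<Rightarrow> ('o, 'm) diagram" where
  "hb_inv C w e b = split C w b \<bullet>\<^bsub>C\<^esub> emb C ((e b)\<^sup>\<inverse>\<^bsub>C\<^esub>) \<bullet>\<^bsub>C\<^esub> merge C b w"

text \<open>The traciator is the rotation of the counit.\<close>

definition rotation :: "('o, 'm, 'z) pivcat_scheme \<Rightarrow> 'o \<Rightarrow> ('o \<Rightarrow> 'm) \<Rightarrow> 'o \<Rightarrow> 'o \<Rightarrow> 'm \<Rightarrow> 'm" where
  "rotation C w e x y f = (let y' = Dual C y in
     \<r>\<^bsub>C\<^esub> (y \<otimes>\<^bsub>C\<^esub> x) \<cdot>\<^bsub>C\<^esub> (ide\<^bsub>C\<^esub> (y \<otimes>\<^bsub>C\<^esub> x) \<odot>\<^bsub>C\<^esub> ev_tilde C y) \<cdot>\<^bsub>C\<^esub> \<a>\<^bsub>C\<^esub> (y \<otimes>\<^bsub>C\<^esub> x) y y'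
       \<cdot>\<^bsub>C\<^esub> ((\<a>\<^bsub>C\<^esub> y x y)\<^sup>\<inverse>\<^bsub>C\<^esub> \<odot>\<^bsub>C\<^esub> ide\<^bsub>C\<^esub> y') \<cdot>\<^bsub>C\<^esub> ((ide\<^bsub>C\<^esub> y \<odot>\<^bsub>C\<^esub> f) \<odot>\<^bsub>C\<^esub> ide\<^bsub>C\<^esub> y') \<cdot>\<^bsub>C\<^esub> (e y \<odot>\<^bsub>C\<^esub> ide\<^bsub>C\<^esub> y')
       \<cdot>\<^bsub>C\<^esub> (\<a>\<^bsub>C\<^esub> w y y')\<^sup>\<inverse>\<^bsub>C\<^esub> \<cdot>\<^bsub>C\<^esub> (ide\<^bsub>C\<^esub> w \<odot>\<^bsub>C\<^esub> Coev C y) \<cdot>\<^bsub>C\<^esub> (\<r>\<^bsub>C\<^esub> w)\<^sup>\<inverse>\<^bsub>C\<^esub>)"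

section \<open>Half-braidings as crossings of strands\<close>

context monoidal_category
begin

lemma half_braidingD:
  assumes "half_braiding C w e" "b \<in> Obj C"
  shows "e b \<in> Arr C" "w \<in> Obj C \<Longrightarrow> Src C (e b) = w \<otimes> b" "w \<in> Obj C \<Longrightarrow> Tgt C (e b) = b \<otimes> w" "is_iso C (e b)"
  using assms by (auto simp: half_braiding_def Hom_def)

context
  fixes w e
  assumes hb: "half_braiding C w e" and w [simp]: "w \<in> Obj C"
begin

lemma hb_simps [simp]:
  assumes "b \<in> Obj C"
  shows "diag C (hb C w e b)" "dsrc (hb C w e b) = [w, b]" "dtgt (hb C w e b) = [b, w]"
    "diag C (hb_inv C w e b)" "dsrc (hb_inv C w e b) = [b, w]" "dtgt (hb_inv C w e b) = [w, b]"
  using assms half_braidingD[OF hb assms] by (simp_all add: hb_def hb_inv_def)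

lemma hb_inverse:
  assumes [simp]: "b \<in> Obj C"
  shows "hb_inv C w e b \<bullet> hb C w e b = did C [w, b]" "hb C w e b \<bullet> hb_inv C w e b = did C [b, w]"
proof -
  note [simp] = half_braidingD[OF hb assms] comp_extend[OF emb_inv_cancel(1)] comp_extend[OF emb_inv_cancel(2)]
  show "hb_inv C w e b \<bullet> hb C w e b = did C [w, b]" "hb C w e b \<bullet> hb_inv C w e b = did C [b, w]"
    by (simp_all add: hb_def hb_inv_def)
qed

lemma hb_natural:
  assumes f: "f \<in> Hom C b c"
  shows "hb C w e c \<bullet> [w] \<lhd> emb C f \<rhd> [] = [] \<lhd> emb C f \<rhd> [w] \<bullet> hb C w e b"
proof -
  note [simp] = Hom_obj[OF f] HomD[OF f] half_braidingD[OF hb Hom_obj(1)[OF f]] half_braidingD[OF hb Hom_obj(2)[OF f]]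
  have "e c \<cdot> (ide w \<odot> f) = (f \<odot> ide w) \<cdot> e b"
    using hb f by (simp add: half_braiding_def)
  from arg_cong[OF this, of "emb C"]
  have "emb C (e c) \<bullet> merge C w c \<bullet> [w] \<lhd> emb C f \<rhd> [] \<bullet> split C w b
      = merge C c w \<bullet> [] \<lhd> emb C f \<rhd> [w] \<bullet> split C b w \<bullet> emb C (e b)"
    by (simp add: emb_simps)
  from arg_cong[OF this, of "\<lambda>t. split C c w \<bullet> t \<bullet> merge C w b"]
  show ?thesis by (simp add: hb_def)
qed

lemma hb_merge:
  assumes [simp]: "b \<in> Obj C" "c \<in> Obj C"
  shows "hb C w e (b \<otimes> c) \<bullet> [w] \<lhd> merge C b c \<rhd> []
    = [] \<lhd> merge C b c \<rhd> [w] \<bullet> [b] \<lhd> hb C w e c \<rhd> [] \<bullet> [] \<lhd> hb C w e b \<rhd> [c]"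
proof -
  note [simp] = half_braidingD[OF hb assms(1)] half_braidingD[OF hb assms(2)] half_braidingD[OF hb, of "b \<otimes> c"]
  have "\<a> b c w \<cdot> e (b \<otimes> c) \<cdot> \<a> w b c = (ide b \<odot> e c) \<cdot> \<a> b w c \<cdot> (e b \<odot> ide c)"
    using hb by (simp add: half_braiding_def)
  from arg_cong[OF this, of "emb C"]
  have "merge C b (c \<otimes> w) \<bullet> [b] \<lhd> merge C c w \<rhd> [] \<bullet> [] \<lhd> split C b c \<rhd> [w] \<bullet> split C (b \<otimes> c) w
     \<bullet> emb C (e (b \<otimes> c)) \<bullet> merge C w (b \<otimes> c) \<bullet> [w] \<lhd> merge C b c \<rhd> [] \<bullet> [] \<lhd> split C w b \<rhd> [c] \<bullet> split C (w \<otimes> b) c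
     = merge C b (c \<otimes> w) \<bullet> [b] \<lhd> emb C (e c) \<rhd> [] \<bullet> [b] \<lhd> merge C w c \<rhd> [] \<bullet>
         [] \<lhd> split C b w \<rhd> [c] \<bullet> [] \<lhd> emb C (e b) \<rhd> [c] \<bullet> split C (w \<otimes> b) c"
    by (simp add: emb_simps)
  from arg_cong[OF this, of "\<lambda>t. [] \<lhd> merge C b c \<rhd> [w] \<bullet> [b] \<lhd> split C c w \<rhd> [] \<bullet> split C b (c \<otimes> w)
      \<bullet> t \<bullet> merge C (w \<otimes> b) c \<bullet> [] \<lhd> merge C w b \<rhd> [c]"]
  show ?thesis by (simp add: hb_def)
qed

text \<open>Triviality of the crossing with \<open>\<one>\<close> is not among the axioms.
  Naturality along \<open>\<l> \<one>\<close> and multiplicativity at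
  \<open>\<one> \<otimes> \<one>\<close> make this crossing idempotent up to unitors, and it is
  invertible.\<close>

lemma hb_create: "hb C w e \<one> \<bullet> [w] \<lhd> create C \<rhd> [] = [] \<lhd> create C \<rhd> [w]"
proof -
  let ?E = "hb C w e \<one>"
  \<comment> \<open>The crossing with the unit strands removed; the aim is that it is the identity
    of \<open>w\<close>.\<close>
  define X where "X = [] \<lhd> erase C \<rhd> [w] \<bullet> ?E \<bullet> [w] \<lhd> create C \<rhd> []"
  have [simp]: "diag C X" "dsrc X = [w]" "dtgt X = [w]"
    by (simp_all add: X_def)
  have "\<l> \<one> \<in> Hom C (\<one> \<otimes> \<one>) \<one>" by (rule lunit_hom) simp
  note n = hb_natural[OF this]
  have l: "emb C (\<l> \<one>) = [] \<lhd> erase C \<rhd> [\<one>] \<bullet> split C \<one> \<one>"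
    by (rule emb_lunit) simp
  have "?E \<bullet> [w] \<lhd> erase C \<rhd> [\<one>] = ?E \<bullet> [w] \<lhd> emb C (\<l> \<one>) \<rhd> [] \<bullet> [w] \<lhd> merge C \<one> \<one> \<rhd> []"
    by (simp add: l)
  also have "\<dots> = [] \<lhd> emb C (\<l> \<one>) \<rhd> [w] \<bullet> hb C w e (\<one> \<otimes> \<one>) \<bullet> [w] \<lhd> merge C \<one> \<one> \<rhd> []"
    unfolding comp_extend[OF n] by simp
  also have "\<dots> = [] \<lhd> erase C \<rhd> [\<one>, w] \<bullet> [\<one>] \<lhd> ?E \<rhd> [] \<bullet> [] \<lhd> ?E \<rhd> [\<one>]"
    by (simp add: hb_merge l)
  also have "\<dots> = ?E \<bullet> [] \<lhd> erase C \<rhd> [w, \<one>] \<bullet> [] \<lhd> ?E \<rhd> [\<one>]"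
  proof -
    have i: "[] \<lhd> erase C \<rhd> [\<one>, w] \<bullet> [\<one>] \<lhd> ?E \<rhd> [] = ?E \<bullet> [] \<lhd> erase C \<rhd> [w, \<one>]"
      using interchange[of "[]" "erase C" "[]" ?E "[]"] by simp
    show ?thesis by (simp add: comp_extend[OF i])
  qed
  finally have *: "hb_inv C w e \<one> \<bullet> ?E \<bullet> [w] \<lhd> erase C \<rhd> [\<one>]
      = hb_inv C w e \<one> \<bullet> ?E \<bullet> [] \<lhd> erase C \<rhd> [w, \<one>] \<bullet> [] \<lhd> ?E \<rhd> [\<one>]"
    by simp
  have "[w] \<lhd> erase C \<rhd> [\<one>] = [] \<lhd> erase C \<rhd> [w, \<one>] \<bullet> [] \<lhd> ?E \<rhd> [\<one>]"
    using * unfolding comp_extend[OF hb_inverse(1)[OF unit_obj]] by simp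
  from arg_cong[OF this, of "\<lambda>t. t \<bullet> [w] \<lhd> create C \<rhd> [\<one>]"]
  have "[] \<lhd> X \<rhd> [\<one>] = did C [w, \<one>]"
    by (simp add: X_def)
  from arg_cong[OF this, of "\<lambda>t. [w] \<lhd> erase C \<rhd> [] \<bullet> t \<bullet> [w] \<lhd> create C \<rhd> []"]
  have "[w] \<lhd> erase C \<rhd> [] \<bullet> [] \<lhd> X \<rhd> [\<one>] \<bullet> [w] \<lhd> create C \<rhd> [] = did C [w]"
    by simp
  moreover have "[] \<lhd> X \<rhd> [\<one>] \<bullet> [w] \<lhd> create C \<rhd> [] = [w] \<lhd> create C \<rhd> [] \<bullet> X"
    using interchange[of "[]" X "[]" "create C" "[]"] by simp
  ultimately have "X = did C [w]"
    by simp
  from arg_cong[OF this, of "\<lambda>t. [] \<lhd> create C \<rhd> [w] \<bullet> t"]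
  show ?thesis by (simp add: X_def)
qed

text \<open>A cup is an arrow out of the unit, so the strand \<open>w\<close> slides across it by
  naturality, multiplicativity and \<open>hb_create\<close>.\<close>

lemma hb_cup:
  assumes [simp]: "y \<in> Obj C" "z \<in> Obj C" and q: "q \<in> Hom C \<one> (y \<otimes> z)"
  shows "[y] \<lhd> hb C w e z \<rhd> [] \<bullet> [] \<lhd> hb C w e y \<rhd> [z] \<bullet> [w] \<lhd> cup C y z q \<rhd> []
    = [] \<lhd> cup C y z q \<rhd> [w]"
proof -
  note [simp] = emb_Hom[OF q]
  note n = hb_natural[OF q]
  have m: "[y] \<lhd> hb C w e z \<rhd> [] \<bullet> [] \<lhd> hb C w e y \<rhd> [z] \<bullet> [w] \<lhd> split C y z \<rhd> []
     = [] \<lhd> split C y z \<rhd> [w] \<bullet> hb C w e (y \<otimes> z)"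
    using arg_cong[OF hb_merge[of y z], of "\<lambda>t. [] \<lhd> split C y z \<rhd> [w] \<bullet> t \<bullet> [w] \<lhd> split C y z \<rhd> []"] by simp
  show ?thesis
    by (simp add: cup_def comp_extend3[OF m] comp_extend[OF n] hb_create)
qed

end

end

section \<open>Rotation and its inverse\<close>

context pivotal_category
begin

context
  fixes w e x y
  assumes hb: "half_braiding C w e" and [simp]: "w \<in> Obj C" "x \<in> Obj C" "y \<in> Obj C"
begin

lemma rotation_hom:
  assumes f: "f \<in> Hom C w (x \<otimes> y)"
  shows "rotation C w e x y f \<in> Hom C w (y \<otimes> x)"
  using HomD[OF f] half_braidingD[OF hb, of y] by (auto simp: rotation_def Let_def intro!: HomI)

lemma emb_rotation:
  assumes f: "f \<in> Hom C w (x \<otimes> y)"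
  shows "emb C (rotation C w e x y f) = merge C y x \<bullet> [y, x] \<lhd> evt_cap y \<rhd> [] \<bullet>
    [y] \<lhd> split C x y \<rhd> [Dual C y] \<bullet> [y] \<lhd> emb C f \<rhd> [Dual C y] \<bullet>
    [] \<lhd> hb C w e y \<rhd> [Dual C y] \<bullet> [w] \<lhd> coev_cup y \<rhd> []"
proof -
  \<comment> \<open>The definition brackets \<open>y \<otimes> x\<close> before it evaluates, so
    this \<open>merge\<close> has to move past all three constituents of the cap on its
    right.\<close>
  have i: "[y \<otimes> x] \<lhd> erase C \<rhd> [] \<bullet> [] \<lhd> merge C y x \<rhd> [\<one>] = merge C y x \<bullet> [y, x] \<lhd> erase C \<rhd> []"
    "[y \<otimes> x] \<lhd> emb C (ev_tilde C y) \<rhd> [] \<bullet> [] \<lhd> merge C y x \<rhd> [y \<otimes> Dual C y]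
      = [] \<lhd> merge C y x \<rhd> [\<one>] \<bullet> [y, x] \<lhd> emb C (ev_tilde C y) \<rhd> []"
    "[y \<otimes> x] \<lhd> merge C y (Dual C y) \<rhd> [] \<bullet> [] \<lhd> merge C y x \<rhd> [y, Dual C y]
      = [] \<lhd> merge C y x \<rhd> [y \<otimes> Dual C y] \<bullet> [y, x] \<lhd> merge C y (Dual C y) \<rhd> []"
    using interchange[of "[]" "merge C y x" "[]" "erase C" "[]"]
      interchange[of "[]" "merge C y x" "[]" "emb C (ev_tilde C y)" "[]"]
      interchange[of "[]" "merge C y x" "[]" "merge C y (Dual C y)" "[]"] by simp_all
  show ?thesis
    using HomD[OF f] half_braidingD[OF hb, of y]
    by (simp add: rotation_def Let_def emb_simps cap_def cup_def hb_def i[THEN comp_extend])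
qed

text \<open>Rotation in the opposite direction: a dual strand of \<open>y\<close> is created on the
  right of \<open>w\<close>, crosses it, and cancels the \<open>y\<close> in the target of
  \<open>h\<close>. By \<open>hb_cup\<close> the crossing with the dual replaces the inverse
  crossing with \<open>y\<close>, so no inverse half-braiding occurs in the formula.\<close>

definition rotation_inv where
  "rotation_inv h = ((\<l> x \<cdot> (Ev C y \<odot> ide x) \<cdot> (\<a> (Dual C y) y x)\<^sup>\<inverse> \<cdot> (ide (Dual C y) \<odot> h) \<cdot> e (Dual C y)) \<odot> ide y)
     \<cdot> (\<a> w (Dual C y) y)\<^sup>\<inverse> \<cdot> (ide w \<odot> coev_tilde y) \<cdot> (\<r> w)\<^sup>\<inverse>"

lemma rotation_inv_hom:
  assumes h: "h \<in> Hom C w (y \<otimes> x)"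
  shows "rotation_inv h \<in> Hom C w (x \<otimes> y)"
  using HomD[OF h] half_braidingD[OF hb, of "Dual C y"] by (auto simp: rotation_inv_def intro!: HomI)

lemma emb_rotation_inv:
  assumes h: "h \<in> Hom C w (y \<otimes> x)"
  shows "emb C (rotation_inv h) = merge C x y \<bullet> [] \<lhd> ev_cap y \<rhd> [x, y] \<bullet> [Dual C y] \<lhd> split C y x \<rhd> [y] \<bullet>
    [Dual C y] \<lhd> emb C h \<rhd> [y] \<bullet> [] \<lhd> hb C w e (Dual C y) \<rhd> [y] \<bullet> [w] \<lhd> coevt_cup y \<rhd> []"
  using HomD[OF h] half_braidingD[OF hb, of "Dual C y"]
  by (simp add: rotation_inv_def emb_simps cap_def cup_def hb_def)

text \<open>Three straightenings: \<open>ev_tilde\<close> against \<open>coev_tilde\<close>, the two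
  crossings against the cup by \<open>hb_cup\<close>, and finally \<open>ev\<close> against
  \<open>coev\<close> on the strand \<open>y\<close>.\<close>

lemma rotation_rotation_inv:
  assumes h: "h \<in> Hom C w (y \<otimes> x)"
  shows "rotation C w e x y (rotation_inv h) = h"
proof (rule emb_faithful_Hom)
  let ?y = "Dual C y" and ?E = "hb C w e y" and ?E' = "hb C w e (Dual C y)"
  let ?H = "split C y x \<bullet> emb C h"
  let ?A = "[] \<lhd> ev_cap y \<rhd> [x] \<bullet> [?y] \<lhd> ?H \<rhd> [] \<bullet> ?E'"
  note [simp] = HomD[OF h] hb_simps[OF hb]
  have i: "[y, x] \<lhd> evt_cap y \<rhd> [] \<bullet> [y] \<lhd> ?A \<rhd> [y, ?y] = [y] \<lhd> ?A \<rhd> [] \<bullet> [y, w, ?y] \<lhd> evt_cap y \<rhd> []"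
    using interchange[of "[y]" ?A "[]" "evt_cap y" "[]"] by simp
  have j: "[y, w] \<lhd> coevt_cup y \<rhd> [?y] \<bullet> [] \<lhd> ?E \<rhd> [?y] = [] \<lhd> ?E \<rhd> [?y, y, ?y] \<bullet> [w, y] \<lhd> coevt_cup y \<rhd> [?y]"
    using interchange[of "[]" ?E "[]" "coevt_cup y" "[?y]"] by simp
  have z: "[y, w, ?y] \<lhd> evt_cap y \<rhd> [] \<bullet> [y, w] \<lhd> coevt_cup y \<rhd> [?y] = did C [y, w, ?y]"
    using whisker_eq[OF zigzag_tilde_dual[of y], of "[y, w]" "[]"] by simp
  have c: "[y] \<lhd> ?E' \<rhd> [] \<bullet> [] \<lhd> ?E \<rhd> [?y] \<bullet> [w] \<lhd> coev_cup y \<rhd> [] = [] \<lhd> coev_cup y \<rhd> [w]"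
    by (rule hb_cup[OF hb]) (simp_all add: coev_hom)
  have k: "[y, ?y] \<lhd> ?H \<rhd> [] \<bullet> [] \<lhd> coev_cup y \<rhd> [w] = [] \<lhd> coev_cup y \<rhd> [y, x] \<bullet> ?H"
    using interchange[of "[]" "coev_cup y" "[]" ?H "[]"] by simp
  have z': "[y] \<lhd> ev_cap y \<rhd> [x] \<bullet> [] \<lhd> coev_cup y \<rhd> [y, x] = did C [y, x]"
    using whisker_eq[OF zigzag_obj_diagram[of y], of "[]" "[x]"] by simp
  have "emb C (rotation C w e x y (rotation_inv h)) = merge C y x \<bullet> ([y, x] \<lhd> evt_cap y \<rhd> [] \<bullet>
    [y] \<lhd> ?A \<rhd> [y, ?y]) \<bullet> [y, w] \<lhd> coevt_cup y \<rhd> [?y] \<bullet> [] \<lhd> ?E \<rhd> [?y] \<bullet> [w] \<lhd> coev_cup y \<rhd> []"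
    using emb_rotation[OF rotation_inv_hom[OF h]] emb_rotation_inv[OF h] by simp
  also have "\<dots> = merge C y x \<bullet> [y] \<lhd> ?A \<rhd> [] \<bullet> [] \<lhd> ?E \<rhd> [?y] \<bullet> [w] \<lhd> coev_cup y \<rhd> []"
    unfolding i by (simp add: comp_extend[OF z])
  also have "\<dots> = merge C y x \<bullet> [y] \<lhd> ev_cap y \<rhd> [x] \<bullet> [y, ?y] \<lhd> ?H \<rhd> [] \<bullet> [] \<lhd> coev_cup y \<rhd> [w]"
    by (simp add: c)
  also have "\<dots> = merge C y x \<bullet> ?H"
    unfolding k comp_extend[OF z'] by simp
  also have "\<dots> = emb C h"
    by simp
  finally show "emb C (rotation C w e x y (rotation_inv h)) = emb C h" .
qed (rule rotation_hom[OF rotation_inv_hom[OF h]], rule h)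

lemma rotation_inv_rotation:
  assumes f: "f \<in> Hom C w (x \<otimes> y)"
  shows "rotation_inv (rotation C w e x y f) = f"
proof (rule emb_faithful_Hom)
  let ?y = "Dual C y" and ?E = "hb C w e y" and ?E' = "hb C w e (Dual C y)"
  let ?I = "hb_inv C w e (Dual C y)"
  let ?F = "split C x y \<bullet> emb C f"
  let ?B = "[x] \<lhd> evt_cap y \<rhd> [] \<bullet> [] \<lhd> ?F \<rhd> [?y]"
  note [simp] = HomD[OF f] hb_simps[OF hb]
  have c: "[y] \<lhd> ?E' \<rhd> [] \<bullet> [] \<lhd> ?E \<rhd> [?y] \<bullet> [w] \<lhd> coev_cup y \<rhd> [] = [] \<lhd> coev_cup y \<rhd> [w]"
    by (rule hb_cup[OF hb]) (simp_all add: coev_hom)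
  have ii: "[y] \<lhd> ?I \<rhd> [] \<bullet> [y] \<lhd> ?E' \<rhd> [] = did C [y, w, ?y]"
    using whisker_eq[OF hb_inverse(1)[OF hb, of ?y], of "[y]" "[]"] by simp
  \<comment> \<open>\<open>hb_cup\<close> solved for the crossing with \<open>y\<close>: it becomes
    the inverse crossing with the dual, which will meet and cancel the crossing contained in
    \<open>rotation_inv\<close>.\<close>
  have c': "[] \<lhd> ?E \<rhd> [?y] \<bullet> [w] \<lhd> coev_cup y \<rhd> [] = [y] \<lhd> ?I \<rhd> [] \<bullet> [] \<lhd> coev_cup y \<rhd> [w]"
    using arg_cong[OF c, of "\<lambda>t. [y] \<lhd> ?I \<rhd> [] \<bullet> t"] by (simp add: comp_extend[OF ii])
  have r: "emb C (rotation C w e x y f) = merge C y x \<bullet> [y] \<lhd> ?B \<rhd> [] \<bullet> [y] \<lhd> ?I \<rhd> [] \<bullet> [] \<lhd> coev_cup y \<rhd> [w]"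
    using emb_rotation[OF f] by (simp add: c')
  have k: "[] \<lhd> ev_cap y \<rhd> [x, y] \<bullet> [?y, y] \<lhd> (?B \<bullet> ?I) \<rhd> [y] = [] \<lhd> (?B \<bullet> ?I) \<rhd> [y] \<bullet> [] \<lhd> ev_cap y \<rhd> [?y, w, y]"
    using interchange[of "[]" "ev_cap y" "[]" "?B \<bullet> ?I" "[y]"] by simp
  have z: "[] \<lhd> ev_cap y \<rhd> [?y, w, y] \<bullet> [?y] \<lhd> coev_cup y \<rhd> [w, y] = did C [?y, w, y]"
    using whisker_eq[OF zigzag_dual_diagram[of y], of "[]" "[w, y]"] by simp
  have ii': "[] \<lhd> ?I \<rhd> [y] \<bullet> [] \<lhd> ?E' \<rhd> [y] = did C [w, ?y, y]"
    using whisker_eq[OF hb_inverse(1)[OF hb, of ?y], of "[]" "[y]"] by simp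
  have j: "[] \<lhd> ?F \<rhd> [?y, y] \<bullet> [w] \<lhd> coevt_cup y \<rhd> [] = [x, y] \<lhd> coevt_cup y \<rhd> [] \<bullet> ?F"
    using interchange[of "[]" ?F "[]" "coevt_cup y" "[]"] by simp
  have z': "[x] \<lhd> evt_cap y \<rhd> [y] \<bullet> [x, y] \<lhd> coevt_cup y \<rhd> [] = did C [x, y]"
    using whisker_eq[OF zigzag_tilde_obj[of y], of "[x]" "[]"] by simp
  have "emb C (rotation_inv (rotation C w e x y f)) = merge C x y \<bullet>
     ([] \<lhd> ev_cap y \<rhd> [x, y] \<bullet> [?y, y] \<lhd> (?B \<bullet> ?I) \<rhd> [y]) \<bullet> [?y] \<lhd> coev_cup y \<rhd> [w, y]
     \<bullet> [] \<lhd> ?E' \<rhd> [y] \<bullet> [w] \<lhd> coevt_cup y \<rhd> []"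
    using emb_rotation_inv[OF rotation_hom[OF f]] r by simp
  also have "\<dots> = merge C x y \<bullet> [x] \<lhd> evt_cap y \<rhd> [y] \<bullet> [] \<lhd> ?F \<rhd> [?y, y] \<bullet> [w] \<lhd> coevt_cup y \<rhd> []"
    unfolding k by (simp add: comp_extend[OF z] comp_extend[OF ii'])
  also have "\<dots> = merge C x y \<bullet> ?F"
    unfolding j comp_extend[OF z'] by simp
  also have "\<dots> = emb C f"
    by simp
  finally show "emb C (rotation_inv (rotation C w e x y f)) = emb C f" .
qed (rule rotation_inv_hom[OF rotation_hom[OF f]], rule f)

end

end

section \<open>The twist of a half-braiding\<close>

context pivotal_category
begin

text \<open>The partial trace of the self-crossing of \<open>w\<close>. Unlike in
  \<open>twist\<close>, the pivotal arrow sits in the cap, so the crossing is that of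
  \<open>w\<close> with itself and not with its double dual.\<close>

definition twist_diagram where
  "twist_diagram w e = [w] \<lhd> evt_cap w \<rhd> [] \<bullet> [] \<lhd> hb C w e w \<rhd> [Dual C w] \<bullet> [w] \<lhd> coev_cup w \<rhd> []"

text \<open>Pull \<open>f\<close> once around the loop.\<close>

lemma twist_loop:
  assumes hb: "half_braiding C w e" and f: "f \<in> Hom C w y"
  shows "[y] \<lhd> evt_cap y \<rhd> [] \<bullet> [y] \<lhd> emb C f \<rhd> [Dual C y] \<bullet> [] \<lhd> hb C w e y \<rhd> [Dual C y]
      \<bullet> [w] \<lhd> coev_cup y \<rhd> [] = emb C f \<bullet> twist_diagram w e"
proof -
  note [simp] = Hom_obj[OF f] HomD[OF f] HomD[OF dual_arrow_hom[OF f]] hb_simps[OF hb]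
  let ?y = "Dual C y" and ?w = "Dual C w" and ?f = "emb C f" and ?g = "emb C (dual_arrow C f)"
  have 1: "[y] \<lhd> evt_cap y \<rhd> [] \<bullet> [y] \<lhd> ?f \<rhd> [?y] = [y] \<lhd> evt_cap w \<rhd> [] \<bullet> [y, w] \<lhd> ?g \<rhd> []"
    using whisker_eq[OF evt_dual_arrow[OF f], of "[y]" "[]"] by simp
  have 2: "[y, w] \<lhd> ?g \<rhd> [] \<bullet> [] \<lhd> hb C w e y \<rhd> [?y] = [] \<lhd> hb C w e y \<rhd> [?w] \<bullet> [w, y] \<lhd> ?g \<rhd> []"
    using interchange[of "[]" "hb C w e y" "[]" ?g "[]"] by simp
  have 3: "[w, y] \<lhd> ?g \<rhd> [] \<bullet> [w] \<lhd> coev_cup y \<rhd> [] = [w] \<lhd> ?f \<rhd> [?w] \<bullet> [w] \<lhd> coev_cup w \<rhd> []"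
    using whisker_eq[OF coev_dual_arrow[OF f], of "[w]" "[]"] by simp
  have 4: "[] \<lhd> hb C w e y \<rhd> [?w] \<bullet> [w] \<lhd> ?f \<rhd> [?w] = [] \<lhd> ?f \<rhd> [w, ?w] \<bullet> [] \<lhd> hb C w e w \<rhd> [?w]"
    using whisker_eq[OF hb_natural[OF hb _ f], of "[]" "[?w]"] by simp
  have 5: "[y] \<lhd> evt_cap w \<rhd> [] \<bullet> [] \<lhd> ?f \<rhd> [w, ?w] = ?f \<bullet> [w] \<lhd> evt_cap w \<rhd> []"
    using interchange[of "[]" ?f "[]" "evt_cap w" "[]"] by simp
  show ?thesis
    by (simp add: comp_extend[OF 1] comp_extend[OF 2] 3 comp_extend[OF 4] comp_extend[OF 5] twist_diagram_def)
qed

text \<open>With \<open>x = \<one>\<close> nothing but the loop of \<open>twist_loop\<close> is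
  left; the unit strand changes sides, which turns the left unitor into the right one.\<close>

lemma emb_rotation_unit:
  assumes hb: "half_braiding C w e" and f: "f \<in> Hom C w y"
  shows "emb C (rotation C w e \<one> y ((\<l> y)\<^sup>\<inverse> \<cdot> f)) = emb C ((\<r> y)\<^sup>\<inverse> \<cdot> f) \<bullet> twist_diagram w e"
proof -
  note [simp] = Hom_obj[OF f] HomD[OF f] hb_simps[OF hb]
  let ?y = "Dual C y" and ?f = "emb C f"
  have h: "(\<l> y)\<^sup>\<inverse> \<cdot> f \<in> Hom C w (\<one> \<otimes> y)"
    by (auto intro!: HomI)
  have i: "[y, \<one>] \<lhd> evt_cap y \<rhd> [] \<bullet> [y] \<lhd> create C \<rhd> [y, ?y] = [y] \<lhd> create C \<rhd> [] \<bullet> [y] \<lhd> evt_cap y \<rhd> []"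
    using interchange[of "[y]" "create C" "[]" "evt_cap y" "[]"] by simp
  have "emb C (rotation C w e \<one> y ((\<l> y)\<^sup>\<inverse> \<cdot> f)) = merge C y \<one> \<bullet> [y] \<lhd> create C \<rhd> [] \<bullet>
     ([y] \<lhd> evt_cap y \<rhd> [] \<bullet> [y] \<lhd> emb C f \<rhd> [Dual C y] \<bullet> [] \<lhd> hb C w e y \<rhd> [Dual C y]
      \<bullet> [w] \<lhd> coev_cup y \<rhd> [])"
    by (simp add: emb_rotation[OF hb _ _ _ h] emb_simps comp_extend[OF i])
  then show ?thesis
    unfolding twist_loop[OF assms] by (simp add: emb_simps)
qed

text \<open>Rotation with \<open>x = 1\<close> is precomposition with the twist, so its bijectivity makes the twist invertible.\<close>

lemma twist_iso:
  assumes hb: "half_braiding C w e" and t: "t \<in> Hom C w w" and e: "emb C t = twist_diagram w e"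
  shows "is_iso C t"
proof -
  note [simp] = Hom_obj(1)[OF t] HomD[OF t]
  have r: "rotation C w e \<one> w ((\<l> w)\<^sup>\<inverse> \<cdot> f) = (\<r> w)\<^sup>\<inverse> \<cdot> f \<cdot> t" if f: "f \<in> Hom C w w" for f
  proof (rule emb_faithful)
    note [simp] = HomD[OF f]
    have h: "(\<l> w)\<^sup>\<inverse> \<cdot> f \<in> Hom C w (\<one> \<otimes> w)"
      by (auto intro!: HomI)
    show "emb C (rotation C w e \<one> w ((\<l> w)\<^sup>\<inverse> \<cdot> f)) = emb C ((\<r> w)\<^sup>\<inverse> \<cdot> f \<cdot> t)"
      unfolding emb_rotation_unit[OF hb f] e[symmetric] by (simp add: emb_comp)
    show "rotation C w e \<one> w ((\<l> w)\<^sup>\<inverse> \<cdot> f) \<in> Arr C"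
      using HomD[OF rotation_hom[OF hb _ _ _ h]] by simp
    show "(\<r> w)\<^sup>\<inverse> \<cdot> f \<cdot> t \<in> Arr C"
      by simp
  qed
  \<comment> \<open>Surjectivity of rotation: the arrow whose rotation is the inverse right unitor
    yields a left inverse of \<open>t\<close>.\<close>
  let ?h = "rotation_inv w e \<one> w ((\<r> w)\<^sup>\<inverse>)"
  have s: "(\<r> w)\<^sup>\<inverse> \<in> Hom C w (w \<otimes> \<one>)"
    by (auto intro!: HomI)
  have h: "?h \<in> Hom C w (\<one> \<otimes> w)"
    by (rule rotation_inv_hom[OF hb _ _ _ s]) simp_all
  note [simp] = HomD[OF h]
  let ?g = "\<l> w \<cdot> ?h"
  have g: "?g \<in> Hom C w w"
    by (auto intro!: HomI)
  note [simp] = HomD[OF g]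
  have "(\<r> w)\<^sup>\<inverse> \<cdot> (?g \<cdot> t) = (\<r> w)\<^sup>\<inverse>"
    using r[OF g] rotation_rotation_inv[OF hb _ _ _ s] by simp
  from arg_cong[OF this, of "\<lambda>k. \<r> w \<cdot> k"] have gt: "?g \<cdot> t = ide w"
    by simp
  have tg: "t \<cdot> ?g \<in> Hom C w w"
    by (auto intro!: HomI)
  have h1: "(\<l> w)\<^sup>\<inverse> \<cdot> (t \<cdot> ?g) \<in> Hom C w (\<one> \<otimes> w)" and h2: "(\<l> w)\<^sup>\<inverse> \<cdot> ide w \<in> Hom C w (\<one> \<otimes> w)"
    by (auto intro!: HomI)
  \<comment> \<open>Injectivity of rotation: \<open>t \<cdot> ?g\<close> and the identity agree
    after precomposition with \<open>t\<close>, hence have equal rotations.\<close>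
  have "(t \<cdot> ?g) \<cdot> t = ide w \<cdot> t"
    using gt by simp
  then have "rotation C w e \<one> w ((\<l> w)\<^sup>\<inverse> \<cdot> (t \<cdot> ?g)) = rotation C w e \<one> w ((\<l> w)\<^sup>\<inverse> \<cdot> ide w)"
    unfolding r[OF tg] r[OF ide_hom[OF Hom_obj(1)[OF t]]] by simp
  then have "(\<l> w)\<^sup>\<inverse> \<cdot> (t \<cdot> ?g) = (\<l> w)\<^sup>\<inverse> \<cdot> ide w"
    using rotation_inv_rotation[OF hb _ _ _ h1] rotation_inv_rotation[OF hb _ _ _ h2] by simp
  from arg_cong[OF this, of "\<lambda>k. \<l> w \<cdot> k"] have "t \<cdot> ?g = ide w"
    by simp
  then show ?thesis
    using is_isoI[OF t g gt] by simp
qed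

end

section \<open>Diagrams and monoidal functors\<close>

locale monoidal_functor = C: monoidal_category C + D: monoidal_category D + tensor_functor C D F
  for C :: "('o, 'm, 'y) moncat_scheme" and D :: "('p, 'n, 'z) moncat_scheme" (structure)
    and F :: "('o, 'm, 'p, 'n, 'w) tfun_scheme"
begin

lemma omap_obj [simp]: "a \<in> Obj C \<Longrightarrow> OMap F a \<in> Obj D"
  by (rule omap)

lemma amap_arr [simp]:
  assumes "f \<in> Arr C"
  shows "AMap F f \<in> Arr D" "Src D (AMap F f) = OMap F (Src C f)" "Tgt D (AMap F f) = OMap F (Tgt C f)"
  using amap[of f "Src C f" "Tgt C f"] assms by (auto simp: Hom_def)

lemma amap_comp:
  "\<lbrakk>f \<in> Arr C; g \<in> Arr C; Src C g = Tgt C f\<rbrakk> \<Longrightarrow> AMap F (g \<cdot>\<^bsub>C\<^esub> f) = AMap F g \<cdot> AMap F f"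
  by (rule map_comp) (auto simp: Hom_def)

lemma amap_inverse:
  assumes "is_iso C f"
  shows "is_iso D (AMap F f)" "AMap F (f\<^sup>\<inverse>\<^bsub>C\<^esub>) = (AMap F f)\<^sup>\<inverse>"
proof -
  have f: "f \<in> Arr C" by (rule C.iso_arr[OF assms])
  have *: "inverse_arrows D (AMap F f) (AMap F (f\<^sup>\<inverse>\<^bsub>C\<^esub>))"
    by (rule D.inverse_arrowsI[where a = "OMap F (Src C f)" and b = "OMap F (Tgt C f)"])
      (auto simp: f assms map_ide intro!: D.HomI simp flip: amap_comp)
  then show "is_iso D (AMap F f)" "AMap F (f\<^sup>\<inverse>\<^bsub>C\<^esub>) = (AMap F f)\<^sup>\<inverse>"
    by (auto simp: is_iso_def dest: D.inv_arrow_eq)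
qed

lemma ten_arr [simp]:
  assumes "a \<in> Obj C" "b \<in> Obj C"
  shows "Ten F a b \<in> Arr D" "Src D (Ten F a b) = OMap F a \<otimes> OMap F b"
    "Tgt D (Ten F a b) = OMap F (a \<otimes>\<^bsub>C\<^esub> b)" "is_iso D (Ten F a b)"
  using ten_hom[OF assms] ten_iso[OF assms] by (auto simp: Hom_def)

lemma uni_arr [simp]:
  "Uni F \<in> Arr D" "Src D (Uni F) = \<one>" "Tgt D (Uni F) = OMap F \<one>\<^bsub>C\<^esub>" "is_iso D (Uni F)"
  using uni_hom uni_iso by (auto simp: Hom_def)

definition femb where "femb f = emb D (AMap F f)"
text \<open>The structure isomorphisms of \<open>F\<close> are absorbed into the bracketing boxes.
  Images of coherence arrows then have the same shape as in \<open>emb_simps\<close>, and a diagram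
  in \<open>C\<close> is carried to the same diagram in \<open>D\<close>.\<close>

definition fmerge where "fmerge a b = emb D (Ten F a b) \<bullet> merge D (OMap F a) (OMap F b)"
definition fsplit where "fsplit a b = split D (OMap F a) (OMap F b) \<bullet> emb D ((Ten F a b)\<^sup>\<inverse>)"
definition fcreate where "fcreate = emb D (Uni F) \<bullet> create D"
definition ferase where "ferase = erase D \<bullet> emb D ((Uni F)\<^sup>\<inverse>)"

lemma femb_diag [simp]:
  "f \<in> Arr C \<Longrightarrow> diag D (femb f)" "f \<in> Arr C \<Longrightarrow> dsrc (femb f) = [OMap F (Src C f)]"
  "f \<in> Arr C \<Longrightarrow> dtgt (femb f) = [OMap F (Tgt C f)]"
  by (simp_all add: femb_def)

lemma fmerge_diag [simp]:
  assumes "a \<in> Obj C" "b \<in> Obj C"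
  shows "diag D (fmerge a b)" "dsrc (fmerge a b) = [OMap F a, OMap F b]" "dtgt (fmerge a b) = [OMap F (a \<otimes>\<^bsub>C\<^esub> b)]"
    "diag D (fsplit a b)" "dtgt (fsplit a b) = [OMap F a, OMap F b]" "dsrc (fsplit a b) = [OMap F (a \<otimes>\<^bsub>C\<^esub> b)]"
  using assms by (simp_all add: fmerge_def fsplit_def)

lemma fcreate_diag [simp]:
  "diag D fcreate" "dsrc fcreate = []" "dtgt fcreate = [OMap F \<one>\<^bsub>C\<^esub>]"
  "diag D ferase" "dsrc ferase = [OMap F \<one>\<^bsub>C\<^esub>]" "dtgt ferase = []"
  by (simp_all add: fcreate_def ferase_def)

lemma fcoherence_cancel [simp]:
  "\<lbrakk>a \<in> Obj C; b \<in> Obj C\<rbrakk> \<Longrightarrow> fsplit a b \<bullet> fmerge a b = did D [OMap F a, OMap F b]"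
  "\<lbrakk>a \<in> Obj C; b \<in> Obj C\<rbrakk> \<Longrightarrow> fmerge a b \<bullet> fsplit a b = did D [OMap F (a \<otimes>\<^bsub>C\<^esub> b)]"
  "ferase \<bullet> fcreate = did D []" "fcreate \<bullet> ferase = did D [OMap F \<one>\<^bsub>C\<^esub>]"
proof -
  note [simp] = D.emb_inv_cancel D.comp_extend[OF D.emb_inv_cancel(1)] D.comp_extend[OF D.emb_inv_cancel(2)]
  show "\<lbrakk>a \<in> Obj C; b \<in> Obj C\<rbrakk> \<Longrightarrow> fsplit a b \<bullet> fmerge a b = did D [OMap F a, OMap F b]"
    "\<lbrakk>a \<in> Obj C; b \<in> Obj C\<rbrakk> \<Longrightarrow> fmerge a b \<bullet> fsplit a b = did D [OMap F (a \<otimes>\<^bsub>C\<^esub> b)]"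
    "ferase \<bullet> fcreate = did D []" "fcreate \<bullet> ferase = did D [OMap F \<one>\<^bsub>C\<^esub>]"
    by (simp_all add: fsplit_def fmerge_def fcreate_def ferase_def)
qed

lemma fcoherence_cancel_whisker [simp]:
  assumes [simp]: "set xs \<subseteq> Obj D" "set ys \<subseteq> Obj D"
  shows "\<lbrakk>a \<in> Obj C; b \<in> Obj C\<rbrakk>
      \<Longrightarrow> xs \<lhd> fsplit a b \<rhd> ys \<bullet> xs \<lhd> fmerge a b \<rhd> ys = did D (xs @ [OMap F a, OMap F b] @ ys)"
    "\<lbrakk>a \<in> Obj C; b \<in> Obj C\<rbrakk>
      \<Longrightarrow> xs \<lhd> fmerge a b \<rhd> ys \<bullet> xs \<lhd> fsplit a b \<rhd> ys = did D (xs @ [OMap F (a \<otimes>\<^bsub>C\<^esub> b)] @ ys)"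
    "xs \<lhd> ferase \<rhd> ys \<bullet> xs \<lhd> fcreate \<rhd> ys = did D (xs @ ys)"
    "xs \<lhd> fcreate \<rhd> ys \<bullet> xs \<lhd> ferase \<rhd> ys = did D (xs @ [OMap F \<one>\<^bsub>C\<^esub>] @ ys)"
  by (simp_all flip: D.whisker_comp)

lemma fcoherence_cancel_comp [simp]:
  assumes t: "diag D t"
  shows "\<lbrakk>a \<in> Obj C; b \<in> Obj C; dtgt t = [OMap F a, OMap F b]\<rbrakk> \<Longrightarrow> fsplit a b \<bullet> fmerge a b \<bullet> t = t"
    "\<lbrakk>a \<in> Obj C; b \<in> Obj C; dtgt t = [OMap F (a \<otimes>\<^bsub>C\<^esub> b)]\<rbrakk> \<Longrightarrow> fmerge a b \<bullet> fsplit a b \<bullet> t = t"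
    "dtgt t = [] \<Longrightarrow> ferase \<bullet> fcreate \<bullet> t = t"
    "dtgt t = [OMap F \<one>\<^bsub>C\<^esub>] \<Longrightarrow> fcreate \<bullet> ferase \<bullet> t = t"
  by (rule D.dcomp_cancel[OF _ t]; simp)+

lemma fcoherence_cancel_whisker_comp [simp]:
  assumes [simp]: "set xs \<subseteq> Obj D" "set ys \<subseteq> Obj D" and t: "diag D t"
  shows "\<lbrakk>a \<in> Obj C; b \<in> Obj C; dtgt t = xs @ [OMap F a, OMap F b] @ ys\<rbrakk>
      \<Longrightarrow> xs \<lhd> fsplit a b \<rhd> ys \<bullet> xs \<lhd> fmerge a b \<rhd> ys \<bullet> t = t"
    "\<lbrakk>a \<in> Obj C; b \<in> Obj C; dtgt t = xs @ [OMap F (a \<otimes>\<^bsub>C\<^esub> b)] @ ys\<rbrakk>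
      \<Longrightarrow> xs \<lhd> fmerge a b \<rhd> ys \<bullet> xs \<lhd> fsplit a b \<rhd> ys \<bullet> t = t"
    "dtgt t = xs @ ys \<Longrightarrow> xs \<lhd> ferase \<rhd> ys \<bullet> xs \<lhd> fcreate \<rhd> ys \<bullet> t = t"
    "dtgt t = xs @ [OMap F \<one>\<^bsub>C\<^esub>] @ ys \<Longrightarrow> xs \<lhd> fcreate \<rhd> ys \<bullet> xs \<lhd> ferase \<rhd> ys \<bullet> t = t"
  by (rule D.dcomp_cancel[OF _ t]; simp)+

lemma femb_ide: "a \<in> Obj C \<Longrightarrow> femb (ide\<^bsub>C\<^esub> a) = did D [OMap F a]"
  by (simp add: femb_def map_ide D.emb_ide)

lemma femb_comp:
  "\<lbrakk>f \<in> Arr C; g \<in> Arr C; Src C g = Tgt C f\<rbrakk> \<Longrightarrow> femb (g \<cdot>\<^bsub>C\<^esub> f) = femb g \<bullet> femb f"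
  by (simp add: femb_def amap_comp D.emb_comp)

lemma femb_tensor:
  assumes [simp]: "f \<in> Arr C" "g \<in> Arr C"
  shows "femb (f \<odot>\<^bsub>C\<^esub> g) = fmerge (Tgt C f) (Tgt C g) \<bullet> [] \<lhd> femb f \<rhd> [OMap F (Tgt C g)]
    \<bullet> [OMap F (Src C f)] \<lhd> femb g \<rhd> [] \<bullet> fsplit (Src C f) (Src C g)"
proof -
  note [simp] = D.emb_inv_cancel
  have "Ten F (Tgt C f) (Tgt C g) \<cdot> (AMap F f \<odot> AMap F g) = AMap F (f \<odot>\<^bsub>C\<^esub> g) \<cdot> Ten F (Src C f) (Src C g)"
    by (rule ten_natural) (auto simp: Hom_def)
  from arg_cong[OF this, of "emb D"]
  have "emb D (AMap F (f \<odot>\<^bsub>C\<^esub> g)) \<bullet> emb D (Ten F (Src C f) (Src C g)) =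
    emb D (Ten F (Tgt C f) (Tgt C g)) \<bullet> merge D (OMap F (Tgt C f)) (OMap F (Tgt C g)) \<bullet>
    [] \<lhd> emb D (AMap F f) \<rhd> [OMap F (Tgt C g)] \<bullet> [OMap F (Src C f)] \<lhd> emb D (AMap F g) \<rhd> []
    \<bullet> split D (OMap F (Src C f)) (OMap F (Src C g))"
    by (simp add: D.emb_comp D.emb_tensor)
  from arg_cong[OF this, of "\<lambda>t. t \<bullet> emb D ((Ten F (Src C f) (Src C g))\<^sup>\<inverse>)"]
  show ?thesis by (simp add: femb_def fmerge_def fsplit_def)
qed

text \<open>The associativity axiom of \<open>F\<close>, solved for the image of the associator by
  composing with the inverse bracketing boxes.\<close>

lemma femb_assoc:
  assumes [simp]: "a \<in> Obj C" "b \<in> Obj C" "c \<in> Obj C"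
  shows "femb (\<a>\<^bsub>C\<^esub> a b c) = fmerge a (b \<otimes>\<^bsub>C\<^esub> c) \<bullet> [OMap F a] \<lhd> fmerge b c \<rhd> []
    \<bullet> [] \<lhd> fsplit a b \<rhd> [OMap F c] \<bullet> fsplit (a \<otimes>\<^bsub>C\<^esub> b) c"
proof -
  from arg_cong[OF ten_assoc[OF assms], of "emb D"]
  have "femb (\<a>\<^bsub>C\<^esub> a b c) \<bullet> fmerge (a \<otimes>\<^bsub>C\<^esub> b) c \<bullet> [] \<lhd> emb D (Ten F a b) \<rhd> [OMap F c]
      \<bullet> split D (OMap F a \<otimes> OMap F b) (OMap F c)
     = fmerge a (b \<otimes>\<^bsub>C\<^esub> c) \<bullet> [OMap F a] \<lhd> fmerge b c \<rhd> [] \<bullet>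
         [] \<lhd> split D (OMap F a) (OMap F b) \<rhd> [OMap F c] \<bullet> split D (OMap F a \<otimes> OMap F b) (OMap F c)"
    by (simp add: D.emb_simps femb_def fmerge_def)
  from arg_cong[OF this, of "\<lambda>t. t \<bullet> merge D (OMap F a \<otimes> OMap F b) (OMap F c) \<bullet> [] \<lhd> merge D (OMap F a) (OMap F b) \<rhd> [OMap F c]
     \<bullet> [] \<lhd> fsplit a b \<rhd> [OMap F c] \<bullet> fsplit (a \<otimes>\<^bsub>C\<^esub> b) c"]
  have "femb (\<a>\<^bsub>C\<^esub> a b c) \<bullet> fmerge (a \<otimes>\<^bsub>C\<^esub> b) c \<bullet> [] \<lhd> fmerge a b \<rhd> [OMap F c]
      \<bullet> [] \<lhd> fsplit a b \<rhd> [OMap F c] \<bullet> fsplit (a \<otimes>\<^bsub>C\<^esub> b) c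
     = fmerge a (b \<otimes>\<^bsub>C\<^esub> c) \<bullet> [OMap F a] \<lhd> fmerge b c \<rhd> [] \<bullet> [] \<lhd> fsplit a b \<rhd> [OMap F c] \<bullet> fsplit (a \<otimes>\<^bsub>C\<^esub> b) c"
    by (simp add: fmerge_def)
  then show ?thesis by simp
qed

lemma femb_lunit:
  assumes [simp]: "a \<in> Obj C"
  shows "femb (\<l>\<^bsub>C\<^esub> a) = [] \<lhd> ferase \<rhd> [OMap F a] \<bullet> fsplit \<one>\<^bsub>C\<^esub> a"
proof -
  from arg_cong[OF ten_lunit[OF assms], of "emb D"]
  have "femb (\<l>\<^bsub>C\<^esub> a) \<bullet> fmerge \<one>\<^bsub>C\<^esub> a \<bullet> [] \<lhd> emb D (Uni F) \<rhd> [OMap F a] \<bullet> split D \<one> (OMap F a)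
     = [] \<lhd> erase D \<rhd> [OMap F a] \<bullet> split D \<one> (OMap F a)"
    by (simp add: D.emb_simps femb_def fmerge_def)
  from arg_cong[OF this, of "\<lambda>t. t \<bullet> merge D \<one> (OMap F a) \<bullet> [] \<lhd> create D \<rhd> [OMap F a]
     \<bullet> [] \<lhd> ferase \<rhd> [OMap F a] \<bullet> fsplit \<one>\<^bsub>C\<^esub> a"]
  have "femb (\<l>\<^bsub>C\<^esub> a) \<bullet> fmerge \<one>\<^bsub>C\<^esub> a \<bullet> [] \<lhd> fcreate \<rhd> [OMap F a] \<bullet> [] \<lhd> ferase \<rhd> [OMap F a] \<bullet> fsplit \<one>\<^bsub>C\<^esub> a
     = [] \<lhd> ferase \<rhd> [OMap F a] \<bullet> fsplit \<one>\<^bsub>C\<^esub> a"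
    by (simp add: fcreate_def)
  then show ?thesis by simp
qed

lemma femb_runit:
  assumes [simp]: "a \<in> Obj C"
  shows "femb (\<r>\<^bsub>C\<^esub> a) = [OMap F a] \<lhd> ferase \<rhd> [] \<bullet> fsplit a \<one>\<^bsub>C\<^esub>"
proof -
  from arg_cong[OF ten_runit[OF assms], of "emb D"]
  have "femb (\<r>\<^bsub>C\<^esub> a) \<bullet> fmerge a \<one>\<^bsub>C\<^esub> \<bullet> [OMap F a] \<lhd> emb D (Uni F) \<rhd> [] \<bullet> split D (OMap F a) \<one>
     = [OMap F a] \<lhd> erase D \<rhd> [] \<bullet> split D (OMap F a) \<one>"
    by (simp add: D.emb_simps femb_def fmerge_def)
  from arg_cong[OF this, of "\<lambda>t. t \<bullet> merge D (OMap F a) \<one> \<bullet> [OMap F a] \<lhd> create D \<rhd> []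
     \<bullet> [OMap F a] \<lhd> ferase \<rhd> [] \<bullet> fsplit a \<one>\<^bsub>C\<^esub>"]
  have "femb (\<r>\<^bsub>C\<^esub> a) \<bullet> fmerge a \<one>\<^bsub>C\<^esub> \<bullet> [OMap F a] \<lhd> fcreate \<rhd> [] \<bullet> [OMap F a] \<lhd> ferase \<rhd> [] \<bullet> fsplit a \<one>\<^bsub>C\<^esub>
     = [OMap F a] \<lhd> ferase \<rhd> [] \<bullet> fsplit a \<one>\<^bsub>C\<^esub>"
    by (simp add: fcreate_def)
  then show ?thesis by simp
qed

lemma femb_inv_eq:
  assumes f: "is_iso C f" and "femb f \<bullet> h = did D [OMap F (Tgt C f)]" "diag D h" "dtgt h = [OMap F (Src C f)]"
  shows "femb (f\<^sup>\<inverse>\<^bsub>C\<^esub>) = h"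
  using assms C.iso_arr[OF f] unfolding femb_def amap_inverse(2)[OF f]
  by (intro D.emb_inv_eq) (auto simp: amap_inverse)

lemma femb_inv_assoc:
  assumes [simp]: "a \<in> Obj C" "b \<in> Obj C" "c \<in> Obj C"
  shows "femb ((\<a>\<^bsub>C\<^esub> a b c)\<^sup>\<inverse>\<^bsub>C\<^esub>) = fmerge (a \<otimes>\<^bsub>C\<^esub> b) c \<bullet> [] \<lhd> fmerge a b \<rhd> [OMap F c]
    \<bullet> [OMap F a] \<lhd> fsplit b c \<rhd> [] \<bullet> fsplit a (b \<otimes>\<^bsub>C\<^esub> c)"
  by (rule femb_inv_eq) (simp_all add: femb_assoc)

lemma femb_inv_lunit: "a \<in> Obj C \<Longrightarrow> femb ((\<l>\<^bsub>C\<^esub> a)\<^sup>\<inverse>\<^bsub>C\<^esub>) = fmerge \<one>\<^bsub>C\<^esub> a \<bullet> [] \<lhd> fcreate \<rhd> [OMap F a]"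
  by (rule femb_inv_eq) (simp_all add: femb_lunit)

lemma femb_inv_runit: "a \<in> Obj C \<Longrightarrow> femb ((\<r>\<^bsub>C\<^esub> a)\<^sup>\<inverse>\<^bsub>C\<^esub>) = fmerge a \<one>\<^bsub>C\<^esub> \<bullet> [OMap F a] \<lhd> fcreate \<rhd> []"
  by (rule femb_inv_eq) (simp_all add: femb_runit)

lemmas femb_simps = femb_ide femb_comp femb_tensor femb_assoc femb_lunit femb_runit
  femb_inv_assoc femb_inv_lunit femb_inv_runit

definition fcap where "fcap u v p = ferase \<bullet> femb p \<bullet> fmerge u v"
definition fcup where "fcup u v q = fsplit u v \<bullet> femb q \<bullet> fcreate"

lemma fcap_eq:
  assumes "u \<in> Obj C" "v \<in> Obj C" and p: "p \<in> Hom C (u \<otimes>\<^bsub>C\<^esub> v) \<one>\<^bsub>C\<^esub>"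
  shows "fcap u v p = cap D (OMap F u) (OMap F v) ((Uni F)\<^sup>\<inverse> \<cdot> AMap F p \<cdot> Ten F u v)"
    and "(Uni F)\<^sup>\<inverse> \<cdot> AMap F p \<cdot> Ten F u v \<in> Hom D (OMap F u \<otimes> OMap F v) \<one>"
  using assms C.HomD[OF p]
  by (auto simp: fcap_def cap_def ferase_def fmerge_def femb_def D.emb_comp intro!: D.HomI)

lemma fcup_eq:
  assumes "u \<in> Obj C" "v \<in> Obj C" and q: "q \<in> Hom C \<one>\<^bsub>C\<^esub> (u \<otimes>\<^bsub>C\<^esub> v)"
  shows "fcup u v q = cup D (OMap F u) (OMap F v) ((Ten F u v)\<^sup>\<inverse> \<cdot> AMap F q \<cdot> Uni F)"
    and "(Ten F u v)\<^sup>\<inverse> \<cdot> AMap F q \<cdot> Uni F \<in> Hom D \<one> (OMap F u \<otimes> OMap F v)"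
  using assms C.HomD[OF q]
  by (auto simp: fcup_def cup_def fcreate_def fsplit_def femb_def D.emb_comp intro!: D.HomI)

end

section \<open>Duals and twists under pivotal functors\<close>

locale rigid_functor = monoidal_functor C D F + C: rigid_category C + D: rigid_category D
  for C :: "('o, 'm, 'y) pivcat_scheme" and D :: "('p, 'n, 'z) pivcat_scheme" (structure)
    and F :: "('o, 'm, 'p, 'n, 'w) tfun_scheme"
begin

abbreviation (input) fev where "fev a \<equiv> fcap (Dual C a) a (Ev C a)"
abbreviation (input) fcoev where "fcoev a \<equiv> fcup a (Dual C a) (Coev C a)"

text \<open>The images of \<open>ev\<close> and \<open>coev\<close> satisfy the zig-zag equations,
  so \<open>F\<close> carries the dual of \<open>a\<close> to a dual of \<open>OMap F a\<close>, and
  uniqueness of duals applies to \<open>dual_comparison\<close>.\<close>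

lemma fzigzag:
  assumes [simp]: "a \<in> Obj C"
  shows "[OMap F a] \<lhd> fev a \<rhd> [] \<bullet> [] \<lhd> fcoev a \<rhd> [OMap F a] = did D [OMap F a]"
    and "[] \<lhd> fev a \<rhd> [OMap F (Dual C a)] \<bullet> [OMap F (Dual C a)] \<lhd> fcoev a \<rhd> [] = did D [OMap F (Dual C a)]"
  using arg_cong[OF C.zigzag_obj[OF assms], of femb] arg_cong[OF C.zigzag_dual[OF assms], of femb]
  by (simp_all add: femb_simps fcap_def fcup_def)

lemma fev_eq:
  assumes "a \<in> Obj C"
  shows "fev a = cap D (OMap F (Dual C a)) (OMap F a) ((Uni F)\<^sup>\<inverse> \<cdot> AMap F (Ev C a) \<cdot> Ten F (Dual C a) a)"
    and "(Uni F)\<^sup>\<inverse> \<cdot> AMap F (Ev C a) \<cdot> Ten F (Dual C a) a \<in> Hom D (OMap F (Dual C a) \<otimes> OMap F a) \<one>"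
  by (rule fcap_eq; use assms C.ev_hom in simp)+

lemma fcoev_eq:
  assumes "a \<in> Obj C"
  shows "fcoev a = cup D (OMap F a) (OMap F (Dual C a)) ((Ten F a (Dual C a))\<^sup>\<inverse> \<cdot> AMap F (Coev C a) \<cdot> Uni F)"
    and "(Ten F a (Dual C a))\<^sup>\<inverse> \<cdot> AMap F (Coev C a) \<cdot> Uni F \<in> Hom D \<one> (OMap F a \<otimes> OMap F (Dual C a))"
  by (rule fcup_eq; use assms C.coev_hom in simp)+

lemma fev_diag [simp]:
  assumes "a \<in> Obj C"
  shows "diag D (fev a)" "dsrc (fev a) = [OMap F (Dual C a), OMap F a]" "dtgt (fev a) = []"
    "diag D (fcoev a)" "dsrc (fcoev a) = []" "dtgt (fcoev a) = [OMap F a, OMap F (Dual C a)]"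
  using assms by (simp_all add: fcap_def fcup_def)

lemma dual_comparison_hom:
  "a \<in> Obj C \<Longrightarrow> dual_comparison C D F a \<in> Hom D (OMap F (Dual C a)) (Dual D (OMap F a))"
  unfolding dual_comparison_def by (rule D.curry_hom) (auto intro: fev_eq)

lemma ev_dual_comparison:
  assumes "a \<in> Obj C"
  shows "D.ev_cap (OMap F a) \<bullet> [] \<lhd> emb D (dual_comparison C D F a) \<rhd> [OMap F a] = fev a"
  unfolding dual_comparison_def fev_eq(1)[OF assms] by (rule D.ev_curry) (auto simp: assms intro: fev_eq)

lemma coev_dual_comparison:
  assumes "a \<in> Obj C"
  shows "[OMap F a] \<lhd> emb D (dual_comparison C D F a) \<rhd> [] \<bullet> fcoev a = D.coev_cup (OMap F a)"
  unfolding dual_comparison_def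
  by (rule D.curry_coev) (use assms fzigzag(1)[OF assms] in \<open>auto simp: fev_eq(1)[symmetric] intro: fev_eq(2)\<close>)

lemma dual_comparison_iso:
  assumes "a \<in> Obj C"
  shows "is_iso D (dual_comparison C D F a)"
  unfolding dual_comparison_def
  by (rule D.curry_iso[OF _ _ _ fcoev_eq(2)[OF assms]])
     (use assms fzigzag[OF assms] in \<open>auto simp: fev_eq(1)[symmetric] fcoev_eq(1)[symmetric] intro: fev_eq(2)\<close>)

end

locale pivotal_functor_diagrams =
  rigid_functor C D F + C: pivotal_category C + D: pivotal_category D + pivotal_functor C D F
  for C :: "('o, 'm, 'y) pivcat_scheme" and D :: "('p, 'n, 'z) pivcat_scheme" (structure)
    and F :: "('o, 'm, 'p, 'n, 'w) tfun_scheme"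
begin

text \<open>Pivotality of \<open>F\<close> in the form used for loops: \<open>F\<close> preserves
  the cap \<open>ev_tilde\<close>, up to the comparison on the dual strand.\<close>

lemma fevt_eq:
  assumes [simp]: "d \<in> Obj C"
  shows "fev (Dual C d) \<bullet> [] \<lhd> femb (Piv C d) \<rhd> [OMap F (Dual C d)]
    = D.evt_cap (OMap F d) \<bullet> [OMap F d] \<lhd> emb D (dual_comparison C D F d) \<rhd> []"
proof -
  let ?d = "Dual C d" and ?w = "OMap F d" and ?p = "emb D (Piv D (OMap F d))"
  let ?c = "dual_comparison C D F"
  have c: "?c d \<in> Hom D (OMap F ?d) (Dual D ?w)" and c': "?c ?d \<in> Hom D (OMap F (Dual C ?d)) (Dual D (OMap F ?d))"
    by (rule dual_comparison_hom; simp)+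
  note cd = D.dual_arrow_hom[OF c]
  note [simp] = D.HomD[OF c] D.HomD[OF c'] D.HomD[OF cd] dual_comparison_iso[of ?d]
    D.comp_extend[OF D.emb_inv_cancel(2)]
  have "femb (Piv C d) = emb D ((?c ?d)\<^sup>\<inverse>) \<bullet> emb D (dual_arrow D (?c d)) \<bullet> ?p"
    by (simp add: femb_def map_piv D.emb_comp)
  \<comment> \<open>Composition with the comparison at the dual of \<open>d\<close> removes the
    inverse from \<open>map_piv\<close>.\<close>
  then have "emb D (?c ?d) \<bullet> femb (Piv C d) = emb D (dual_arrow D (?c d)) \<bullet> ?p"
    by simp
  from D.whisker_eq[OF this, of "[]" "[OMap F ?d]"]
  have 1: "[] \<lhd> emb D (?c ?d) \<rhd> [OMap F ?d] \<bullet> [] \<lhd> femb (Piv C d) \<rhd> [OMap F ?d]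
     = [] \<lhd> emb D (dual_arrow D (?c d)) \<rhd> [OMap F ?d] \<bullet> [] \<lhd> ?p \<rhd> [OMap F ?d]"
    by simp
  have 2: "[Dual D (Dual D ?w)] \<lhd> emb D (?c d) \<rhd> [] \<bullet> [] \<lhd> ?p \<rhd> [OMap F ?d]
      = [] \<lhd> ?p \<rhd> [Dual D ?w] \<bullet> [?w] \<lhd> emb D (?c d) \<rhd> []"
    using D.interchange[of "[]" ?p "[]" "emb D (?c d)" "[]"] by simp
  show ?thesis
    unfolding ev_dual_comparison[of ?d, OF C.dual_obj'[OF assms], symmetric]
    by (simp add: 1 D.comp_extend[OF D.ev_dual_arrow[OF c]] 2 D.evt_cap_eq)
qed

end

text \<open>Only the source is braided, since \<open>M\<close> is not. The single crossing needed in
  the target is supplied as a half-braiding whose value is the image of the braiding of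
  \<open>C\<close>.\<close>

locale braided_source = pivotal_functor_diagrams C D F + C: braided_pivotal_category C
  for C :: "('o, 'm, 'y) bpivcat_scheme" and D :: "('p, 'n, 'z) pivcat_scheme" (structure)
    and F :: "('o, 'm, 'p, 'n, 'w) tfun_scheme"
begin

lemma braid_arr [simp]:
  assumes "a \<in> Obj C" "b \<in> Obj C"
  shows "\<beta>\<^bsub>C\<^esub> a b \<in> Arr C" "Src C (\<beta>\<^bsub>C\<^esub> a b) = a \<otimes>\<^bsub>C\<^esub> b" "Tgt C (\<beta>\<^bsub>C\<^esub> a b) = b \<otimes>\<^bsub>C\<^esub> a" "is_iso C (\<beta>\<^bsub>C\<^esub> a b)"
  using C.braid_hom[OF assms] C.braid_iso[OF assms] by (auto simp: Hom_def)

text \<open>In the image of \<open>twist\<close> the pivotal arrow rises from the bottom through the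
  crossing to the cap, where \<open>fevt_eq\<close> absorbs it and leaves the comparison arrow; this
  one descends to the cup and is absorbed by \<open>coev_dual_comparison\<close>.\<close>

lemma femb_twist:
  assumes [simp]: "d \<in> Obj C"
    and e: "hb D (OMap F d) e (OMap F d) = fsplit d d \<bullet> femb (\<beta>\<^bsub>C\<^esub> d d) \<bullet> fmerge d d"
  shows "femb (\<theta>\<^bsub>C\<^esub> d) = D.twist_diagram (OMap F d) e"
proof -
  let ?d = "Dual C d" and ?dd = "Dual C (Dual C d)" and ?w = "OMap F d" and ?p = "femb (Piv C d)"
  let ?B = "\<lambda>a b. fsplit b a \<bullet> femb (\<beta>\<^bsub>C\<^esub> a b) \<bullet> fmerge a b"
  let ?c = "emb D (dual_comparison C D F d)"
  note [simp] = D.HomD[OF dual_comparison_hom[OF assms(1)]]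
  have "\<beta>\<^bsub>C\<^esub> ?dd d \<cdot>\<^bsub>C\<^esub> (Piv C d \<odot>\<^bsub>C\<^esub> ide\<^bsub>C\<^esub> d) = (ide\<^bsub>C\<^esub> d \<odot>\<^bsub>C\<^esub> Piv C d) \<cdot>\<^bsub>C\<^esub> \<beta>\<^bsub>C\<^esub> d d"
    by (rule C.braid_natural) (simp_all add: C.HomI)
  from arg_cong[OF this, of femb]
  have "femb (\<beta>\<^bsub>C\<^esub> ?dd d) \<bullet> fmerge ?dd d \<bullet> [] \<lhd> ?p \<rhd> [?w] \<bullet> fsplit d d
    = fmerge d ?dd \<bullet> [?w] \<lhd> ?p \<rhd> [] \<bullet> fsplit d d \<bullet> femb (\<beta>\<^bsub>C\<^esub> d d)"
    by (simp add: femb_simps)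
  from arg_cong[OF this, of "\<lambda>t. fsplit d ?dd \<bullet> t \<bullet> fmerge d d"]
  have "?B ?dd d \<bullet> [] \<lhd> ?p \<rhd> [?w] = [?w] \<lhd> ?p \<rhd> [] \<bullet> ?B d d"
    by simp
  from D.whisker_eq[OF this, of "[]" "[OMap F ?d]"]
  have 1: "[] \<lhd> ?B ?dd d \<rhd> [OMap F ?d] \<bullet> [] \<lhd> ?p \<rhd> [?w, OMap F ?d]
     = [?w] \<lhd> ?p \<rhd> [OMap F ?d] \<bullet> [] \<lhd> ?B d d \<rhd> [OMap F ?d]"
    by (simp del: D.whisker_comp add: D.whisker_comp[of "[]"] )
  have 2: "[OMap F ?dd] \<lhd> fcoev d \<rhd> [] \<bullet> ?p = [] \<lhd> ?p \<rhd> [?w, OMap F ?d] \<bullet> [?w] \<lhd> fcoev d \<rhd> []"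
    using D.interchange[of "[]" ?p "[]" "fcoev d" "[]"] by simp
  have 3: "[?w] \<lhd> fev ?d \<rhd> [] \<bullet> [?w] \<lhd> ?p \<rhd> [OMap F ?d] = [?w] \<lhd> D.evt_cap ?w \<rhd> [] \<bullet> [?w, ?w] \<lhd> ?c \<rhd> []"
    using D.whisker_eq[OF fevt_eq[of d], of "[?w]" "[]"] by simp
  have 4: "[?w, ?w] \<lhd> ?c \<rhd> [] \<bullet> [] \<lhd> ?B d d \<rhd> [OMap F ?d] = [] \<lhd> ?B d d \<rhd> [Dual D ?w] \<bullet> [?w, ?w] \<lhd> ?c \<rhd> []"
    using D.interchange[of "[]" "?B d d" "[]" ?c "[]"] by simp
  have 5: "[?w, ?w] \<lhd> ?c \<rhd> [] \<bullet> [?w] \<lhd> fcoev d \<rhd> [] = [?w] \<lhd> D.coev_cup ?w \<rhd> []"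
    using D.whisker_eq[OF coev_dual_comparison[of d], of "[?w]" "[]"] by simp
  have "femb (\<theta>\<^bsub>C\<^esub> d) = [?w] \<lhd> fev ?d \<rhd> [] \<bullet> [] \<lhd> ?B ?dd d \<rhd> [OMap F ?d] \<bullet> [OMap F ?dd] \<lhd> fcoev d \<rhd> [] \<bullet> ?p"
    by (simp add: twist_def Let_def femb_simps fcap_def fcup_def)
  also have "\<dots> = ([?w] \<lhd> fev ?d \<rhd> [] \<bullet> [?w] \<lhd> ?p \<rhd> [OMap F ?d]) \<bullet> [] \<lhd> ?B d d \<rhd> [OMap F ?d] \<bullet> [?w] \<lhd> fcoev d \<rhd> []"
    unfolding 2 D.comp_extend[OF 1] D.dcomp_assoc ..
  also have "\<dots> = [?w] \<lhd> D.evt_cap ?w \<rhd> [] \<bullet> ([?w, ?w] \<lhd> ?c \<rhd> [] \<bullet> [] \<lhd> ?B d d \<rhd> [OMap F ?d]) \<bullet> [?w] \<lhd> fcoev d \<rhd> []"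
    unfolding 3 D.dcomp_assoc ..
  also have "\<dots> = D.twist_diagram ?w e"
    unfolding 4 D.dcomp_assoc 5 D.twist_diagram_def e ..
  finally show ?thesis .
qed

lemma twist_hom: "d \<in> Obj C \<Longrightarrow> \<theta>\<^bsub>C\<^esub> d \<in> Hom C d d"
  by (auto simp: twist_def Let_def intro!: C.HomI)

end

section \<open>Invertibility of the twist in a braided pivotal category\<close>

context braided_pivotal_category
begin

lemma braid_half_braiding:
  assumes [simp]: "a \<in> Obj C"
  shows "half_braiding C a (\<lambda>b\<in>Obj C. \<beta> a b)"
proof -
  have "\<beta> a c \<cdot> (ide a \<odot> f) = (f \<odot> ide a) \<cdot> \<beta> a b" if "f \<in> Hom C b c" for b c f
    by (rule braid_natural[OF _ that]) (simp add: ide_hom)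
  then show ?thesis
    using assms by (auto simp: half_braiding_def hexagon_right braid_hom braid_iso)
qed

lemma inv_ide: "a \<in> Obj C \<Longrightarrow> (ide a)\<^sup>\<inverse> = ide a"
  by (rule inv_arrow_eq, rule inverse_arrowsI) (simp_all add: ide_hom)

lemma tensor_functor_id: "tensor_functor C C (id_tfun C)"
  by unfold_locales (simp_all add: id_tfun_def ide_hom unit_obj ide_iso HomI, auto simp: Hom_def)

text \<open>Here the comparison is the curried evaluation, that is, a single zig-zag. Pivotality of
  the identity functor follows.\<close>

lemma dual_comparison_id:
  assumes [simp]: "a \<in> Obj C"
  shows "dual_comparison C C (id_tfun C) a = ide (Dual C a)"
proof -
  have "dual_comparison C C (id_tfun C) a = curry_pairing C (Dual C a) a (Ev C a)"
    by (simp add: dual_comparison_def id_tfun_def inv_ide)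
  also have "\<dots> = ide (Dual C a)"
    using HomD[OF curry_hom[of "Dual C a" a "Ev C a"]] ev_hom[of a]
    by (intro emb_faithful) (simp_all add: emb_curry zigzag_dual_diagram emb_ide)
  finally show ?thesis .
qed

lemma dual_arrow_ide:
  assumes [simp]: "a \<in> Obj C"
  shows "dual_arrow C (ide a) = ide (Dual C a)"
  using dual_comparison_id[OF assms]
  by (simp add: dual_arrow_def dual_comparison_def id_tfun_def inv_ide)

lemma braided_source_id: "braided_source C C (id_tfun C)"
proof -
  interpret tensor_functor C C "id_tfun C"
    by (rule tensor_functor_id)
  have "pivotal_functor C C (id_tfun C)"
    by unfold_locales (simp add: dual_comparison_id dual_arrow_ide inv_ide, simp add: id_tfun_def)
  then interpret pivotal_functor C C "id_tfun C" .
  show ?thesis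
    by unfold_locales
qed

text \<open>Applied to the identity functor and to the braiding as half-braiding,
  \<open>femb_twist\<close> exhibits the twist as the loop to which \<open>twist_iso\<close>
  applies.\<close>

lemma twist_is_iso:
  assumes [simp]: "a \<in> Obj C"
  shows "is_iso C (\<theta> a)"
proof -
  interpret I: braided_source C C "id_tfun C"
    by (rule braided_source_id)
  have [simp]: "I.femb f = emb C f" "OMap (id_tfun C) b = b" for f b
    unfolding I.femb_def by (simp_all add: id_tfun_def)
  have [simp]: "I.fsplit a a = split C a a" "I.fmerge a a = merge C a a"
    unfolding I.fsplit_def I.fmerge_def by (simp_all add: id_tfun_def inv_ide emb_ide)
  show ?thesis
    using I.femb_twist[OF assms, of "\<lambda>b\<in>Obj C. \<beta> a b"] I.twist_hom[OF assms]
    by (intro twist_iso[OF braid_half_braiding[OF assms]]) (simp_all add: hb_def)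
qed

end

section \<open>The Drinfeld center\<close>

context monoidal_category
begin

lemma tensor_iso:
  assumes "is_iso C f" "is_iso C g"
  shows "is_iso C (f \<odot> g)"
proof (rule is_isoI)
  have [simp]: "f \<in> Arr C" "g \<in> Arr C" using assms by (auto intro: iso_arr)
  show "f \<odot> g \<in> Hom C (Src C f \<otimes> Src C g) (Tgt C f \<otimes> Tgt C g)"
    "f\<^sup>\<inverse> \<odot> g\<^sup>\<inverse> \<in> Hom C (Tgt C f \<otimes> Tgt C g) (Src C f \<otimes> Src C g)"
    "f\<^sup>\<inverse> \<odot> g\<^sup>\<inverse> \<cdot> f \<odot> g = ide (Src C f \<otimes> Src C g)" "f \<odot> g \<cdot> f\<^sup>\<inverse> \<odot> g\<^sup>\<inverse> = ide (Tgt C f \<otimes> Tgt C g)"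
    using assms by (auto intro!: HomI simp: tensor_comp')
qed

lemma hb_eq:
  assumes "e b \<in> Hom C (w \<otimes> b) (b \<otimes> w)" "w \<in> Obj C" "b \<in> Obj C"
  shows "emb C (e b) = merge C b w \<bullet> hb C w e b \<bullet> split C w b"
    "diag C (hb C w e b)" "dsrc (hb C w e b) = [w, b]" "dtgt (hb C w e b) = [b, w]"
  using assms HomD[OF assms(1)] by (simp_all add: hb_def)

text \<open>Converse to \<open>hb_natural\<close> and \<open>hb_merge\<close>, so that
  half-braidings can be constructed without brackets.\<close>

lemma half_braidingI:
  assumes ext: "e \<in> extensional (Obj C)" and w [simp]: "w \<in> Obj C"
    and hom: "\<And>b. b \<in> Obj C \<Longrightarrow> e b \<in> Hom C (w \<otimes> b) (b \<otimes> w)"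
    and iso: "\<And>b. b \<in> Obj C \<Longrightarrow> is_iso C (e b)"
    and nat: "\<And>b c f. f \<in> Hom C b c \<Longrightarrow> hb C w e c \<bullet> [w] \<lhd> emb C f \<rhd> [] = [] \<lhd> emb C f \<rhd> [w] \<bullet> hb C w e b"
    and ten: "\<And>b c. \<lbrakk>b \<in> Obj C; c \<in> Obj C\<rbrakk> \<Longrightarrow> hb C w e (b \<otimes> c) \<bullet> [w] \<lhd> merge C b c \<rhd> []
        = [] \<lhd> merge C b c \<rhd> [w] \<bullet> [b] \<lhd> hb C w e c \<rhd> [] \<bullet> [] \<lhd> hb C w e b \<rhd> [c]"
  shows "half_braiding C w e"
  unfolding half_braiding_def
proof (intro conjI ballI)
  show "e c \<cdot> (ide w \<odot> f) = (f \<odot> ide w) \<cdot> e b" if f: "f \<in> Hom C b c" for b c f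
  proof (rule emb_faithful)
    note [simp] = Hom_obj[OF f] HomD[OF f] HomD[OF hom]
    note [simp] = hb_eq[of e, OF hom]
    show "e c \<cdot> ide w \<odot> f \<in> Arr C" "f \<odot> ide w \<cdot> e b \<in> Arr C"
      by simp_all
    show "emb C (e c \<cdot> (ide w \<odot> f)) = emb C ((f \<odot> ide w) \<cdot> e b)"
      by (simp add: emb_simps comp_extend[OF nat[OF f]])
  qed
  show "\<a> b c w \<cdot> e (b \<otimes> c) \<cdot> \<a> w b c = (ide b \<odot> e c) \<cdot> \<a> b w c \<cdot> (e b \<odot> ide c)"
    if [simp]: "b \<in> Obj C" "c \<in> Obj C" for b c
  proof (rule emb_faithful)
    note [simp] = HomD[OF hom]
    note [simp] = hb_eq[of e, OF hom]
    show "\<a> b c w \<cdot> e (b \<otimes> c) \<cdot> \<a> w b c \<in> Arr C" "(ide b \<odot> e c) \<cdot> \<a> b w c \<cdot> (e b \<odot> ide c) \<in> Arr C"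
      by simp_all
    show "emb C (\<a> b c w \<cdot> e (b \<otimes> c) \<cdot> \<a> w b c) = emb C ((ide b \<odot> e c) \<cdot> \<a> b w c \<cdot> (e b \<odot> ide c))"
      by (simp add: emb_simps comp_extend[OF ten])
  qed
qed (use ext hom iso in auto)

lemma half_braiding_hom: "\<lbrakk>half_braiding C w e; b \<in> Obj C\<rbrakk> \<Longrightarrow> e b \<in> Hom C (w \<otimes> b) (b \<otimes> w)"
  by (simp add: half_braiding_def)

lemma center_objD:
  assumes "X \<in> center_obj C"
  shows "fst X \<in> Obj C" "half_braiding C (fst X) (snd X)"
  using assms by (auto simp: center_obj_def)

abbreviation (input) chb where "chb X b \<equiv> hb C (fst X) (snd X) b"

lemma center_objI: "\<lbrakk>fst X \<in> Obj C; half_braiding C (fst X) (snd X)\<rbrakk> \<Longrightarrow> X \<in> center_obj C"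
  by (cases X) (simp add: center_obj_def)

lemma center_obj_fst [simp]: "X \<in> center_obj C \<Longrightarrow> fst X \<in> Obj C"
  by (rule center_objD)

lemma chb_simps [simp]:
  assumes "X \<in> center_obj C" "b \<in> Obj C"
  shows "diag C (chb X b)" "dsrc (chb X b) = [fst X, b]" "dtgt (chb X b) = [b, fst X]"
  using center_objD[OF assms(1)] hb_simps[of "fst X" "snd X" b] assms(2) by auto

definition center_hom where
  "center_hom X Y = {f \<in> Hom C (fst X) (fst Y).
     \<forall>b\<in>Obj C. snd Y b \<cdot> (f \<odot> ide b) = (ide b \<odot> f) \<cdot> snd X b}"

lemma center_hom_iff:
  assumes X: "X \<in> center_obj C" and Y: "Y \<in> center_obj C" and f: "f \<in> Hom C (fst X) (fst Y)"
  shows "f \<in> center_hom X Y \<longleftrightarrow>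
    (\<forall>b\<in>Obj C. chb Y b \<bullet> [] \<lhd> emb C f \<rhd> [b] = [b] \<lhd> emb C f \<rhd> [] \<bullet> chb X b)"
proof -
  note [simp] = HomD[OF f] X Y
  have "snd Y b \<cdot> (f \<odot> ide b) = (ide b \<odot> f) \<cdot> snd X b \<longleftrightarrow>
     chb Y b \<bullet> [] \<lhd> emb C f \<rhd> [b] = [b] \<lhd> emb C f \<rhd> [] \<bullet> chb X b" (is "?l = ?r \<longleftrightarrow> ?L = ?R")
    if b [simp]: "b \<in> Obj C" for b
  proof -
    note hX = half_braiding_hom[OF center_objD(2)[OF X] b] and hY = half_braiding_hom[OF center_objD(2)[OF Y] b]
    note [simp] = HomD[OF hX] HomD[OF hY] X Y
    have "?l = ?r \<longleftrightarrow> emb C ?l = emb C ?r"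
      by (auto dest: emb_faithful)
    also have "\<dots> \<longleftrightarrow> merge C b (fst Y) \<bullet> ?L \<bullet> split C (fst X) b = merge C b (fst Y) \<bullet> ?R \<bullet> split C (fst X) b"
      by (simp add: emb_simps hb_eq(1)[of "snd X", OF hX] hb_eq(1)[of "snd Y", OF hY])
    also have "\<dots> \<longleftrightarrow> ?L = ?R"
    proof
      assume "merge C b (fst Y) \<bullet> ?L \<bullet> split C (fst X) b = merge C b (fst Y) \<bullet> ?R \<bullet> split C (fst X) b"
      from arg_cong[OF this, of "\<lambda>t. split C b (fst Y) \<bullet> t \<bullet> merge C (fst X) b"]
      show "?L = ?R" by simp
    qed simp
    finally show ?thesis .
  qed
  then show ?thesis
    using f by (simp add: center_hom_def)
qed

lemma center_homD:
  assumes "f \<in> center_hom X Y" "X \<in> center_obj C" "Y \<in> center_obj C"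
  shows "f \<in> Hom C (fst X) (fst Y)"
    "b \<in> Obj C \<Longrightarrow> chb Y b \<bullet> [] \<lhd> emb C f \<rhd> [b] = [b] \<lhd> emb C f \<rhd> [] \<bullet> chb X b"
proof -
  show f: "f \<in> Hom C (fst X) (fst Y)"
    using assms(1) by (simp add: center_hom_def)
  show "b \<in> Obj C \<Longrightarrow> chb Y b \<bullet> [] \<lhd> emb C f \<rhd> [b] = [b] \<lhd> emb C f \<rhd> [] \<bullet> chb X b"
    using assms center_hom_iff[OF assms(2,3) f] by simp
qed

lemma center_hom_inv:
  assumes f: "f \<in> center_hom X Y" and X: "X \<in> center_obj C" and Y: "Y \<in> center_obj C" and iso: "is_iso C f"
  shows "f\<^sup>\<inverse> \<in> center_hom Y X"
proof -
  note fh = center_homD(1)[OF f X Y]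
  have gh: "f\<^sup>\<inverse> \<in> Hom C (fst Y) (fst X)"
    by (rule inv_hom[OF iso fh])
  note [simp] = HomD[OF fh] iso X Y
  have "chb X b \<bullet> [] \<lhd> emb C (f\<^sup>\<inverse>) \<rhd> [b] = [b] \<lhd> emb C (f\<^sup>\<inverse>) \<rhd> [] \<bullet> chb Y b" if [simp]: "b \<in> Obj C" for b
  proof -
    have 1: "[b] \<lhd> emb C (f\<^sup>\<inverse>) \<rhd> [] \<bullet> [b] \<lhd> emb C f \<rhd> [] = did C [b, fst X]"
      using whisker_eq[OF emb_inv_cancel(1)[OF iso], of "[b]" "[]"] by simp
    have 2: "[] \<lhd> emb C f \<rhd> [b] \<bullet> [] \<lhd> emb C (f\<^sup>\<inverse>) \<rhd> [b] = did C [fst Y, b]"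
      using whisker_eq[OF emb_inv_cancel(2)[OF iso], of "[]" "[b]"] by simp
    have "[b] \<lhd> emb C (f\<^sup>\<inverse>) \<rhd> [] \<bullet> ([b] \<lhd> emb C f \<rhd> [] \<bullet> chb X b) \<bullet> [] \<lhd> emb C (f\<^sup>\<inverse>) \<rhd> [b]
       = [b] \<lhd> emb C (f\<^sup>\<inverse>) \<rhd> [] \<bullet> chb Y b"
      unfolding center_homD(2)[OF f X Y that, symmetric] by (simp add: 2)
    then show ?thesis
      by (simp add: comp_extend[OF 1])
  qed
  then show ?thesis
    using center_hom_iff[OF Y X gh] by simp
qed

lemma center_tensor_fst [simp]: "fst (center_tensor C X Y) = fst X \<otimes> fst Y"
  by (simp add: center_tensor_def split: prod.splits)

lemma center_tensor_snd:
  "c \<in> Obj C \<Longrightarrow> snd (center_tensor C X Y) c = \<a> c (fst X) (fst Y) \<cdot> (snd X c \<odot> ide (fst Y))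
      \<cdot> (\<a> (fst X) c (fst Y))\<^sup>\<inverse> \<cdot> (ide (fst X) \<odot> snd Y c) \<cdot> \<a> (fst X) (fst Y) c"
  by (simp add: center_tensor_def split: prod.splits)

context
  fixes X Y
  assumes X [simp]: "X \<in> center_obj C" and Y [simp]: "Y \<in> center_obj C"
begin

lemma center_tensor_hom:
  assumes c [simp]: "c \<in> Obj C"
  shows "snd (center_tensor C X Y) c \<in> Hom C ((fst X \<otimes> fst Y) \<otimes> c) (c \<otimes> (fst X \<otimes> fst Y))"
    "is_iso C (snd (center_tensor C X Y) c)"
proof -
  note [simp] = half_braidingD[OF center_objD(2)[OF X] c] half_braidingD[OF center_objD(2)[OF Y] c]

  show "snd (center_tensor C X Y) c \<in> Hom C ((fst X \<otimes> fst Y) \<otimes> c) (c \<otimes> (fst X \<otimes> fst Y))"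
    by (auto simp: center_tensor_snd intro!: HomI)
  show "is_iso C (snd (center_tensor C X Y) c)"
    unfolding center_tensor_snd[OF c]
    by (intro iso_comp tensor_iso inv_iso) (simp_all add: ide_iso)
qed

lemma hb_center_tensor:
  assumes c [simp]: "c \<in> Obj C"
  shows "hb C (fst X \<otimes> fst Y) (snd (center_tensor C X Y)) c = [c] \<lhd> merge C (fst X) (fst Y) \<rhd> [] \<bullet>
    [] \<lhd> chb X c \<rhd> [fst Y] \<bullet> [fst X] \<lhd> chb Y c \<rhd> [] \<bullet> [] \<lhd> split C (fst X) (fst Y) \<rhd> [c]"
proof -
  note [simp] = half_braidingD[OF center_objD(2)[OF X] c] half_braidingD[OF center_objD(2)[OF Y] c]

  show ?thesis by (simp add: hb_def center_tensor_snd emb_simps)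
qed

text \<open>The crossing of the product is a crossing of \<open>Y\<close> followed by one of
  \<open>X\<close>, and each axiom is the axiom for these two in turn; in the multiplicative law the
  two middle crossings are interchanged.\<close>

lemma center_tensor_obj: "center_tensor C X Y \<in> center_obj C"
proof -
  let ?a = "fst X" and ?b = "fst Y"
  have "half_braiding C (?a \<otimes> ?b) (snd (center_tensor C X Y))"
  proof (rule half_braidingI)
    show "snd (center_tensor C X Y) \<in> extensional (Obj C)"
      by (simp add: center_tensor_def split: prod.splits)
    show "hb C (?a \<otimes> ?b) (snd (center_tensor C X Y)) d \<bullet> [?a \<otimes> ?b] \<lhd> emb C f \<rhd> []
       = [] \<lhd> emb C f \<rhd> [?a \<otimes> ?b] \<bullet> hb C (?a \<otimes> ?b) (snd (center_tensor C X Y)) c"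
      if f: "f \<in> Hom C c d" for c d f
    proof -
      note [simp] = Hom_obj[OF f] HomD[OF f]
      have 1: "[] \<lhd> split C ?a ?b \<rhd> [d] \<bullet> [?a \<otimes> ?b] \<lhd> emb C f \<rhd> [] = [?a, ?b] \<lhd> emb C f \<rhd> [] \<bullet> [] \<lhd> split C ?a ?b \<rhd> [c]"
        using interchange[of "[]" "split C ?a ?b" "[]" "emb C f" "[]"] by simp
      have 2: "[?a] \<lhd> chb Y d \<rhd> [] \<bullet> [?a, ?b] \<lhd> emb C f \<rhd> [] = [?a] \<lhd> emb C f \<rhd> [?b] \<bullet> [?a] \<lhd> chb Y c \<rhd> []"
        using whisker_eq[OF hb_natural[OF center_objD(2)[OF Y] _ f], of "[?a]" "[]"] by simp
      have 3: "[] \<lhd> chb X d \<rhd> [?b] \<bullet> [?a] \<lhd> emb C f \<rhd> [?b] = [] \<lhd> emb C f \<rhd> [?a, ?b] \<bullet> [] \<lhd> chb X c \<rhd> [?b]"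
        using whisker_eq[OF hb_natural[OF center_objD(2)[OF X] _ f], of "[]" "[?b]"] by simp
      have 4: "[d] \<lhd> merge C ?a ?b \<rhd> [] \<bullet> [] \<lhd> emb C f \<rhd> [?a, ?b] = [] \<lhd> emb C f \<rhd> [?a \<otimes> ?b] \<bullet> [c] \<lhd> merge C ?a ?b \<rhd> []"
        using interchange[of "[]" "emb C f" "[]" "merge C ?a ?b" "[]"] by simp
      show ?thesis
        by (simp add: hb_center_tensor 1 comp_extend[OF 2] comp_extend[OF 3] comp_extend[OF 4])
    qed
    show "hb C (?a \<otimes> ?b) (snd (center_tensor C X Y)) (c \<otimes> d) \<bullet> [?a \<otimes> ?b] \<lhd> merge C c d \<rhd> []
        = [] \<lhd> merge C c d \<rhd> [?a \<otimes> ?b] \<bullet> [c] \<lhd> hb C (?a \<otimes> ?b) (snd (center_tensor C X Y)) d \<rhd> []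
           \<bullet> [] \<lhd> hb C (?a \<otimes> ?b) (snd (center_tensor C X Y)) c \<rhd> [d]"
      if [simp]: "c \<in> Obj C" "d \<in> Obj C" for c d
    proof -
      have 1: "[] \<lhd> split C ?a ?b \<rhd> [c \<otimes> d] \<bullet> [?a \<otimes> ?b] \<lhd> merge C c d \<rhd> [] = [?a, ?b] \<lhd> merge C c d \<rhd> [] \<bullet> [] \<lhd> split C ?a ?b \<rhd> [c, d]"
        using interchange[of "[]" "split C ?a ?b" "[]" "merge C c d" "[]"] by simp
      have 2: "[?a] \<lhd> chb Y (c \<otimes> d) \<rhd> [] \<bullet> [?a, ?b] \<lhd> merge C c d \<rhd> []
         = [?a] \<lhd> merge C c d \<rhd> [?b] \<bullet> [?a, c] \<lhd> chb Y d \<rhd> [] \<bullet> [?a] \<lhd> chb Y c \<rhd> [d]"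
        using whisker_eq[OF hb_merge[OF center_objD(2)[OF Y], of c d], of "[?a]" "[]"] by simp
      have 3: "[] \<lhd> chb X (c \<otimes> d) \<rhd> [?b] \<bullet> [?a] \<lhd> merge C c d \<rhd> [?b]
         = [] \<lhd> merge C c d \<rhd> [?a, ?b] \<bullet> [c] \<lhd> chb X d \<rhd> [?b] \<bullet> [] \<lhd> chb X c \<rhd> [d, ?b]"
        using whisker_eq[OF hb_merge[OF center_objD(2)[OF X], of c d], of "[]" "[?b]"] by simp
      have 4: "[c \<otimes> d] \<lhd> merge C ?a ?b \<rhd> [] \<bullet> [] \<lhd> merge C c d \<rhd> [?a, ?b] = [] \<lhd> merge C c d \<rhd> [?a \<otimes> ?b] \<bullet> [c, d] \<lhd> merge C ?a ?b \<rhd> []"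
        using interchange[of "[]" "merge C c d" "[]" "merge C ?a ?b" "[]"] by simp
      have 5: "[] \<lhd> chb X c \<rhd> [d, ?b] \<bullet> [?a, c] \<lhd> chb Y d \<rhd> [] = [c, ?a] \<lhd> chb Y d \<rhd> [] \<bullet> [] \<lhd> chb X c \<rhd> [?b, d]"
        using interchange[of "[]" "chb X c" "[]" "chb Y d" "[]"] by simp
      show ?thesis
        by (simp add: hb_center_tensor 1 comp_extend[OF 2] comp_extend[OF 3] comp_extend[OF 4] comp_extend[OF 5])
    qed
  qed (simp_all add: center_tensor_hom)
  then show ?thesis
    by (intro center_objI) simp_all
qed

text \<open>Both iterated products have the same crossings, of \<open>V\<close>, then
  \<open>Y\<close>, then \<open>X\<close>; only the bracketing boxes differ, and the associator
  absorbs them.\<close>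

lemma center_assoc:
  assumes V [simp]: "V \<in> center_obj C"
  shows "\<a> (fst X) (fst Y) (fst V) \<in> center_hom (center_tensor C (center_tensor C X Y) V) (center_tensor C X (center_tensor C Y V))"
proof -
  let ?a = "fst X" and ?b = "fst Y" and ?c = "fst V"
  note XY = center_tensor_obj
  have YV: "center_tensor C Y V \<in> center_obj C"
    by (rule monoidal_category.center_tensor_obj[OF monoidal_category_axioms]) simp_all
  have XY_V: "center_tensor C (center_tensor C X Y) V \<in> center_obj C"
    by (rule monoidal_category.center_tensor_obj[OF monoidal_category_axioms XY V])
  have X_YV: "center_tensor C X (center_tensor C Y V) \<in> center_obj C"
    by (rule monoidal_category.center_tensor_obj[OF monoidal_category_axioms X YV])
  note H = monoidal_category.hb_center_tensor[OF monoidal_category_axioms]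
  have h: "\<a> ?a ?b ?c \<in> Hom C (fst (center_tensor C (center_tensor C X Y) V)) (fst (center_tensor C X (center_tensor C Y V)))"
    by (auto intro!: HomI)
  have "chb (center_tensor C X (center_tensor C Y V)) d \<bullet> [] \<lhd> emb C (\<a> ?a ?b ?c) \<rhd> [d]
     = [d] \<lhd> emb C (\<a> ?a ?b ?c) \<rhd> [] \<bullet> chb (center_tensor C (center_tensor C X Y) V) d" if [simp]: "d \<in> Obj C" for d
  proof -
    have 1: "[] \<lhd> chb X d \<rhd> [?b \<otimes> ?c] \<bullet> [?a, d] \<lhd> merge C ?b ?c \<rhd> [] = [d, ?a] \<lhd> merge C ?b ?c \<rhd> [] \<bullet> [] \<lhd> chb X d \<rhd> [?b, ?c]"
      using interchange[of "[]" "chb X d" "[]" "merge C ?b ?c" "[]"] by simp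
    have 2: "[] \<lhd> split C ?a ?b \<rhd> [d, ?c] \<bullet> [?a \<otimes> ?b] \<lhd> chb V d \<rhd> [] = [?a, ?b] \<lhd> chb V d \<rhd> [] \<bullet> [] \<lhd> split C ?a ?b \<rhd> [?c, d]"
      using interchange[of "[]" "split C ?a ?b" "[]" "chb V d" "[]"] by simp
    show ?thesis
      using H[OF X YV that] H[OF XY V that]
      by (simp add: H[OF X Y that] H[OF Y V that] emb_assoc comp_extend[OF 1] comp_extend[OF 2])
  qed
  then show ?thesis
    using center_hom_iff[OF XY_V X_YV h] by simp
qed

end

lemma hb_center_unit: "d \<in> Obj C \<Longrightarrow> hb C \<one> (snd (center_unit C)) d = [d] \<lhd> create C \<rhd> [] \<bullet> [] \<lhd> erase C \<rhd> [d]"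
  by (simp add: hb_def center_unit_def emb_simps)

lemma center_unit_fst [simp]: "fst (center_unit C) = \<one>"
  by (simp add: center_unit_def)

text \<open>Membership of the unit in the center is a hypothesis here; for a central functor it is
  read off from \<open>Uni Z\<close> being an arrow of the center.\<close>

lemma center_runit:
  assumes X [simp]: "X \<in> center_obj C" and U: "center_unit C \<in> center_obj C"
  shows "\<r> (fst X) \<in> center_hom (center_tensor C X (center_unit C)) X"
proof -
  let ?a = "fst X"
  have h: "\<r> ?a \<in> Hom C (fst (center_tensor C X (center_unit C))) ?a"
    by (auto intro!: HomI)
  have "chb X d \<bullet> [] \<lhd> emb C (\<r> ?a) \<rhd> [d] = [d] \<lhd> emb C (\<r> ?a) \<rhd> [] \<bullet> chb (center_tensor C X (center_unit C)) d"
    if [simp]: "d \<in> Obj C" for d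
  proof -
    have 1: "[] \<lhd> chb X d \<rhd> [\<one>] \<bullet> [?a, d] \<lhd> create C \<rhd> [] = [d, ?a] \<lhd> create C \<rhd> [] \<bullet> chb X d"
      using interchange[of "[]" "chb X d" "[]" "create C" "[]"] by simp
    show ?thesis
      using hb_center_tensor[OF X U that]
      by (simp add: hb_center_unit emb_runit comp_extend[OF 1])
  qed
  then show ?thesis
    using center_hom_iff[OF center_tensor_obj[OF X U] X h] by simp
qed

text \<open>Compatibility with an isomorphism \<open>f\<close> forces \<open>e\<close> to be the
  half-braiding of \<open>X\<close> conjugated by \<open>f\<close>, and conjugation preserves every
  axiom.\<close>

lemma half_braiding_transport:
  assumes X [simp]: "X \<in> center_obj C" and [simp]: "v \<in> Obj C" and f: "f \<in> Hom C (fst X) v" and iso [simp]: "is_iso C f"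
    and ext: "e \<in> extensional (Obj C)"
    and hom: "\<And>b. b \<in> Obj C \<Longrightarrow> e b \<in> Hom C (v \<otimes> b) (b \<otimes> v)"
    and comm: "\<And>b. b \<in> Obj C \<Longrightarrow> hb C v e b \<bullet> [] \<lhd> emb C f \<rhd> [b] = [b] \<lhd> emb C f \<rhd> [] \<bullet> chb X b"
  shows "half_braiding C v e"
proof -
  let ?a = "fst X" and ?f = "emb C f" and ?g = "emb C (f\<^sup>\<inverse>)"
  note [simp] = HomD[OF f] hb_eq(2-)[of e, OF hom]
  have fg: "[] \<lhd> ?f \<rhd> ys \<bullet> [] \<lhd> ?g \<rhd> ys = did C (v # ys)" if "set ys \<subseteq> Obj C" for ys
    using whisker_eq[OF emb_inv_cancel(2)[OF iso], of "[]" ys] that by simp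
  have gf: "xs \<lhd> ?g \<rhd> ys \<bullet> xs \<lhd> ?f \<rhd> ys = did C (xs @ ?a # ys)" if "set xs \<subseteq> Obj C" "set ys \<subseteq> Obj C" for xs ys
    using whisker_eq[OF emb_inv_cancel(1)[OF iso], of xs ys] that by simp
  have H: "hb C v e b = [b] \<lhd> ?f \<rhd> [] \<bullet> chb X b \<bullet> [] \<lhd> ?g \<rhd> [b]" if [simp]: "b \<in> Obj C" for b
    using arg_cong[OF comm[OF that], of "\<lambda>t. t \<bullet> [] \<lhd> ?g \<rhd> [b]"] by (simp add: fg)
  show ?thesis
  proof (rule half_braidingI[OF ext \<open>v \<in> Obj C\<close> hom])
    show "is_iso C (e b)" if b [simp]: "b \<in> Obj C" for b
    proof -
      note [simp] = half_braidingD[OF center_objD(2)[OF X] b] HomD[OF hom[OF b]]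
      have "e b = (ide b \<odot> f) \<cdot> snd X b \<cdot> (f\<^sup>\<inverse> \<odot> ide b)"
        by (rule emb_faithful)
          (simp_all add: emb_simps hb_eq(1)[of e, OF hom] H hb_eq(1)[of "snd X", OF half_braiding_hom[OF center_objD(2)[OF X] b]])
      then show ?thesis
        by (simp add: iso_comp tensor_iso inv_iso ide_iso)
    qed
    show "hb C v e c \<bullet> [v] \<lhd> emb C k \<rhd> [] = [] \<lhd> emb C k \<rhd> [v] \<bullet> hb C v e b" if k: "k \<in> Hom C b c" for b c k
    proof -
      note [simp] = Hom_obj[OF k] HomD[OF k]
      have 1: "[] \<lhd> ?g \<rhd> [c] \<bullet> [v] \<lhd> emb C k \<rhd> [] = [?a] \<lhd> emb C k \<rhd> [] \<bullet> [] \<lhd> ?g \<rhd> [b]"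
        using interchange[of "[]" ?g "[]" "emb C k" "[]"] by simp
      have 2: "[c] \<lhd> ?f \<rhd> [] \<bullet> [] \<lhd> emb C k \<rhd> [?a] = [] \<lhd> emb C k \<rhd> [v] \<bullet> [b] \<lhd> ?f \<rhd> []"
        using interchange[of "[]" "emb C k" "[]" ?f "[]"] by simp
      show ?thesis
        by (simp add: H 1 comp_extend[OF hb_natural[OF center_objD(2)[OF X] _ k]] comp_extend[OF 2])
    qed
    show "hb C v e (b \<otimes> c) \<bullet> [v] \<lhd> merge C b c \<rhd> []
        = [] \<lhd> merge C b c \<rhd> [v] \<bullet> [b] \<lhd> hb C v e c \<rhd> [] \<bullet> [] \<lhd> hb C v e b \<rhd> [c]"
      if [simp]: "b \<in> Obj C" "c \<in> Obj C" for b c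
    proof -
      have 1: "[] \<lhd> ?g \<rhd> [b \<otimes> c] \<bullet> [v] \<lhd> merge C b c \<rhd> [] = [?a] \<lhd> merge C b c \<rhd> [] \<bullet> [] \<lhd> ?g \<rhd> [b, c]"
        using interchange[of "[]" ?g "[]" "merge C b c" "[]"] by simp
      have 2: "[b \<otimes> c] \<lhd> ?f \<rhd> [] \<bullet> [] \<lhd> merge C b c \<rhd> [?a] = [] \<lhd> merge C b c \<rhd> [v] \<bullet> [b, c] \<lhd> ?f \<rhd> []"
        using interchange[of "[]" "merge C b c" "[]" ?f "[]"] by simp
      show ?thesis
        using gf[of "[b]" "[c]"]
        by (simp add: H 1 comp_extend[OF hb_merge[OF center_objD(2)[OF X]]] comp_extend[OF 2] comp_extend[OF gf])
    qed
  qed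
qed

end

section \<open>Half-braidings on dual objects\<close>

context rigid_category
begin

lemma center_dual_fst [simp]: "fst (center_dual C X) = Dual C (fst X)"
  by (simp add: center_dual_def Let_def split: prod.splits)

lemma center_dual_snd:
  assumes "b \<in> Obj C"
  shows "snd (center_dual C X) b = (let a = fst X; a' = Dual C a in
     (\<l> b \<odot> ide a') \<cdot> ((Ev C a \<odot> ide b) \<odot> ide a')
        \<cdot> ((\<a> a' a b)\<^sup>\<inverse> \<odot> ide a') \<cdot> ((ide a' \<odot> (snd X b)\<^sup>\<inverse>) \<odot> ide a')
        \<cdot> (\<a> a' b a \<odot> ide a') \<cdot> (\<a> (a' \<otimes> b) a a')\<^sup>\<inverse> \<cdot> (ide (a' \<otimes> b) \<odot> Coev C a)
        \<cdot> (\<r> (a' \<otimes> b))\<^sup>\<inverse>)"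
  using assms by (simp add: center_dual_def Let_def split: prod.splits)

context
  fixes X
  assumes X [simp]: "X \<in> center_obj C"
begin

lemma center_dual_hom:
  assumes b [simp]: "b \<in> Obj C"
  shows "snd (center_dual C X) b \<in> Hom C (Dual C (fst X) \<otimes> b) (b \<otimes> Dual C (fst X))"
proof -
  note [simp] = half_braidingD[OF center_objD(2)[OF X] b]
  show ?thesis by (auto simp: center_dual_snd Let_def intro!: HomI)
qed

lemma hb_center_dual:
  assumes b [simp]: "b \<in> Obj C"
  shows "hb C (Dual C (fst X)) (snd (center_dual C X)) b = [] \<lhd> ev_cap (fst X) \<rhd> [b, Dual C (fst X)] \<bullet>
    [Dual C (fst X)] \<lhd> hb_inv C (fst X) (snd X) b \<rhd> [Dual C (fst X)] \<bullet> [Dual C (fst X), b] \<lhd> coev_cup (fst X) \<rhd> []"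
proof -
  note [simp] = half_braidingD[OF center_objD(2)[OF X] b]
  let ?a = "fst X" and ?a' = "Dual C (fst X)"
  have i: "[] \<lhd> split C ?a' b \<rhd> [?a, ?a'] \<bullet> [?a' \<otimes> b] \<lhd> split C ?a ?a' \<rhd> []
      = [?a', b] \<lhd> split C ?a ?a' \<rhd> [] \<bullet> [] \<lhd> split C ?a' b \<rhd> [?a \<otimes> ?a']"
    "[] \<lhd> split C ?a' b \<rhd> [?a \<otimes> ?a'] \<bullet> [?a' \<otimes> b] \<lhd> emb C (Coev C ?a) \<rhd> []
      = [?a', b] \<lhd> emb C (Coev C ?a) \<rhd> [] \<bullet> [] \<lhd> split C ?a' b \<rhd> [\<one>]"
    "[] \<lhd> split C ?a' b \<rhd> [\<one>] \<bullet> [?a' \<otimes> b] \<lhd> create C \<rhd> []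
      = [?a', b] \<lhd> create C \<rhd> [] \<bullet> split C ?a' b"
    using interchange[of "[]" "split C ?a' b" "[]" "split C ?a ?a'" "[]"]
      interchange[of "[]" "split C ?a' b" "[]" "emb C (Coev C ?a)" "[]"]
      interchange[of "[]" "split C ?a' b" "[]" "create C" "[]"] by simp_all
  show ?thesis
    by (simp add: hb_def hb_inv_def center_dual_snd Let_def emb_simps cap_def cup_def i i[THEN comp_extend])
qed

text \<open>The axioms for the half-braiding of \<open>a\<^sup>*\<close> are never checked directly: it is the half-braiding of \<open>a'\<close>
  transported along the isomorphism \<open>a' \<rightarrow> a\<^sup>*\<close> which a nondegenerate pairing in the center induces.\<close>

lemma center_dual_pairing:
  assumes Y [simp]: "Y \<in> center_obj C" and p [simp]: "p \<in> Hom C (fst Y \<otimes> fst X) \<one>"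
    and iso: "is_iso C (curry_pairing C (fst Y) (fst X) p)"
    and comm: "\<And>b. b \<in> Obj C \<Longrightarrow> [b] \<lhd> cap C (fst Y) (fst X) p \<rhd> [] \<bullet> [] \<lhd> chb Y b \<rhd> [fst X] \<bullet> [fst Y] \<lhd> chb X b \<rhd> []
       = [] \<lhd> cap C (fst Y) (fst X) p \<rhd> [b]"
  shows "center_dual C X \<in> center_obj C" "curry_pairing C (fst Y) (fst X) p \<in> center_hom Y (center_dual C X)"
proof -
  note [simp] = hb_simps[OF center_objD(2)[OF X]]
  let ?a = "fst X" and ?b = "fst Y" and ?a' = "Dual C (fst X)"
  let ?c = "curry_pairing C ?b ?a p" and ?P = "cap C ?b ?a p"
  have c: "?c \<in> Hom C ?b ?a'"
    by (rule curry_hom) simp_all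
  note [simp] = HomD[OF c]
  have *: "hb C ?a' (snd (center_dual C X)) d \<bullet> [] \<lhd> emb C ?c \<rhd> [d] = [d] \<lhd> emb C ?c \<rhd> [] \<bullet> chb Y d"
    if [simp]: "d \<in> Obj C" for d
  proof -
    let ?I = "hb_inv C ?a (snd X) d"
    have 1: "[?a', d] \<lhd> coev_cup ?a \<rhd> [] \<bullet> [] \<lhd> emb C ?c \<rhd> [d] = [] \<lhd> emb C ?c \<rhd> [d, ?a, ?a'] \<bullet> [?b, d] \<lhd> coev_cup ?a \<rhd> []"
      using interchange[of "[]" "emb C ?c" "[d]" "coev_cup ?a" "[]"] by simp
    have 2: "[?a'] \<lhd> ?I \<rhd> [?a'] \<bullet> [] \<lhd> emb C ?c \<rhd> [d, ?a, ?a'] = [] \<lhd> emb C ?c \<rhd> [?a, d, ?a'] \<bullet> [?b] \<lhd> ?I \<rhd> [?a']"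
      using interchange[of "[]" "emb C ?c" "[]" ?I "[?a']"] by simp
    have 3: "[] \<lhd> ev_cap ?a \<rhd> [d, ?a'] \<bullet> [] \<lhd> emb C ?c \<rhd> [?a, d, ?a'] = [] \<lhd> ?P \<rhd> [d, ?a']"
      using whisker_eq[OF ev_curry[of ?b ?a p], of "[]" "[d, ?a']"] by simp
    have ii: "[?b] \<lhd> chb X d \<rhd> [] \<bullet> [?b] \<lhd> ?I \<rhd> [] = did C [?b, d, ?a]"
      using whisker_eq[OF hb_inverse(2)[OF center_objD(2)[OF X], of d], of "[?b]" "[]"] by simp
    \<comment> \<open>\<open>comm\<close> precomposed with the inverse crossing of \<open>X\<close>.
      This is the inverse crossing that occurs in the formula for the half-braiding of the
      dual.\<close>
    have "[] \<lhd> ?P \<rhd> [d] \<bullet> [?b] \<lhd> ?I \<rhd> [] = [d] \<lhd> ?P \<rhd> [] \<bullet> [] \<lhd> chb Y d \<rhd> [?a]"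
      unfolding comm[OF that, symmetric] by (simp add: ii)
    from whisker_eq[OF this, of "[]" "[?a']"]
    have 4: "[] \<lhd> ?P \<rhd> [d, ?a'] \<bullet> [?b] \<lhd> ?I \<rhd> [?a'] = [d] \<lhd> ?P \<rhd> [?a'] \<bullet> [] \<lhd> chb Y d \<rhd> [?a, ?a']"
      by simp
    have 5: "[] \<lhd> chb Y d \<rhd> [?a, ?a'] \<bullet> [?b, d] \<lhd> coev_cup ?a \<rhd> [] = [d, ?b] \<lhd> coev_cup ?a \<rhd> [] \<bullet> chb Y d"
      using interchange[of "[]" "chb Y d" "[]" "coev_cup ?a" "[]"] by simp
    show ?thesis
      unfolding hb_center_dual[OF that] dcomp_assoc 1 comp_extend[OF 2] comp_extend[OF 3] comp_extend[OF 4] 5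
      by (simp add: emb_curry)
  qed
  have "half_braiding C ?a' (snd (center_dual C X))"
  proof (rule half_braiding_transport[OF Y _ c iso])
    show "snd (center_dual C X) \<in> extensional (Obj C)"
      by (simp add: center_dual_def Let_def split: prod.splits)
  qed (simp_all add: center_dual_hom *)
  then show D: "center_dual C X \<in> center_obj C"
    by (intro center_objI) simp_all
  show "?c \<in> center_hom Y (center_dual C X)"
    using center_hom_iff[OF Y D, of ?c] c by (simp add: *)
qed

end

end

lemma center_simps [simp]:
  "Obj (center M) = center_obj M" "Arr (center M) = center_arr M" "Src (center M) f = fst f" "Tgt (center M) f = snd (snd f)"
  "ide\<^bsub>center M\<^esub> X = (X, ide\<^bsub>M\<^esub> (fst X), X)"
  "fst (snd (g \<cdot>\<^bsub>center M\<^esub> f)) = fst (snd g) \<cdot>\<^bsub>M\<^esub> fst (snd f)"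
  "fst (g \<cdot>\<^bsub>center M\<^esub> f) = fst f" "snd (snd (g \<cdot>\<^bsub>center M\<^esub> f)) = snd (snd g)"
  "X \<otimes>\<^bsub>center M\<^esub> Y = center_tensor M X Y"
  "fst (snd (g \<odot>\<^bsub>center M\<^esub> f)) = fst (snd g) \<odot>\<^bsub>M\<^esub> fst (snd f)"
  "\<one>\<^bsub>center M\<^esub> = center_unit M"
  "\<a>\<^bsub>center M\<^esub> X Y V = (center_tensor M (center_tensor M X Y) V, \<a>\<^bsub>M\<^esub> (fst X) (fst Y) (fst V),
     center_tensor M X (center_tensor M Y V))"
  "\<l>\<^bsub>center M\<^esub> X = (center_tensor M (center_unit M) X, \<l>\<^bsub>M\<^esub> (fst X), X)"
  "\<r>\<^bsub>center M\<^esub> X = (center_tensor M X (center_unit M), \<r>\<^bsub>M\<^esub> (fst X), X)"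
  "Dual (center M) X = center_dual M X"
  "Ev (center M) X = (center_tensor M (center_dual M X) X, Ev M (fst X), center_unit M)"
  "Coev (center M) X = (center_unit M, Coev M (fst X), center_tensor M X (center_dual M X))"
  "Piv (center M) X = (X, Piv M (fst X), center_dual M (center_dual M X))"
  "\<beta>\<^bsub>center M\<^esub> X Y = (center_tensor M X Y, snd X (fst Y), center_tensor M Y X)"
  by (simp_all add: center_def split: prod.splits)

section \<open>Inverses and curried pairings formed in the center\<close>

context rigid_category
begin

lemma Hom_center:
  "f \<in> Hom (center C) X Y \<longleftrightarrow>
    X \<in> center_obj C \<and> Y \<in> center_obj C \<and> f = (X, fst (snd f), Y) \<and> fst (snd f) \<in> center_hom X Y"
  by (cases f; cases X; cases Y) (auto simp: Hom_def[of "center C"] center_arr_def center_hom_def)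

lemma center_inverse_arrows:
  assumes "f \<in> Hom (center C) X Y" "inverse_arrows (center C) f g"
  shows "inverse_arrows C (fst (snd f)) (fst (snd g))"
proof -
  have g: "g \<in> Hom (center C) Y X"
    using assms by (auto simp: inverse_arrows_def Hom_def[of "center C"])
  have f: "fst f = X" "snd (snd f) = Y"
    using assms(1) by (auto simp: Hom_def)
  have "fst (snd f) \<in> Hom C (fst X) (fst Y)" "fst (snd g) \<in> Hom C (fst Y) (fst X)"
    using assms(1) g by (auto simp: Hom_center center_hom_def)
  moreover have "g \<cdot>\<^bsub>center C\<^esub> f = ide\<^bsub>center C\<^esub> X" "f \<cdot>\<^bsub>center C\<^esub> g = ide\<^bsub>center C\<^esub> Y"
    using assms(2) f by (auto simp: inverse_arrows_def)
  from arg_cong[OF this(1), of "\<lambda>t. fst (snd t)"] arg_cong[OF this(2), of "\<lambda>t. fst (snd t)"]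
  have "fst (snd g) \<cdot> fst (snd f) = ide (fst X)" "fst (snd f) \<cdot> fst (snd g) = ide (fst Y)"
    by simp_all
  ultimately show ?thesis
    by (rule inverse_arrowsI)
qed

lemma center_iso:
  assumes "is_iso (center C) f"
  shows "is_iso C (fst (snd f))"
proof -
  from assms obtain g where g: "inverse_arrows (center C) f g"
    by (auto simp: is_iso_def)
  then have "f \<in> Hom (center C) (fst f) (snd (snd f))"
    by (auto simp: inverse_arrows_def Hom_def)
  then show ?thesis
    unfolding is_iso_def using center_inverse_arrows g by blast
qed

text \<open>An inverse in \<open>center\<close> is a description over tagged triples. Existence
  comes from \<open>center_hom_inv\<close>, uniqueness from the underlying arrows, so the
  description can be evaluated in \<open>M\<close>.\<close>

lemma center_inv_arrow:
  assumes X: "X \<in> center_obj C" and Y: "Y \<in> center_obj C" and f: "f \<in> center_hom X Y" and iso: "is_iso C f"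
  shows "inv_arrow (center C) (X, f, Y) = (Y, f\<^sup>\<inverse>, X)"
  unfolding inv_arrow_def[of "center C"]
proof (rule the_equality)
  have F: "(X, f, Y) \<in> Hom (center C) X Y"
    using X Y f by (simp add: Hom_center)
  have G: "(Y, f\<^sup>\<inverse>, X) \<in> Hom (center C) Y X"
    using X Y center_hom_inv[OF f X Y iso] by (simp add: Hom_center)
  have "f \<in> Hom C (fst X) (fst Y)"
    using f by (simp add: center_hom_def)
  then show "inverse_arrows (center C) (X, f, Y) (Y, f\<^sup>\<inverse>, X)"
    using F G iso HomD[of f "fst X" "fst Y"]
    by (simp add: inverse_arrows_def[of "center C"] prod_eq_iff Hom_def[of "center C"])
  fix h
  assume h: "inverse_arrows (center C) (X, f, Y) h"
  then have "h \<in> Hom (center C) Y X"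
    by (simp add: inverse_arrows_def)
  then have "h = (Y, fst (snd h), X)"
    by (simp add: Hom_center)
  moreover have "fst (snd h) = f\<^sup>\<inverse>"
    using center_inverse_arrows[OF F h] inv_arrow_eq by auto
  ultimately show "h = (Y, f\<^sup>\<inverse>, X)"
    by simp
qed

text \<open>The delicate ingredients of a curried pairing are the inverses of an associator and of a
  right unitor. They can be evaluated once the dual of \<open>V\<close> and the unit are objects of
  the center.\<close>

lemma curry_pairing_center:
  assumes U: "U \<in> center_obj C" and V: "V \<in> center_obj C" and V': "center_dual C V \<in> center_obj C"
    and I: "center_unit C \<in> center_obj C"
  shows "curry_pairing (center C) U V p = (U, curry_pairing C (fst U) (fst V) (fst (snd p)), center_dual C V)"
proof -
  let ?V = "center_dual C V"
  have a: "inv_arrow (center C) (\<a>\<^bsub>center C\<^esub> U V ?V)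
     = (center_tensor C U (center_tensor C V ?V), (\<a> (fst U) (fst V) (fst ?V))\<^sup>\<inverse>, center_tensor C (center_tensor C U V) ?V)"
    unfolding center_simps using U V V'
    by (intro center_inv_arrow center_assoc center_tensor_obj) simp_all
  have r: "inv_arrow (center C) (\<r>\<^bsub>center C\<^esub> U) = (U, (\<r> (fst U))\<^sup>\<inverse>, center_tensor C U (center_unit C))"
    unfolding center_simps using U I
    by (intro center_inv_arrow center_runit center_tensor_obj) simp_all
  show ?thesis
    unfolding curry_pairing_def[of "center C"] curry_pairing_def[of C] center_simps(15)
    by (rule prod_eqI; (rule prod_eqI)?)
      (simp_all only: fst_conv snd_conv center_simps(6-8,10) a r, simp_all)
qed

end

section \<open>Central functors\<close>

lemma underlying_simps [simp]:
  "OMap (underlying M Z) a = fst (OMap Z a)" "AMap (underlying M Z) f = fst (snd (AMap Z f))"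
  "Ten (underlying M Z) a b = fst (snd (Ten Z a b)) \<cdot>\<^bsub>M\<^esub> ide\<^bsub>M\<^esub> (fst (OMap Z a) \<otimes>\<^bsub>M\<^esub> fst (OMap Z b))"
  "Uni (underlying M Z) = fst (snd (Uni Z)) \<cdot>\<^bsub>M\<^esub> ide\<^bsub>M\<^esub> \<one>\<^bsub>M\<^esub>"
  by (simp_all add: underlying_def comp_tfun_def forgetful_def case_prod_unfold)

locale central_functor =
  C: braided_pivotal_category C + M: pivotal_category M + Z: braided_pivotal_functor C "center M" Z
  for C :: "('o, 'm, 'u) bpivcat_scheme" and M :: "('p, 'n, 'v) pivcat_scheme" (structure)
    and Z :: "('o, 'm, 'p \<times> ('p \<Rightarrow> 'n), ('p \<times> ('p \<Rightarrow> 'n)) \<times> 'n \<times> ('p \<times> ('p \<Rightarrow> 'n))) tfun"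
begin

abbreviation \<Phi> where "\<Phi> \<equiv> underlying M Z"

lemma center_obj_Z [simp]: "a \<in> Obj C \<Longrightarrow> OMap Z a \<in> center_obj M"
  using Z.omap by simp

lemma AMap_Z:
  assumes "f \<in> Hom C a b"
  shows "AMap Z f = (OMap Z a, AMap \<Phi> f, OMap Z b)" "AMap \<Phi> f \<in> M.center_hom (OMap Z a) (OMap Z b)"
  using Z.amap[OF assms] M.Hom_center by auto

lemma Ten_Z:
  assumes [simp]: "a \<in> Obj C" "b \<in> Obj C"
  shows "Ten \<Phi> a b = fst (snd (Ten Z a b))"
    "fst (snd (Ten Z a b)) \<in> M.center_hom (center_tensor M (OMap Z a) (OMap Z b)) (OMap Z (a \<otimes>\<^bsub>C\<^esub> b))"
    "Ten Z a b = (center_tensor M (OMap Z a) (OMap Z b), fst (snd (Ten Z a b)), OMap Z (a \<otimes>\<^bsub>C\<^esub> b))"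
proof -
  show *: "fst (snd (Ten Z a b)) \<in> M.center_hom (center_tensor M (OMap Z a) (OMap Z b)) (OMap Z (a \<otimes>\<^bsub>C\<^esub> b))"
   and "Ten Z a b = (center_tensor M (OMap Z a) (OMap Z b), fst (snd (Ten Z a b)), OMap Z (a \<otimes>\<^bsub>C\<^esub> b))"
    using Z.ten_hom[OF assms] by (auto simp: M.Hom_center)
  show "Ten \<Phi> a b = fst (snd (Ten Z a b))"
    using * by (auto simp: M.center_hom_def intro: M.comp_ide_right)
qed

lemma Uni_Z:
  shows "Uni \<Phi> = fst (snd (Uni Z))"
    "fst (snd (Uni Z)) \<in> M.center_hom (center_unit M) (OMap Z \<one>\<^bsub>C\<^esub>)"
    "Uni Z = (center_unit M, fst (snd (Uni Z)), OMap Z \<one>\<^bsub>C\<^esub>)"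
    "center_unit M \<in> center_obj M"
proof -
  show *: "fst (snd (Uni Z)) \<in> M.center_hom (center_unit M) (OMap Z \<one>\<^bsub>C\<^esub>)"
    and "Uni Z = (center_unit M, fst (snd (Uni Z)), OMap Z \<one>\<^bsub>C\<^esub>)" "center_unit M \<in> center_obj M"
    using Z.uni_hom by (auto simp: M.Hom_center)
  show "Uni \<Phi> = fst (snd (Uni Z))"
    using * by (auto simp: M.center_hom_def intro: M.comp_ide_right)
qed

text \<open>The tensor product and composition of the center act on underlying arrows as in
  \<open>M\<close>, so each axiom is the projection of the same axiom for \<open>Z\<close>.\<close>

lemma tensor_functor_underlying: "tensor_functor C M \<Phi>"
proof
  note [simp] = Ten_Z(1) Uni_Z(1) and [simp del] = underlying_simps(3,4)
  show "a \<in> Obj C \<Longrightarrow> OMap \<Phi> a \<in> Obj M" for a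
    by simp
  show "f \<in> Hom C a b \<Longrightarrow> AMap \<Phi> f \<in> Hom M (OMap \<Phi> a) (OMap \<Phi> b)" for f a b
    using AMap_Z(2)[of f a b] by (simp add: M.center_hom_def)
  show "a \<in> Obj C \<Longrightarrow> AMap \<Phi> (ide\<^bsub>C\<^esub> a) = ide (OMap \<Phi> a)" for a
    using Z.map_ide[of a] by simp
  show "\<lbrakk>f \<in> Hom C a b; g \<in> Hom C b c\<rbrakk> \<Longrightarrow> AMap \<Phi> (g \<cdot>\<^bsub>C\<^esub> f) = AMap \<Phi> g \<cdot> AMap \<Phi> f" for f g a b c
    using Z.map_comp[of f a b g c] by simp
  show "\<lbrakk>a \<in> Obj C; b \<in> Obj C\<rbrakk> \<Longrightarrow> Ten \<Phi> a b \<in> Hom M (OMap \<Phi> a \<otimes> OMap \<Phi> b) (OMap \<Phi> (a \<otimes>\<^bsub>C\<^esub> b))" for a b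
    using Ten_Z(2)[of a b] by (simp add: M.center_hom_def)
  show "\<lbrakk>a \<in> Obj C; b \<in> Obj C\<rbrakk> \<Longrightarrow> is_iso M (Ten \<Phi> a b)" for a b
    using Z.ten_iso[of a b] M.center_iso by simp
  show "\<lbrakk>f \<in> Hom C a a'; g \<in> Hom C b b'\<rbrakk>
      \<Longrightarrow> Ten \<Phi> a' b' \<cdot> (AMap \<Phi> f \<odot> AMap \<Phi> g) = AMap \<Phi> (f \<odot>\<^bsub>C\<^esub> g) \<cdot> Ten \<Phi> a b" for f g a a' b b'
    using arg_cong[OF Z.ten_natural[of f a a' g b b'], of "\<lambda>t. fst (snd t)"]
      C.Hom_obj[of f a a'] C.Hom_obj[of g b b'] by simp
  show "Uni \<Phi> \<in> Hom M \<one> (OMap \<Phi> \<one>\<^bsub>C\<^esub>)"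
    using Uni_Z(2) by (simp add: M.center_hom_def)
  show "is_iso M (Uni \<Phi>)"
    using Z.uni_iso M.center_iso by simp
  show "\<lbrakk>a \<in> Obj C; b \<in> Obj C; c \<in> Obj C\<rbrakk>
      \<Longrightarrow> AMap \<Phi> (\<a>\<^bsub>C\<^esub> a b c) \<cdot> Ten \<Phi> (a \<otimes>\<^bsub>C\<^esub> b) c \<cdot> (Ten \<Phi> a b \<odot> ide (OMap \<Phi> c))
         = Ten \<Phi> a (b \<otimes>\<^bsub>C\<^esub> c) \<cdot> (ide (OMap \<Phi> a) \<odot> Ten \<Phi> b c) \<cdot> \<a> (OMap \<Phi> a) (OMap \<Phi> b) (OMap \<Phi> c)" for a b c
    using arg_cong[OF Z.ten_assoc[of a b c], of "\<lambda>t. fst (snd t)"] by simp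
  show "a \<in> Obj C \<Longrightarrow> AMap \<Phi> (\<l>\<^bsub>C\<^esub> a) \<cdot> Ten \<Phi> \<one>\<^bsub>C\<^esub> a \<cdot> (Uni \<Phi> \<odot> ide (OMap \<Phi> a)) = \<l> (OMap \<Phi> a)" for a
    using arg_cong[OF Z.ten_lunit[of a], of "\<lambda>t. fst (snd t)"] by simp
  show "a \<in> Obj C \<Longrightarrow> AMap \<Phi> (\<r>\<^bsub>C\<^esub> a) \<cdot> Ten \<Phi> a \<one>\<^bsub>C\<^esub> \<cdot> (ide (OMap \<Phi> a) \<odot> Uni \<Phi>) = \<r> (OMap \<Phi> a)" for a
    using arg_cong[OF Z.ten_runit[of a], of "\<lambda>t. fst (snd t)"] by simp
qed

sublocale F: tensor_functor C M \<Phi>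
  by (rule tensor_functor_underlying)

sublocale F: rigid_functor C M \<Phi>
  by unfold_locales

section \<open>Crossings and duals of objects in the image of \<open>Z\<close>\<close>

abbreviation (input) zhb where "zhb c b \<equiv> hb M (OMap \<Phi> c) (snd (OMap Z c)) b"

lemma zhb_simps [simp]:
  assumes "c \<in> Obj C" "b \<in> Obj M"
  shows "diag M (zhb c b)" "dsrc (zhb c b) = [OMap \<Phi> c, b]" "dtgt (zhb c b) = [b, OMap \<Phi> c]"
  using M.chb_simps[OF center_obj_Z[OF assms(1)] assms(2)] by simp_all

declare underlying_simps [simp del]

lemma zhb_natural:
  assumes f: "f \<in> Hom C c d" and b: "b \<in> Obj M"
  shows "zhb d b \<bullet> [] \<lhd> F.femb f \<rhd> [b] = [b] \<lhd> F.femb f \<rhd> [] \<bullet> zhb c b"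
  using M.center_homD(2)[OF AMap_Z(2)[OF f] _ _ b] C.Hom_obj[OF f]
  by (simp add: F.femb_def underlying_simps(1))

text \<open>\<open>Ten Z\<close> is an arrow of the center and therefore carries the half-braiding
  of the tensor product, two successive crossings, to that of the image of
  \<open>u \<otimes> v\<close>.\<close>

lemma zhb_fmerge:
  assumes [simp]: "u \<in> Obj C" "v \<in> Obj C" "b \<in> Obj M"
  shows "zhb (u \<otimes>\<^bsub>C\<^esub> v) b \<bullet> [] \<lhd> F.fmerge u v \<rhd> [b]
    = [b] \<lhd> F.fmerge u v \<rhd> [] \<bullet> [] \<lhd> zhb u b \<rhd> [OMap \<Phi> v] \<bullet> [OMap \<Phi> u] \<lhd> zhb v b \<rhd> []"
proof -
  let ?u = "OMap Z u" and ?v = "OMap Z v"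
  have t: "center_tensor M ?u ?v \<in> center_obj M"
    by (rule M.center_tensor_obj) simp_all
  note [simp] = underlying_simps(1)
  have 1: "zhb (u \<otimes>\<^bsub>C\<^esub> v) b \<bullet> [] \<lhd> emb M (Ten \<Phi> u v) \<rhd> [b]
      = [b] \<lhd> emb M (Ten \<Phi> u v) \<rhd> [] \<bullet> M.chb (center_tensor M ?u ?v) b"
    using M.center_homD(2)[OF Ten_Z(2)[of u v] t, of b] by (simp add: Ten_Z(1))
  show ?thesis
    using M.hb_center_tensor[of ?u ?v b]
    by (simp add: F.fmerge_def M.comp_extend[OF 1[simplified]])
qed

lemma zhb_fcreate:
  assumes [simp]: "b \<in> Obj M"
  shows "zhb \<one>\<^bsub>C\<^esub> b \<bullet> [] \<lhd> F.fcreate \<rhd> [b] = [b] \<lhd> F.fcreate \<rhd> []"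
proof -
  note [simp] = underlying_simps(1)
  have 1: "zhb \<one>\<^bsub>C\<^esub> b \<bullet> [] \<lhd> emb M (Uni \<Phi>) \<rhd> [b] = [b] \<lhd> emb M (Uni \<Phi>) \<rhd> [] \<bullet> M.chb (center_unit M) b"
    using M.center_homD(2)[OF Uni_Z(2,4), of b] by (simp add: Uni_Z(1))
  show ?thesis
    using M.hb_center_unit[of b] by (simp add: F.fcreate_def M.comp_extend[OF 1[simplified]])
qed

text \<open>The image of a pairing is an arrow of the center into the unit, and the crossing with
  the unit is trivial.\<close>

lemma zhb_fcap:
  assumes [simp]: "u \<in> Obj C" "v \<in> Obj C" and p: "p \<in> Hom C (u \<otimes>\<^bsub>C\<^esub> v) \<one>\<^bsub>C\<^esub>" and [simp]: "b \<in> Obj M"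
  shows "[b] \<lhd> F.fcap u v p \<rhd> [] \<bullet> [] \<lhd> zhb u b \<rhd> [OMap \<Phi> v] \<bullet> [OMap \<Phi> u] \<lhd> zhb v b \<rhd> []
    = [] \<lhd> F.fcap u v p \<rhd> [b]"
proof -
  note [simp] = C.HomD[OF p]
  have e: "[b] \<lhd> F.ferase \<rhd> [] \<bullet> zhb \<one>\<^bsub>C\<^esub> b = [] \<lhd> F.ferase \<rhd> [b]"
    using arg_cong[OF zhb_fcreate[of b], of "\<lambda>t. [b] \<lhd> F.ferase \<rhd> [] \<bullet> t \<bullet> [] \<lhd> F.ferase \<rhd> [b]"] by simp
  have "[b] \<lhd> F.fcap u v p \<rhd> [] \<bullet> [] \<lhd> zhb u b \<rhd> [OMap \<Phi> v] \<bullet> [OMap \<Phi> u] \<lhd> zhb v b \<rhd> []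
     = [b] \<lhd> F.ferase \<rhd> [] \<bullet> ([b] \<lhd> F.femb p \<rhd> [] \<bullet> zhb (u \<otimes>\<^bsub>C\<^esub> v) b) \<bullet> [] \<lhd> F.fmerge u v \<rhd> [b]"
    by (simp add: F.fcap_def zhb_fmerge)
  also have "\<dots> = [] \<lhd> F.fcap u v p \<rhd> [b]"
    unfolding zhb_natural[OF p, symmetric, OF assms(4)] by (simp add: M.comp_extend[OF e] F.fcap_def)
  finally show ?thesis .
qed

text \<open>The image of the evaluation of \<open>d\<close> is a nondegenerate pairing compatible
  with half-braidings by \<open>zhb_fcap\<close>, so \<open>center_dual_pairing\<close> applies with
  \<open>Z\<close> at the dual of \<open>d\<close> as partner.\<close>

lemma dual_comparison_center:
  assumes [simp]: "d \<in> Obj C"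
  shows "center_dual M (OMap Z d) \<in> center_obj M"
    "dual_comparison C M \<Phi> d \<in> M.center_hom (OMap Z (Dual C d)) (center_dual M (OMap Z d))"
proof -
  note [simp] = underlying_simps(1)
  note p = F.fev_eq[OF assms]
  have iso: "is_iso M (dual_comparison C M \<Phi> d)"
    by (rule F.dual_comparison_iso) simp
  show "center_dual M (OMap Z d) \<in> center_obj M"
    by (rule M.center_dual_pairing(1)[where Y = "OMap Z (Dual C d)"])
      (use p iso zhb_fcap[of "Dual C d" d "Ev C d"] C.ev_hom[of d] in \<open>simp_all add: dual_comparison_def\<close>)
  show "dual_comparison C M \<Phi> d \<in> M.center_hom (OMap Z (Dual C d)) (center_dual M (OMap Z d))"
    unfolding dual_comparison_def underlying_simps(1)
    by (rule M.center_dual_pairing(2))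
      (use p iso zhb_fcap[of "Dual C d" d "Ev C d"] C.ev_hom[of d] in \<open>simp_all add: dual_comparison_def\<close>)
qed

text \<open>The center dual of \<open>Z d\<close> is only isomorphic, through the comparison
  \<open>?g\<close>, to the value of \<open>Z\<close> at the dual of \<open>d\<close>. A pairing
  with it is obtained by moving the image of the evaluation of the dual of \<open>d\<close> along
  this isomorphism.\<close>

lemma center_double_dual:
  assumes [simp]: "d \<in> Obj C"
  shows "center_dual M (center_dual M (OMap Z d)) \<in> center_obj M"
proof -
  let ?X = "center_dual M (OMap Z d)" and ?d = "Dual C d" and ?dd = "Dual C (Dual C d)"
  let ?g = "dual_comparison C M \<Phi> d" and ?w = "OMap \<Phi> d"
  let ?v = "Dual M ?w" and ?u = "OMap \<Phi> ?dd" and ?s = "OMap \<Phi> ?d"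
  let ?h = "?g\<^sup>\<inverse>"
  have fst [simp]: "fst (OMap Z c) = OMap \<Phi> c" for c
    by (simp add: underlying_simps(1))
  note X [simp] = dual_comparison_center(1)[OF assms]
  note g = F.dual_comparison_hom[OF assms]
  have iso [simp]: "is_iso M ?g"
    by (rule F.dual_comparison_iso) simp
  note h = M.inv_hom[OF iso g]
  have hc: "?h \<in> M.center_hom ?X (OMap Z ?d)"
    by (rule M.center_hom_inv[OF dual_comparison_center(2)[OF assms]]) simp_all
  note [simp] = M.HomD[OF g] M.HomD[OF h]
  define p where "p = (Uni \<Phi>)\<^sup>\<inverse> \<cdot> AMap \<Phi> (Ev C ?d) \<cdot> Ten \<Phi> ?dd ?d"
  define q where "q = (Ten \<Phi> ?d ?dd)\<^sup>\<inverse> \<cdot> AMap \<Phi> (Coev C ?d) \<cdot> Uni \<Phi>"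
  have p: "p \<in> Hom M (?u \<otimes> ?s) \<one>" "F.fev ?d = cap M ?u ?s p"
    and q: "q \<in> Hom M \<one> (?s \<otimes> ?u)" "F.fcoev ?d = cup M ?s ?u q"
    unfolding p_def q_def using F.fev_eq[of ?d] F.fcoev_eq[of ?d] by simp_all
  \<comment> \<open>The images of evaluation and coevaluation for the dual of \<open>d\<close>, with
    one leg moved along \<open>?h\<close> and \<open>?g\<close>; they stay inverse to each other
    because \<open>?h\<close> and \<open>?g\<close> cancel.\<close>
  let ?p = "p \<cdot> (ide ?u \<odot> ?h)" and ?q = "(?g \<odot> ide ?u) \<cdot> q"
  note [simp] = M.HomD[OF p(1)] M.HomD[OF q(1)]
  have p': "?p \<in> Hom M (?u \<otimes> ?v) \<one>" and q': "?q \<in> Hom M \<one> (?v \<otimes> ?u)"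
    by (auto intro!: M.HomI)
  have P: "cap M ?u ?v ?p = F.fev ?d \<bullet> [?u] \<lhd> emb M ?h \<rhd> []"
    using M.cap_comp_tensor[OF p(1), of "ide ?u" ?u ?h ?v] p(2) h by (simp add: M.ide_hom M.emb_ide)
  have Q: "cup M ?v ?u ?q = [] \<lhd> emb M ?g \<rhd> [?u] \<bullet> F.fcoev ?d"
    unfolding q(2) by (simp add: cup_def M.emb_simps)
  have hg: "xs \<lhd> emb M ?h \<rhd> ys \<bullet> xs \<lhd> emb M ?g \<rhd> ys = did M (xs @ ?s # ys)"
    if "set xs \<subseteq> Obj M" "set ys \<subseteq> Obj M" for xs ys
    using M.whisker_eq[OF M.emb_inv_cancel(1)[OF iso], of xs ys] that by simp
  have gh: "emb M ?g \<bullet> emb M ?h = did M [?v]"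
    using M.emb_inv_cancel(2)[OF iso] by simp
  have z1: "[?v] \<lhd> cap M ?u ?v ?p \<rhd> [] \<bullet> [] \<lhd> cup M ?v ?u ?q \<rhd> [?v] = did M [?v]"
  proof -
    have 1: "[?v, ?u] \<lhd> emb M ?h \<rhd> [] \<bullet> [] \<lhd> emb M ?g \<rhd> [?u, ?v] = [] \<lhd> emb M ?g \<rhd> [?u, ?s] \<bullet> [?s, ?u] \<lhd> emb M ?h \<rhd> []"
      using M.interchange[of "[]" "emb M ?g" "[?u]" "emb M ?h" "[]"] by simp
    have 2: "[?s, ?u] \<lhd> emb M ?h \<rhd> [] \<bullet> [] \<lhd> F.fcoev ?d \<rhd> [?v] = [] \<lhd> F.fcoev ?d \<rhd> [?s] \<bullet> emb M ?h"
      using M.interchange[of "[]" "F.fcoev ?d" "[]" "emb M ?h" "[]"] by simp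
    have 3: "[?v] \<lhd> F.fev ?d \<rhd> [] \<bullet> [] \<lhd> emb M ?g \<rhd> [?u, ?s] = emb M ?g \<bullet> [?s] \<lhd> F.fev ?d \<rhd> []"
      using M.interchange[of "[]" "emb M ?g" "[]" "F.fev ?d" "[]"] by simp
    show ?thesis
      unfolding P Q
      by (simp add: M.comp_extend[OF 1] 2 M.comp_extend[OF 3] M.comp_extend[OF F.fzigzag(1)] gh)
  qed
  have z2: "[] \<lhd> cap M ?u ?v ?p \<rhd> [?u] \<bullet> [?u] \<lhd> cup M ?v ?u ?q \<rhd> [] = did M [?u]"
    unfolding P Q by (simp add: M.comp_extend[OF hg] F.fzigzag(2))
  have c: "[b] \<lhd> cap M ?u ?v ?p \<rhd> [] \<bullet> [] \<lhd> zhb ?dd b \<rhd> [?v] \<bullet> [?u] \<lhd> M.chb ?X b \<rhd> []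
      = [] \<lhd> cap M ?u ?v ?p \<rhd> [b]" if [simp]: "b \<in> Obj M" for b
  proof -
    have [simp]: "diag M (M.chb ?X b)" "dsrc (M.chb ?X b) = [?v, b]" "dtgt (M.chb ?X b) = [b, ?v]"
      using M.chb_simps[OF X that] by simp_all
    have 1: "[b, ?u] \<lhd> emb M ?h \<rhd> [] \<bullet> [] \<lhd> zhb ?dd b \<rhd> [?v] = [] \<lhd> zhb ?dd b \<rhd> [?s] \<bullet> [?u, b] \<lhd> emb M ?h \<rhd> []"
      using M.interchange[of "[]" "zhb ?dd b" "[]" "emb M ?h" "[]"] by simp
    have 2: "[?u, b] \<lhd> emb M ?h \<rhd> [] \<bullet> [?u] \<lhd> M.chb ?X b \<rhd> [] = [?u] \<lhd> zhb ?d b \<rhd> [] \<bullet> [?u] \<lhd> emb M ?h \<rhd> [b]"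
      using M.whisker_eq[OF M.center_homD(2)[OF hc X _ that], of "[?u]" "[]"] by simp
    have 3: "[b] \<lhd> F.fev ?d \<rhd> [] \<bullet> [] \<lhd> zhb ?dd b \<rhd> [?s] \<bullet> [?u] \<lhd> zhb ?d b \<rhd> [] = [] \<lhd> F.fev ?d \<rhd> [b]"
      by (rule zhb_fcap) (simp_all add: C.ev_hom)
    show ?thesis
      unfolding P by (simp add: M.comp_extend[OF 1] 2[simplified] M.comp_extend3[OF 3])
  qed
  have "is_iso M (curry_pairing M ?u ?v ?p)"
    by (rule M.curry_iso[OF _ _ p' q' z1 z2]) simp_all
  then show ?thesis
    by (intro M.center_dual_pairing(1)[OF X, of "OMap Z ?dd" ?p]) (use p' c in simp_all)
qed

lemma dual_comparison_Z:
  assumes [simp]: "d \<in> Obj C"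
  shows "dual_comparison C (center M) Z d = (OMap Z (Dual C d), dual_comparison C M \<Phi> d, center_dual M (OMap Z d))"
proof -
  have u: "inv_arrow (center M) (Uni Z) = (OMap Z \<one>\<^bsub>C\<^esub>, (Uni \<Phi>)\<^sup>\<inverse>, center_unit M)"
    by (subst Uni_Z(3), subst M.center_inv_arrow)
      (use Uni_Z F.uni_iso in simp_all)
  show ?thesis
    unfolding dual_comparison_def[of C "center M"] dual_comparison_def[of C M]
    using M.curry_pairing_center[of "OMap Z (Dual C d)" "OMap Z d"] dual_comparison_center(1)[OF assms] Uni_Z(4)
    by (simp add: u underlying_simps(1,2) Ten_Z(1))
qed

text \<open>The projection of \<open>map_piv\<close> for \<open>Z\<close>. Its right-hand side
  contains an inverse, evaluated by \<open>center_inv_arrow\<close>, and a dual arrow, which is a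
  curried pairing with source the double dual of \<open>Z x\<close>; this is where
  \<open>center_double_dual\<close> enters.\<close>

lemma pivotal_functor_underlying: "pivotal_functor C M \<Phi>"
proof
  fix x assume [simp]: "x \<in> Obj C"
  let ?x = "Dual C x" and ?f = "dual_comparison C (center M) Z x" and ?g = "dual_comparison C M \<Phi> x"
  note [simp] = underlying_simps(1)
  have i: "inv_arrow (center M) (dual_comparison C (center M) Z ?x)
     = (center_dual M (OMap Z ?x), (dual_comparison C M \<Phi> ?x)\<^sup>\<inverse>, OMap Z (Dual C ?x))"
    unfolding dual_comparison_Z[of ?x, OF C.dual_obj'[OF \<open>x \<in> Obj C\<close>]]
    by (rule M.center_inv_arrow) (simp_all add: dual_comparison_center F.dual_comparison_iso)
  have d: "fst (snd (dual_arrow (center M) ?f)) = dual_arrow M ?g"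
    unfolding dual_arrow_def[of "center M"] dual_arrow_def[of M] dual_comparison_Z[OF \<open>x \<in> Obj C\<close>]
    using M.curry_pairing_center[of "center_dual M (center_dual M (OMap Z x))" "OMap Z ?x"]
      dual_comparison_center(1) center_double_dual[of x] Uni_Z(4) M.HomD[OF F.dual_comparison_hom[of x]]
    by simp
  show "AMap \<Phi> (Piv C x) = (dual_comparison C M \<Phi> ?x)\<^sup>\<inverse> \<cdot> dual_arrow M ?g \<cdot> Piv M (OMap \<Phi> x)"
    using arg_cong[OF Z.map_piv[of x], of "\<lambda>t. fst (snd t)"] by (simp add: i d underlying_simps(2))
qed

sublocale F: pivotal_functor C M \<Phi>
  by (rule pivotal_functor_underlying)

sublocale F: braided_source C M \<Phi>
  by unfold_locales

text \<open>The braiding of the center is the half-braiding of its first object, so preservation of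
  braidings by \<open>Z\<close> identifies the crossing of two image strands.\<close>

lemma zhb_braid:
  assumes [simp]: "a \<in> Obj C" "b \<in> Obj C"
  shows "zhb a (OMap \<Phi> b) = F.fsplit b a \<bullet> F.femb (\<beta>\<^bsub>C\<^esub> a b) \<bullet> F.fmerge a b"
proof -
  note [simp] = underlying_simps(1)
  have h: "snd (OMap Z a) (OMap \<Phi> b) \<in> Hom M (OMap \<Phi> a \<otimes> OMap \<Phi> b) (OMap \<Phi> b \<otimes> OMap \<Phi> a)"
    using M.half_braiding_hom[OF M.center_objD(2)[OF center_obj_Z[of a]], of "OMap \<Phi> b"] F.omap[of b] by simp
  note [simp] = M.HomD[OF h, simplified]
  have "AMap \<Phi> (\<beta>\<^bsub>C\<^esub> a b) \<cdot> Ten \<Phi> a b = Ten \<Phi> b a \<cdot> snd (OMap Z a) (OMap \<Phi> b)"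
    using arg_cong[OF Z.map_braid[of a b], of "\<lambda>t. fst (snd t)"] by (simp add: underlying_simps(2) Ten_Z(1))
  from arg_cong[OF this, of "emb M"]
  have *: "F.femb (\<beta>\<^bsub>C\<^esub> a b) \<bullet> emb M (Ten \<Phi> a b) = emb M (Ten \<Phi> b a) \<bullet> emb M (snd (OMap Z a) (OMap \<Phi> b))"
    by (simp add: F.femb_def M.emb_comp)
  have "zhb a (OMap \<Phi> b) = split M (OMap \<Phi> b) (OMap \<Phi> a) \<bullet> emb M ((Ten \<Phi> b a)\<^sup>\<inverse>)
      \<bullet> emb M (Ten \<Phi> b a) \<bullet> emb M (snd (OMap Z a) (OMap \<Phi> b)) \<bullet> merge M (OMap \<Phi> a) (OMap \<Phi> b)"
    by (simp add: hb_def M.comp_extend[OF M.emb_inv_cancel(1)])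
  also have "\<dots> = F.fsplit b a \<bullet> F.femb (\<beta>\<^bsub>C\<^esub> a b) \<bullet> F.fmerge a b"
    by (simp add: F.fsplit_def F.fmerge_def M.comp_extend[OF *])
  finally show ?thesis .
qed

end

section \<open>The traciator and the multiplication maps\<close>

locale central_adjunction = central_functor C M Z + adj: adjunction C M "underlying M Z" Tr \<eta> \<epsilon>
  for C :: "('o, 'm, 'u) bpivcat_scheme" and M :: "('p, 'n, 'v) pivcat_scheme" (structure)
    and Z :: "('o, 'm, 'p \<times> ('p \<Rightarrow> 'n), ('p \<times> ('p \<Rightarrow> 'n)) \<times> 'n \<times> ('p \<times> ('p \<Rightarrow> 'n))) tfun"
    and Tr :: "('p, 'n, 'o, 'm) cfun" and \<eta> :: "'o \<Rightarrow> 'm" and \<epsilon> :: "'p \<Rightarrow> 'n"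
begin

lemma Tr_obj [simp]: "x \<in> Obj M \<Longrightarrow> OMap Tr x \<in> Obj C"
  by (rule adj.T.omap)

lemma counit_arr [simp]:
  assumes "x \<in> Obj M"
  shows "\<epsilon> x \<in> Arr M" "Src M (\<epsilon> x) = OMap \<Phi> (OMap Tr x)" "Tgt M (\<epsilon> x) = x"
  using adj.counit_hom[OF assms] by (auto simp: Hom_def)

lemma unmate:
  assumes g: "g \<in> Hom C c (OMap Tr x)" and x: "x \<in> Obj M"
  shows "AMap Tr (\<epsilon> x \<cdot> AMap \<Phi> g) \<cdot>\<^bsub>C\<^esub> \<eta> c = g"
proof -
  note [simp] = C.Hom_obj[OF g] C.HomD[OF g] x
  note \<Phi>g = F.amap[OF g] and e = adj.counit_hom[OF x]
  have n: "\<eta> c \<in> Hom C c (OMap Tr (OMap \<Phi> c))" "\<eta> (OMap Tr x) \<in> Hom C (OMap Tr x) (OMap Tr (OMap \<Phi> (OMap Tr x)))"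
    by (rule adj.unit_hom; simp)+
  have "AMap Tr (\<epsilon> x \<cdot> AMap \<Phi> g) \<cdot>\<^bsub>C\<^esub> \<eta> c = (AMap Tr (\<epsilon> x) \<cdot>\<^bsub>C\<^esub> AMap Tr (AMap \<Phi> g)) \<cdot>\<^bsub>C\<^esub> \<eta> c"
    using adj.T.map_comp[OF \<Phi>g e] by simp
  also have "\<dots> = AMap Tr (\<epsilon> x) \<cdot>\<^bsub>C\<^esub> (\<eta> (OMap Tr x) \<cdot>\<^bsub>C\<^esub> g)"
    using C.comp_assoc[OF n(1) adj.T.amap[OF \<Phi>g] adj.T.amap[OF e]] adj.unit_natural[OF g] by simp
  also have "\<dots> = (AMap Tr (\<epsilon> x) \<cdot>\<^bsub>C\<^esub> \<eta> (OMap Tr x)) \<cdot>\<^bsub>C\<^esub> g"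
    using C.comp_assoc[OF g n(2) adj.T.amap[OF e]] by simp
  also have "\<dots> = g"
    using adj.triangle_right[OF x] by simp
  finally show ?thesis .
qed

lemma mate_unique:
  assumes "g \<in> Hom C c (OMap Tr x)" "h \<in> Hom C c (OMap Tr x)" "x \<in> Obj M"
    and "\<epsilon> x \<cdot> AMap \<Phi> g = \<epsilon> x \<cdot> AMap \<Phi> h"
  shows "g = h"
  by (rule trans[OF unmate[OF assms(1,3), symmetric] unmate[OF assms(2,3), folded assms(4)]])

text \<open>The transpose \<open>AMap Tr f\<close> after the unit solves the equation in
  \<open>with_mate\<close>, and mates determine their arrows, so the description denotes it.\<close>

lemma with_mate:
  assumes f: "f \<in> Hom M (OMap \<Phi> c) x" and c: "c \<in> Obj C"
  shows "with_mate C M \<Phi> Tr \<epsilon> c x f \<in> Hom C c (OMap Tr x)"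
    "\<epsilon> x \<cdot> AMap \<Phi> (with_mate C M \<Phi> Tr \<epsilon> c x f) = f"
proof -
  let ?g = "AMap Tr f \<cdot>\<^bsub>C\<^esub> \<eta> c"
  note x = M.Hom_obj(2)[OF f] and n = adj.unit_hom[OF c] and Tf = adj.T.amap[OF f]
  note e = adj.counit_hom[OF x] and e' = adj.counit_hom[OF M.Hom_obj(1)[OF f]]
  have g: "?g \<in> Hom C c (OMap Tr x)"
    by (rule C.comp_hom[OF n Tf])
  have "\<epsilon> x \<cdot> AMap \<Phi> ?g = (\<epsilon> x \<cdot> AMap \<Phi> (AMap Tr f)) \<cdot> AMap \<Phi> (\<eta> c)"
    using M.comp_assoc[OF F.amap[OF n] F.amap[OF Tf] e] F.map_comp[OF n Tf] by simp
  also have "\<dots> = f \<cdot> (\<epsilon> (OMap \<Phi> c) \<cdot> AMap \<Phi> (\<eta> c))"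
    using adj.counit_natural[OF f] M.comp_assoc[OF F.amap[OF n] e' f] by simp
  also have "\<dots> = f"
    using adj.triangle_left[OF c] M.HomD[OF f] by simp
  finally have m: "\<epsilon> x \<cdot> AMap \<Phi> ?g = f" .
  have "\<exists>!g. g \<in> Hom C c (OMap Tr x) \<and> \<epsilon> x \<cdot> AMap \<Phi> g = f"
    using g m mate_unique[OF _ _ x] by metis
  from theI'[OF this] show "with_mate C M \<Phi> Tr \<epsilon> c x f \<in> Hom C c (OMap Tr x)"
    "\<epsilon> x \<cdot> AMap \<Phi> (with_mate C M \<Phi> Tr \<epsilon> c x f) = f"
    by (simp_all add: with_mate_def)
qed

section \<open>Rotation of mates and invertibility of the traciator\<close>

abbreviation (input) rot where "rot c \<equiv> rotation M (OMap \<Phi> c) (snd (OMap Z c))"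
abbreviation (input) rot_inv where "rot_inv c \<equiv> M.rotation_inv (OMap \<Phi> c) (snd (OMap Z c))"

lemma half_braiding_Z: "c \<in> Obj C \<Longrightarrow> half_braiding M (OMap \<Phi> c) (snd (OMap Z c))"
  using M.center_objD(2)[OF center_obj_Z] by (simp add: underlying_simps(1))

context
  fixes x y
  assumes [simp]: "x \<in> Obj M" "y \<in> Obj M"
begin

lemma rot_hom: "\<lbrakk>c \<in> Obj C; f \<in> Hom M (OMap \<Phi> c) (x \<otimes> y)\<rbrakk> \<Longrightarrow> rot c x y f \<in> Hom M (OMap \<Phi> c) (y \<otimes> x)"
  by (rule M.rotation_hom[OF half_braiding_Z]) simp_all

text \<open>\<open>Z g\<close> is an arrow of the center, so the image of \<open>g\<close> slides
  through the crossing. This is what allows the traciator, defined by the rotation of one counit, to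
  be computed on any arrow into \<open>Tr (x \<otimes> y)\<close>.\<close>

lemma rot_natural:
  assumes g: "g \<in> Hom C c d" and f: "f \<in> Hom M (OMap \<Phi> d) (x \<otimes> y)"
  shows "rot d x y f \<cdot> AMap \<Phi> g = rot c x y (f \<cdot> AMap \<Phi> g)"
proof -
  note [simp] = C.Hom_obj[OF g] C.HomD[OF g] M.HomD[OF f]
  have r: "rot d x y f \<in> Hom M (OMap \<Phi> d) (y \<otimes> x)"
    by (rule rot_hom) (simp_all add: f)
  have fg: "f \<cdot> AMap \<Phi> g \<in> Hom M (OMap \<Phi> c) (x \<otimes> y)"
    by (auto intro!: M.HomI)
  have r': "rot c x y (f \<cdot> AMap \<Phi> g) \<in> Hom M (OMap \<Phi> c) (y \<otimes> x)"
    by (rule rot_hom[OF _ fg]) simp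
  note [simp] = M.HomD[OF r] M.HomD[OF r']
  let ?y = "Dual M y"
  have 1: "[OMap \<Phi> d] \<lhd> M.coev_cup y \<rhd> [] \<bullet> F.femb g = [] \<lhd> F.femb g \<rhd> [y, ?y] \<bullet> [OMap \<Phi> c] \<lhd> M.coev_cup y \<rhd> []"
    using M.interchange[of "[]" "F.femb g" "[]" "M.coev_cup y" "[]"] by simp
  have 2: "[] \<lhd> zhb d y \<rhd> [?y] \<bullet> [] \<lhd> F.femb g \<rhd> [y, ?y] = [y] \<lhd> F.femb g \<rhd> [?y] \<bullet> [] \<lhd> zhb c y \<rhd> [?y]"
    using M.whisker_eq[OF zhb_natural[OF g, of y], of "[]" "[?y]"] by simp
  have eg: "emb M (AMap \<Phi> g) = F.femb g"
    by (simp add: F.femb_def)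
  show ?thesis
  proof (rule M.emb_faithful)
    show "emb M (rot d x y f \<cdot> AMap \<Phi> g) = emb M (rot c x y (f \<cdot> AMap \<Phi> g))"
      by (simp add: M.emb_comp eg M.emb_rotation[OF half_braiding_Z _ _ _ f] M.emb_rotation[OF half_braiding_Z _ _ _ fg]
        1 M.comp_extend[OF 2])
  qed simp_all
qed

lemma counit_tensor_hom: "\<epsilon> (x \<otimes> y) \<in> Hom M (OMap \<Phi> (OMap Tr (x \<otimes> y))) (x \<otimes> y)"
  by (rule adj.counit_hom) simp

lemma traciator_mate:
  "traciator C M Z Tr \<epsilon> x y \<in> Hom C (OMap Tr (x \<otimes> y)) (OMap Tr (y \<otimes> x))"
  "\<epsilon> (y \<otimes> x) \<cdot> AMap \<Phi> (traciator C M Z Tr \<epsilon> x y) = rot (OMap Tr (x \<otimes> y)) x y (\<epsilon> (x \<otimes> y))"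
proof -
  let ?c = "OMap Tr (x \<otimes> y)"
  have t: "traciator C M Z Tr \<epsilon> x y = with_mate C M \<Phi> Tr \<epsilon> ?c (y \<otimes> x) (rot ?c x y (\<epsilon> (x \<otimes> y)))"
    by (simp add: traciator_def rotation_def Let_def)
  have r: "rot ?c x y (\<epsilon> (x \<otimes> y)) \<in> Hom M (OMap \<Phi> ?c) (y \<otimes> x)"
    by (rule rot_hom[OF _ counit_tensor_hom]) simp
  show "traciator C M Z Tr \<epsilon> x y \<in> Hom C ?c (OMap Tr (y \<otimes> x))"
    "\<epsilon> (y \<otimes> x) \<cdot> AMap \<Phi> (traciator C M Z Tr \<epsilon> x y) = rot ?c x y (\<epsilon> (x \<otimes> y))"
    unfolding t by (rule with_mate[OF r]; simp)+
qed

text \<open>A Yoneda argument: rotation is a bijection natural in \<open>c\<close>, and arrows into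
  \<open>Tr\<close> correspond to their mates, so the mate of the inversely rotated counit is a
  two-sided inverse.\<close>

lemma traciator_iso: "is_iso C (traciator C M Z Tr \<epsilon> x y)"
proof -
  let ?c = "OMap Tr (x \<otimes> y)" and ?d = "OMap Tr (y \<otimes> x)" and ?t = "traciator C M Z Tr \<epsilon> x y"
  \<comment> \<open>The arrow whose rotation is the counit at \<open>y \<otimes> x\<close>; it is
    the mate of the inverse \<open>s\<close>.\<close>
  let ?u = "rot_inv ?d x y (\<epsilon> (y \<otimes> x))"
  have e: "\<epsilon> (y \<otimes> x) \<in> Hom M (OMap \<Phi> ?d) (y \<otimes> x)"
    by (rule adj.counit_hom) simp
  note e' = counit_tensor_hom
  have u: "?u \<in> Hom M (OMap \<Phi> ?d) (x \<otimes> y)"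
    by (rule M.rotation_inv_hom[OF half_braiding_Z _ _ _ e]) simp_all
  have ru: "rot ?d x y ?u = \<epsilon> (y \<otimes> x)"
    by (rule M.rotation_rotation_inv[OF half_braiding_Z _ _ _ e]) simp_all
  define s where "s = with_mate C M \<Phi> Tr \<epsilon> ?d (x \<otimes> y) ?u"
  have s: "s \<in> Hom C ?d ?c" "\<epsilon> (x \<otimes> y) \<cdot> AMap \<Phi> s = ?u"
    unfolding s_def by (rule with_mate[OF u]; simp)+
  note t = traciator_mate
  note \<Phi>s = F.amap[OF s(1)] and \<Phi>t = F.amap[OF t(1)]
  have ts: "?t \<cdot>\<^bsub>C\<^esub> s = ide\<^bsub>C\<^esub> ?d"
  proof (rule mate_unique)
    have "\<epsilon> (y \<otimes> x) \<cdot> AMap \<Phi> (?t \<cdot>\<^bsub>C\<^esub> s) = rot ?c x y (\<epsilon> (x \<otimes> y)) \<cdot> AMap \<Phi> s"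
      using F.map_comp[OF s(1) t(1)] M.comp_assoc[OF \<Phi>s \<Phi>t e] t(2) by simp
    also have "\<dots> = \<epsilon> (y \<otimes> x)"
      using rot_natural[OF s(1) e'] s(2) ru by simp
    finally show "\<epsilon> (y \<otimes> x) \<cdot> AMap \<Phi> (?t \<cdot>\<^bsub>C\<^esub> s) = \<epsilon> (y \<otimes> x) \<cdot> AMap \<Phi> (ide\<^bsub>C\<^esub> ?d)"
      by (simp add: F.map_ide)
  qed (rule C.comp_hom[OF s(1) t(1)], rule C.ide_hom, simp_all)
  have st: "s \<cdot>\<^bsub>C\<^esub> ?t = ide\<^bsub>C\<^esub> ?c"
  proof (rule mate_unique)
    have ut: "?u \<cdot> AMap \<Phi> ?t \<in> Hom M (OMap \<Phi> ?c) (x \<otimes> y)"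
      by (rule M.comp_hom[OF \<Phi>t u])
    have "rot ?c x y (?u \<cdot> AMap \<Phi> ?t) = rot ?c x y (\<epsilon> (x \<otimes> y))"
      using rot_natural[OF t(1) u] ru t(2) by simp
    then have "rot_inv ?c x y (rot ?c x y (?u \<cdot> AMap \<Phi> ?t)) = rot_inv ?c x y (rot ?c x y (\<epsilon> (x \<otimes> y)))"
      by simp
    then have "?u \<cdot> AMap \<Phi> ?t = \<epsilon> (x \<otimes> y)"
      using M.rotation_inv_rotation[OF half_braiding_Z _ _ _ ut] M.rotation_inv_rotation[OF half_braiding_Z _ _ _ e'] by simp
    then show "\<epsilon> (x \<otimes> y) \<cdot> AMap \<Phi> (s \<cdot>\<^bsub>C\<^esub> ?t) = \<epsilon> (x \<otimes> y) \<cdot> AMap \<Phi> (ide\<^bsub>C\<^esub> ?c)"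
      using F.map_comp[OF t(1) s(1)] M.comp_assoc[OF \<Phi>t \<Phi>s e'] s(2) by (simp add: F.map_ide)
  qed (rule C.comp_hom[OF t(1) s(1)], rule C.ide_hom, simp_all)
  show ?thesis
    by (rule C.is_isoI[OF t(1) s(1) st ts])
qed

lemma mult_map_mate:
  "mult_map C M Z Tr \<epsilon> x y \<in> Hom C (OMap Tr x \<otimes>\<^bsub>C\<^esub> OMap Tr y) (OMap Tr (x \<otimes> y))"
  "\<epsilon> (x \<otimes> y) \<cdot> AMap \<Phi> (mult_map C M Z Tr \<epsilon> x y) = (\<epsilon> x \<odot> \<epsilon> y) \<cdot> (Ten \<Phi> (OMap Tr x) (OMap Tr y))\<^sup>\<inverse>"
proof -
  have m: "(\<epsilon> x \<odot> \<epsilon> y) \<cdot> (Ten \<Phi> (OMap Tr x) (OMap Tr y))\<^sup>\<inverse>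
      \<in> Hom M (OMap \<Phi> (OMap Tr x \<otimes>\<^bsub>C\<^esub> OMap Tr y)) (x \<otimes> y)"
    by (auto intro!: M.HomI)
  show "mult_map C M Z Tr \<epsilon> x y \<in> Hom C (OMap Tr x \<otimes>\<^bsub>C\<^esub> OMap Tr y) (OMap Tr (x \<otimes> y))"
    "\<epsilon> (x \<otimes> y) \<cdot> AMap \<Phi> (mult_map C M Z Tr \<epsilon> x y) = (\<epsilon> x \<odot> \<epsilon> y) \<cdot> (Ten \<Phi> (OMap Tr x) (OMap Tr y))\<^sup>\<inverse>"
    unfolding mult_map_def by (rule with_mate[OF m]; simp)+
qed

lemma emb_counits:
  "emb M ((\<epsilon> x \<odot> \<epsilon> y) \<cdot> (Ten \<Phi> (OMap Tr x) (OMap Tr y))\<^sup>\<inverse>) = merge M x y \<bullet> [] \<lhd> emb M (\<epsilon> x) \<rhd> [y] \<bullet>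
     [OMap \<Phi> (OMap Tr x)] \<lhd> emb M (\<epsilon> y) \<rhd> [] \<bullet> F.fsplit (OMap Tr x) (OMap Tr y)"
  by (simp add: M.emb_simps F.fsplit_def)

end

section \<open>The two exchange identities for the traciator\<close>

lemma traciator_mult_map:
  assumes [simp]: "x \<in> Obj M" "y \<in> Obj M"
  shows "traciator C M Z Tr \<epsilon> x y \<cdot>\<^bsub>C\<^esub> mult_map C M Z Tr \<epsilon> x y
    = mult_map C M Z Tr \<epsilon> y x \<cdot>\<^bsub>C\<^esub> \<beta>\<^bsub>C\<^esub> (OMap Tr x) (OMap Tr y) \<cdot>\<^bsub>C\<^esub> (ide\<^bsub>C\<^esub> (OMap Tr x) \<odot>\<^bsub>C\<^esub> \<theta>\<^bsub>C\<^esub> (OMap Tr y))"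
proof (rule mate_unique)
  let ?c = "OMap Tr x" and ?d = "OMap Tr y"
  let ?v = "OMap \<Phi> ?c" and ?w = "OMap \<Phi> ?d" and ?y = "Dual M y"
  let ?\<mu> = "mult_map C M Z Tr \<epsilon>" and ?\<tau> = "traciator C M Z Tr \<epsilon> x y"
  let ?m = "(\<epsilon> x \<odot> \<epsilon> y) \<cdot> (Ten \<Phi> ?c ?d)\<^sup>\<inverse>" and ?m' = "(\<epsilon> y \<odot> \<epsilon> x) \<cdot> (Ten \<Phi> ?d ?c)\<^sup>\<inverse>"
  let ?b = "\<beta>\<^bsub>C\<^esub> ?c ?d \<cdot>\<^bsub>C\<^esub> (ide\<^bsub>C\<^esub> ?c \<odot>\<^bsub>C\<^esub> \<theta>\<^bsub>C\<^esub> ?d)"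
  note \<mu> = mult_map_mate[of x y, OF assms] and \<mu>' = mult_map_mate[of y x, OF assms(2,1)]
  note \<tau> = traciator_mate[OF assms]
  have th: "\<theta>\<^bsub>C\<^esub> ?d \<in> Hom C ?d ?d"
    by (rule F.twist_hom) simp
  note [simp] = C.HomD[OF th] C.HomD[OF \<mu>(1)] C.HomD[OF \<mu>'(1)] C.HomD[OF \<tau>(1)]
  have b: "?b \<in> Hom C (?c \<otimes>\<^bsub>C\<^esub> ?d) (?d \<otimes>\<^bsub>C\<^esub> ?c)"
    by (auto intro!: C.HomI)
  show "?\<tau> \<cdot>\<^bsub>C\<^esub> ?\<mu> x y \<in> Hom C (?c \<otimes>\<^bsub>C\<^esub> ?d) (OMap Tr (y \<otimes> x))"
    "?\<mu> y x \<cdot>\<^bsub>C\<^esub> ?b \<in> Hom C (?c \<otimes>\<^bsub>C\<^esub> ?d) (OMap Tr (y \<otimes> x))"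
    by (auto intro!: C.HomI)
  show "y \<otimes> x \<in> Obj M" by simp
  have m: "?m \<in> Hom M (OMap \<Phi> (?c \<otimes>\<^bsub>C\<^esub> ?d)) (x \<otimes> y)"
    by (auto intro!: M.HomI)
  have r: "rot (?c \<otimes>\<^bsub>C\<^esub> ?d) x y ?m \<in> Hom M (OMap \<Phi> (?c \<otimes>\<^bsub>C\<^esub> ?d)) (y \<otimes> x)"
    by (rule rot_hom[OF assms _ m]) simp
  note [simp] = M.HomD[OF r]
  have m': "?m' \<cdot> AMap \<Phi> ?b \<in> Hom M (OMap \<Phi> (?c \<otimes>\<^bsub>C\<^esub> ?d)) (y \<otimes> x)"
    using C.HomD[OF b] by (auto intro!: M.HomI)
  let ?E = "zhb ?c y" and ?E' = "zhb ?d y" and ?ex = "emb M (\<epsilon> x)" and ?ey = "emb M (\<epsilon> y)"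
  have ey: "\<epsilon> y \<in> Hom M ?w y"
    by (rule adj.counit_hom) simp
  \<comment> \<open>The strand \<open>y\<close> crosses \<open>?w\<close>, the image of
    \<open>Tr y\<close>, before \<open>?v\<close>. This order puts the loop on the second
    factor.\<close>
  have i1: "[y] \<lhd> F.fsplit ?c ?d \<rhd> [] \<bullet> zhb (?c \<otimes>\<^bsub>C\<^esub> ?d) y = [] \<lhd> ?E \<rhd> [?w] \<bullet> [?v] \<lhd> ?E' \<rhd> [] \<bullet> [] \<lhd> F.fsplit ?c ?d \<rhd> [y]"
    using arg_cong[OF zhb_fmerge[of ?c ?d y], of "\<lambda>t. [y] \<lhd> F.fsplit ?c ?d \<rhd> [] \<bullet> t \<bullet> [] \<lhd> F.fsplit ?c ?d \<rhd> [y]"] by simp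
  have i1': "[y] \<lhd> F.fsplit ?c ?d \<rhd> [?y] \<bullet> [] \<lhd> zhb (?c \<otimes>\<^bsub>C\<^esub> ?d) y \<rhd> [?y]
      = [] \<lhd> ?E \<rhd> [?w, ?y] \<bullet> [?v] \<lhd> ?E' \<rhd> [?y] \<bullet> [] \<lhd> F.fsplit ?c ?d \<rhd> [y, ?y]"
    using M.whisker_eq[OF i1, of "[]" "[?y]"] by simp
  have i2: "[] \<lhd> F.fsplit ?c ?d \<rhd> [y, ?y] \<bullet> [OMap \<Phi> (?c \<otimes>\<^bsub>C\<^esub> ?d)] \<lhd> M.coev_cup y \<rhd> []
      = [?v, ?w] \<lhd> M.coev_cup y \<rhd> [] \<bullet> F.fsplit ?c ?d"
    using M.interchange[of "[]" "F.fsplit ?c ?d" "[]" "M.coev_cup y" "[]"] by simp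
  have i3: "[y, x] \<lhd> M.evt_cap y \<rhd> [] \<bullet> [y] \<lhd> ?ex \<rhd> [y, ?y] = [y] \<lhd> ?ex \<rhd> [] \<bullet> [y, ?v] \<lhd> M.evt_cap y \<rhd> []"
    using M.interchange[of "[y]" ?ex "[]" "M.evt_cap y" "[]"] by simp
  have i4: "[y, ?v] \<lhd> ?ey \<rhd> [?y] \<bullet> [] \<lhd> ?E \<rhd> [?w, ?y] = [] \<lhd> ?E \<rhd> [y, ?y] \<bullet> [?v, y] \<lhd> ?ey \<rhd> [?y]"
    using M.interchange[of "[]" ?E "[]" ?ey "[?y]"] by simp
  have i5: "[y, ?v] \<lhd> M.evt_cap y \<rhd> [] \<bullet> [] \<lhd> ?E \<rhd> [y, ?y] = ?E \<bullet> [?v, y] \<lhd> M.evt_cap y \<rhd> []"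
    using M.interchange[of "[]" ?E "[]" "M.evt_cap y" "[]"] by simp
  \<comment> \<open>By \<open>zhb_braid\<close> the self-crossing of \<open>?w\<close> is the image
    of the braiding, so its loop is the image of the twist.\<close>
  have tw: "F.femb (\<theta>\<^bsub>C\<^esub> ?d) = M.twist_diagram ?w (snd (OMap Z ?d))"
    by (rule F.femb_twist) (simp_all add: zhb_braid)
  have "[y] \<lhd> M.evt_cap y \<rhd> [] \<bullet> [y] \<lhd> ?ey \<rhd> [?y] \<bullet> [] \<lhd> ?E' \<rhd> [?y] \<bullet> [?w] \<lhd> M.coev_cup y \<rhd> []
      = ?ey \<bullet> F.femb (\<theta>\<^bsub>C\<^esub> ?d)"
    unfolding tw by (rule M.twist_loop[OF half_braiding_Z ey]) simp
  from M.whisker_eq[OF this, of "[?v]" "[]"]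
  have loop: "[?v, y] \<lhd> M.evt_cap y \<rhd> [] \<bullet> [?v, y] \<lhd> ?ey \<rhd> [?y] \<bullet> [?v] \<lhd> ?E' \<rhd> [?y] \<bullet> [?v, ?w] \<lhd> M.coev_cup y \<rhd> []
      = [?v] \<lhd> ?ey \<rhd> [] \<bullet> [?v] \<lhd> F.femb (\<theta>\<^bsub>C\<^esub> ?d) \<rhd> []"
    by simp
  \<comment> \<open>With the loop closed, \<open>\<epsilon> y\<close> passes the remaining crossing,
    which now has both strands in the image of \<open>\<Phi>\<close> and is the image of the
    braiding.\<close>
  have i6: "?E \<bullet> [?v] \<lhd> ?ey \<rhd> [] = [] \<lhd> ?ey \<rhd> [?v] \<bullet> zhb ?c ?w"
    by (rule M.hb_natural[OF half_braiding_Z _ ey]) simp_all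
  have i7: "[y] \<lhd> ?ex \<rhd> [] \<bullet> [] \<lhd> ?ey \<rhd> [?v] = [] \<lhd> ?ey \<rhd> [x] \<bullet> [?w] \<lhd> ?ex \<rhd> []"
    using M.interchange[of "[]" ?ey "[]" ?ex "[]"] by simp
  have "emb M (rot (?c \<otimes>\<^bsub>C\<^esub> ?d) x y ?m) = merge M y x \<bullet> [y, x] \<lhd> M.evt_cap y \<rhd> [] \<bullet> [y] \<lhd> ?ex \<rhd> [y, ?y] \<bullet>
      [y, ?v] \<lhd> ?ey \<rhd> [?y] \<bullet> [y] \<lhd> F.fsplit ?c ?d \<rhd> [?y] \<bullet>
      [] \<lhd> zhb (?c \<otimes>\<^bsub>C\<^esub> ?d) y \<rhd> [?y] \<bullet> [OMap \<Phi> (?c \<otimes>\<^bsub>C\<^esub> ?d)] \<lhd> M.coev_cup y \<rhd> []"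
    using M.emb_rotation[OF half_braiding_Z _ _ _ m] by (simp add: emb_counits)
  also have "\<dots> = merge M y x \<bullet> [y] \<lhd> ?ex \<rhd> [] \<bullet> ?E \<bullet> ([?v, y] \<lhd> M.evt_cap y \<rhd> [] \<bullet>
      [?v, y] \<lhd> ?ey \<rhd> [?y] \<bullet> [?v] \<lhd> ?E' \<rhd> [?y] \<bullet> [?v, ?w] \<lhd> M.coev_cup y \<rhd> []) \<bullet> F.fsplit ?c ?d"
    unfolding M.comp_extend[OF i1'] M.dcomp_assoc i2 M.comp_extend[OF i3] M.comp_extend[OF i4] M.comp_extend[OF i5] ..
  also have "\<dots> = merge M y x \<bullet> [] \<lhd> ?ey \<rhd> [x] \<bullet> [?w] \<lhd> ?ex \<rhd> [] \<bullet> zhb ?c ?w \<bullet>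
      [?v] \<lhd> F.femb (\<theta>\<^bsub>C\<^esub> ?d) \<rhd> [] \<bullet> F.fsplit ?c ?d"
    unfolding loop M.dcomp_assoc M.comp_extend[OF i6] M.comp_extend[OF i7] ..
  also have "\<dots> = emb M (?m' \<cdot> AMap \<Phi> ?b)"
  proof -
    have "emb M (?m' \<cdot> AMap \<Phi> ?b) = emb M ?m' \<bullet> F.femb ?b"
      using C.HomD[OF b] by (simp add: F.femb_def M.emb_comp)
    then show ?thesis
      by (simp add: emb_counits F.femb_simps zhb_braid)
  qed
  finally have *: "rot (?c \<otimes>\<^bsub>C\<^esub> ?d) x y ?m = ?m' \<cdot> AMap \<Phi> ?b"
    by (rule M.emb_faithful_Hom[OF r m'])
  have e: "\<epsilon> (y \<otimes> x) \<in> Hom M (OMap \<Phi> (OMap Tr (y \<otimes> x))) (y \<otimes> x)"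
    by (rule adj.counit_hom) simp
  have "\<epsilon> (y \<otimes> x) \<cdot> AMap \<Phi> (?\<tau> \<cdot>\<^bsub>C\<^esub> ?\<mu> x y) = (\<epsilon> (y \<otimes> x) \<cdot> AMap \<Phi> ?\<tau>) \<cdot> AMap \<Phi> (?\<mu> x y)"
    by (simp add: F.amap_comp)
  also have "\<dots> = rot (?c \<otimes>\<^bsub>C\<^esub> ?d) x y ?m"
    unfolding \<tau>(2) rot_natural[OF assms \<mu>(1) counit_tensor_hom[OF assms]] \<mu>(2) ..
  also have "\<dots> = (\<epsilon> (y \<otimes> x) \<cdot> AMap \<Phi> (?\<mu> y x)) \<cdot> AMap \<Phi> ?b"
    unfolding * \<mu>'(2) ..
  also have "\<dots> = \<epsilon> (y \<otimes> x) \<cdot> AMap \<Phi> (?\<mu> y x \<cdot>\<^bsub>C\<^esub> ?b)"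
    using M.comp_assoc[OF F.amap[OF b] F.amap[OF \<mu>'(1)] e] F.map_comp[OF b \<mu>'(1)] by simp
  finally show "\<epsilon> (y \<otimes> x) \<cdot> AMap \<Phi> (?\<tau> \<cdot>\<^bsub>C\<^esub> ?\<mu> x y) = \<epsilon> (y \<otimes> x) \<cdot> AMap \<Phi> (?\<mu> y x \<cdot>\<^bsub>C\<^esub> ?b)" .
qed

lemma traciator_minus_mult_map:
  assumes [simp]: "x \<in> Obj M" "y \<in> Obj M"
  shows "traciator_minus C M Z Tr \<epsilon> x y \<cdot>\<^bsub>C\<^esub> mult_map C M Z Tr \<epsilon> x y
    = mult_map C M Z Tr \<epsilon> y x \<cdot>\<^bsub>C\<^esub> \<beta>\<^sup>-\<^bsub>C\<^esub> (OMap Tr x) (OMap Tr y) \<cdot>\<^bsub>C\<^esub> ((\<theta>\<^bsub>C\<^esub> (OMap Tr x))\<^sup>\<inverse>\<^bsub>C\<^esub> \<odot>\<^bsub>C\<^esub> ide\<^bsub>C\<^esub> (OMap Tr y))"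
proof -
  let ?a = "OMap Tr x" and ?b = "OMap Tr y" and ?\<mu> = "mult_map C M Z Tr \<epsilon>" and ?\<tau> = "traciator C M Z Tr \<epsilon> y x"
  let ?\<beta> = "\<beta>\<^bsub>C\<^esub> ?b ?a" and ?\<theta> = "\<theta>\<^bsub>C\<^esub> ?a"
  let ?r = "?\<beta>\<^sup>\<inverse>\<^bsub>C\<^esub> \<cdot>\<^bsub>C\<^esub> (?\<theta>\<^sup>\<inverse>\<^bsub>C\<^esub> \<odot>\<^bsub>C\<^esub> ide\<^bsub>C\<^esub> ?b)"
  note \<mu> = mult_map_mate[of x y, OF assms] and \<mu>' = mult_map_mate[of y x, OF assms(2,1)]
  note \<tau> = traciator_mate[of y x, OF assms(2,1)]
  have th: "?\<theta> \<in> Hom C ?a ?a"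
    by (rule F.twist_hom) simp
  have [simp]: "is_iso C ?\<theta>" "is_iso C ?\<tau>"
    by (simp_all add: C.twist_is_iso traciator_iso)
  note [simp] = C.HomD[OF th] C.HomD[OF \<mu>(1)] C.HomD[OF \<mu>'(1)] C.HomD[OF \<tau>(1)]
  \<comment> \<open>Read for the pair \<open>y\<close>, \<open>x\<close>, the first identity has the
    twist of \<open>Tr x\<close> on the second factor; naturality of the braiding moves it to the
    first factor, where its inverse cancels it.\<close>
  have n: "?\<beta> \<cdot>\<^bsub>C\<^esub> (ide\<^bsub>C\<^esub> ?b \<odot>\<^bsub>C\<^esub> ?\<theta>) = (?\<theta> \<odot>\<^bsub>C\<^esub> ide\<^bsub>C\<^esub> ?b) \<cdot>\<^bsub>C\<^esub> ?\<beta>"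
    by (rule C.braid_natural[OF _ th]) (simp add: C.ide_hom)
  have "?\<tau> \<cdot>\<^bsub>C\<^esub> ?\<mu> y x \<cdot>\<^bsub>C\<^esub> ?r = (?\<tau> \<cdot>\<^bsub>C\<^esub> ?\<mu> y x) \<cdot>\<^bsub>C\<^esub> ?r"
    by simp
  also have "\<dots> = ?\<mu> x y \<cdot>\<^bsub>C\<^esub> (?\<beta> \<cdot>\<^bsub>C\<^esub> (ide\<^bsub>C\<^esub> ?b \<odot>\<^bsub>C\<^esub> ?\<theta>)) \<cdot>\<^bsub>C\<^esub> ?r"
    unfolding traciator_mult_map[OF assms(2,1)] by simp
  also have "\<dots> = ?\<mu> x y"
    unfolding n by (simp add: C.tensor_comp')
  finally have "?\<tau>\<^sup>\<inverse>\<^bsub>C\<^esub> \<cdot>\<^bsub>C\<^esub> ?\<mu> x y = ?\<tau>\<^sup>\<inverse>\<^bsub>C\<^esub> \<cdot>\<^bsub>C\<^esub> ?\<tau> \<cdot>\<^bsub>C\<^esub> ?\<mu> y x \<cdot>\<^bsub>C\<^esub> ?r"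
    by simp
  also have "\<dots> = ?\<mu> y x \<cdot>\<^bsub>C\<^esub> ?r"
    by simp
  finally show ?thesis
    by (simp add: traciator_minus_def braid_minus_def)
qed

end

theorem lemma4p26:
  fixes C :: "('o, 'm, 'u) bpivcat_scheme" (structure)
    and M :: "('p, 'n, 'v) pivcat_scheme"
    and Z :: "('o, 'm, 'p \<times> ('p \<Rightarrow> 'n), ('p \<times> ('p \<Rightarrow> 'n)) \<times> 'n \<times> ('p \<times> ('p \<Rightarrow> 'n))) tfun"
    and Tr :: "('p, 'n, 'o, 'm) cfun"
    and \<eta> :: "'o \<Rightarrow> 'm" and \<epsilon> :: "'p \<Rightarrow> 'n"
    and x y :: 'p
  assumes "braided_pivotal_category C"
    and "pivotal_category M"
    and "braided_pivotal_functor C (center M) Z"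
    and "adjunction C M (underlying M Z) Tr \<eta> \<epsilon>"
    and "x \<in> Obj M" and "y \<in> Obj M"
  shows "traciator C M Z Tr \<epsilon> x y \<cdot> mult_map C M Z Tr \<epsilon> x y
           = mult_map C M Z Tr \<epsilon> y x \<cdot> \<beta> (OMap Tr x) (OMap Tr y)
               \<cdot> (ide (OMap Tr x) \<odot> \<theta> (OMap Tr y))
       \<and> traciator_minus C M Z Tr \<epsilon> x y \<cdot> mult_map C M Z Tr \<epsilon> x y
           = mult_map C M Z Tr \<epsilon> y x \<cdot> \<beta>\<^sup>- (OMap Tr x) (OMap Tr y)
               \<cdot> ((\<theta> (OMap Tr x))\<^sup>\<inverse> \<odot> ide (OMap Tr y))"
proof -
  interpret central_adjunction C M Z Tr \<eta> \<epsilon>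
    by (rule central_adjunction.intro, rule central_functor.intro) (rule assms)+
  show ?thesis
    using traciator_mult_map[OF assms(5,6)] traciator_minus_mult_map[OF assms(5,6)] by simp
qed

end
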